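(* Let $\Omega\subset\mathbb{R}^N$ be bounded and $p$ log-Hölder continuous in $\Omega$. Let $u\in W^{1,p(x)}(\Omega)$ be such that $\Delta_{p(x)}u\ge-H(x)(|u|+1)^{p(x)-1}$ in $\Omega$, with $0\le H\in L^{q_0(x)}(\Omega)$, where $q_0\in C(\Omega)$ and $\max\{1,\frac{N}{p(x)}\}<q_0(x)$ for every $x\in\Omega$. Let $\Omega'\subset\subset\Omega$. Then $u$ is bounded from above in $\Omega'$. More precisely, for every $0<t<\infty$, $$\sup_{\Omega'}u\le\widetilde C\Big[1+\|u\|_{L^t(\Omega'')}\Big],$$ where $\Omega''=\{x\in\Omega:\mathrm{dist}(x,\Omega')<\frac12\mathrm{dist}(\Omega',\partial\Omega)\}$. Here $\widetilde C$ depends on $t$, $\Omega'$, $p(x)$, $q_0(x)$, $\||H|^{q_0(x)}\|_{L^1(\Omega)}$ and $\||u|^{p(x)}\|_{L^1(\Omega)}$. If instead $\Delta_{p(x)}u\le H(x)(|u|+1)^{p(x)-1}$ in $\Omega$ (with $H$, $q_0$ as before), then $u$ is bounded from below in $\Omega'$ by $-\widetilde C\big[1+\|u\|_{L^t(\Omega'')}\big]$.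
   Context: $N$ is the spatial dimension. Standing assumptions on the exponent: $1<p_1\le p(x)\le p_2<\infty$ in $\Omega$ and $p$ is continuous up to the boundary. $p$ is log-Hölder continuous in $\Omega$ if $|p(x)-p(y)|\le\omega(|x-y|)$ for all $x,y$ in any ball $B_R(x_0)\subset\Omega$, with a modulus $\omega$ independent of the ball satisfying $\omega(r)=C/|\log r|$ for $0<r\le1/2$. For a variable exponent $m(x)$, $L^{m(x)}(\Omega)$ is the set of measurable $u$ with $|u|^{m(x)}\in L^1(\Omega)$; $\|u\|_{p(\cdot)}=\inf\{\lambda>0:\int_\Omega(|u(x)|/\lambda)^{p(x)}dx\le1\}$. $W^{1,p(x)}(\Omega)$ is the set of $u\in L^{p(x)}(\Omega)$ with distributional gradient in $L^{p(x)}(\Omega)$, with norm $\|u\|_{p(\cdot)}+\||\nabla u|\|_{p(\cdot)}$; $W_0^{1,p(x)}(\Omega)$ is the closure in it of its compactly supported elements. $\Delta_{p(x)}u=\mathrm{div}(|\nabla u|^{p(x)-2}\nabla u)$, and inequalities are in the weak sense: $\Delta_{p(x)}u\ge F$ (resp. $\le F$) means $-\int_\Omega|\nabla u|^{p(x)-2}\nabla u\cdot\nabla\phi\,dx\ge\int_\Omega F\phi\,dx$ (resp. $\le$) for every $0\le\phi\in L^\infty(\Omega)\cap W_0^{1,p(x)}(\Omega)$. Suprema and infima of $u$ are essential ones. *)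

theory Defs
  imports "HOL-Probability.Essential_Supremum"
begin

section \<open>Test functions and weak gradients\<close>

primrec Ck :: "nat \<Rightarrow> ('a::euclidean_space \<Rightarrow> real) \<Rightarrow> bool" where
  "Ck 0 f \<longleftrightarrow> continuous_on UNIV f"
| "Ck (Suc k) f \<longleftrightarrow>
     f differentiable_on UNIV \<and> (\<forall>b\<in>Basis. Ck k (\<lambda>x. frechet_derivative f (at x) b))"

definition test_functions :: "'a::euclidean_space set \<Rightarrow> ('a \<Rightarrow> real) set" where
  "test_functions \<Omega> =
     {\<phi>. (\<forall>k. Ck k \<phi>) \<and> compact (closure {x. \<phi> x \<noteq> 0}) \<and> closure {x. \<phi> x \<noteq> 0} \<subseteq> \<Omega>}"

definition locally_integrable ::
  "'a::euclidean_space set \<Rightarrow> ('a \<Rightarrow> 'b::euclidean_space) \<Rightarrow> bool" where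
  "locally_integrable \<Omega> f \<longleftrightarrow>
     f \<in> borel_measurable (lebesgue_on \<Omega>) \<and>
     (\<forall>K. compact K \<and> K \<subseteq> \<Omega> \<longrightarrow> integrable (lebesgue_on K) f)"

definition has_weak_gradient ::
  "'a::euclidean_space set \<Rightarrow> ('a \<Rightarrow> real) \<Rightarrow> ('a \<Rightarrow> 'a) \<Rightarrow> bool" where
  "has_weak_gradient \<Omega> u G \<longleftrightarrow>
     locally_integrable \<Omega> u \<and> locally_integrable \<Omega> G \<and>
     (\<forall>\<phi>\<in>test_functions \<Omega>. \<forall>b\<in>Basis.
        (LINT x|lebesgue_on \<Omega>. u x * frechet_derivative \<phi> (at x) b)
          = - (LINT x|lebesgue_on \<Omega>. \<phi> x * (G x \<bullet> b)))"

text \<open>A weak gradient is unique up to null sets, and only integrals of it occur below, so the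
  choice of representative is immaterial.\<close>

definition weak_grad :: "'a::euclidean_space set \<Rightarrow> ('a \<Rightarrow> real) \<Rightarrow> 'a \<Rightarrow> 'a" where
  "weak_grad \<Omega> u = (SOME G. has_weak_gradient \<Omega> u G)"

section \<open>Variable exponent spaces\<close>

text \<open>Functions are total, and only their values on the set of definition matter; elements of the
  spaces are functions rather than classes modulo null sets.\<close>

definition Lp_var ::
  "'a::euclidean_space set \<Rightarrow> ('a \<Rightarrow> real) \<Rightarrow> ('a \<Rightarrow> 'b::euclidean_space) set" where
  "Lp_var \<Omega> m =
     {f \<in> borel_measurable (lebesgue_on \<Omega>). integrable (lebesgue_on \<Omega>) (\<lambda>x. norm (f x) powr m x)}"

definition modular ::
  "'a::euclidean_space set \<Rightarrow> ('a \<Rightarrow> real) \<Rightarrow> ('a \<Rightarrow> real) \<Rightarrow> real" where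
  "modular \<Omega> m f = (LINT x|lebesgue_on \<Omega>. \<bar>f x\<bar> powr m x)"

definition luxemburg_norm ::
  "'a::euclidean_space set \<Rightarrow> ('a \<Rightarrow> real) \<Rightarrow> ('a \<Rightarrow> 'b::euclidean_space) \<Rightarrow> real" where
  "luxemburg_norm \<Omega> p f =
     Inf {l. 0 < l \<and> (\<integral>\<^sup>+x. ennreal ((norm (f x) / l) powr p x) \<partial>lebesgue_on \<Omega>) \<le> 1}"

definition W1p :: "'a::euclidean_space set \<Rightarrow> ('a \<Rightarrow> real) \<Rightarrow> ('a \<Rightarrow> real) set" where
  "W1p \<Omega> p = {u \<in> Lp_var \<Omega> p. (\<exists>G. has_weak_gradient \<Omega> u G) \<and> weak_grad \<Omega> u \<in> Lp_var \<Omega> p}"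

definition W1p_norm :: "'a::euclidean_space set \<Rightarrow> ('a \<Rightarrow> real) \<Rightarrow> ('a \<Rightarrow> real) \<Rightarrow> real" where
  "W1p_norm \<Omega> p u = luxemburg_norm \<Omega> p u + luxemburg_norm \<Omega> p (weak_grad \<Omega> u)"

definition W1p_compact :: "'a::euclidean_space set \<Rightarrow> ('a \<Rightarrow> real) \<Rightarrow> ('a \<Rightarrow> real) set" where
  "W1p_compact \<Omega> p =
     {u \<in> W1p \<Omega> p. \<exists>K. compact K \<and> K \<subseteq> \<Omega> \<and> (AE x in lebesgue_on \<Omega>. x \<notin> K \<longrightarrow> u x = 0)}"

definition W01p :: "'a::euclidean_space set \<Rightarrow> ('a \<Rightarrow> real) \<Rightarrow> ('a \<Rightarrow> real) set" where
  "W01p \<Omega> p =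
     {u \<in> W1p \<Omega> p. \<forall>\<epsilon>>0. \<exists>v\<in>W1p_compact \<Omega> p. W1p_norm \<Omega> p (\<lambda>x. u x - v x) < \<epsilon>}"

definition Linfty :: "'a::euclidean_space set \<Rightarrow> ('a \<Rightarrow> real) set" where
  "Linfty \<Omega> = {f \<in> borel_measurable (lebesgue_on \<Omega>). \<exists>M. AE x in lebesgue_on \<Omega>. \<bar>f x\<bar> \<le> M}"

text \<open>The \<open>L\<^sup>t\<close> (quasi-)norm, with the value \<open>\<infinity>\<close> if \<open>f\<close> is not in \<open>L\<^sup>t\<close>.\<close>

definition Lt_norm :: "real \<Rightarrow> 'a::euclidean_space set \<Rightarrow> ('a \<Rightarrow> real) \<Rightarrow> ereal" where
  "Lt_norm t A f =
     (if f \<in> Lp_var A (\<lambda>_. t) then ereal (modular A (\<lambda>_. t) f powr (1 / t)) else \<infinity>)"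

definition log_holder :: "'a::euclidean_space set \<Rightarrow> ('a \<Rightarrow> real) \<Rightarrow> bool" where
  "log_holder \<Omega> p \<longleftrightarrow>
     (\<exists>\<omega> C. (\<forall>r. 0 < r \<and> r \<le> 1/2 \<longrightarrow> \<omega> r = C / \<bar>ln r\<bar>) \<and>
        (\<forall>x0 R. ball x0 R \<subseteq> \<Omega> \<longrightarrow>
           (\<forall>x\<in>ball x0 R. \<forall>y\<in>ball x0 R. \<bar>p x - p y\<bar> \<le> \<omega> (norm (x - y)))))"

section \<open>Weak inequalities for the \<open>p(x)\<close>-Laplacian\<close>

text \<open>Integral with values in \<open>[-\<infinity>,\<infinity>]\<close> of the difference of positive and negative part; it is the
  usual one whenever one of the two parts has finite integral, in particular for functions of
  constant sign. (Elsewhere \<open>\<infinity> - \<infinity> = \<infinity>\<close>, so it should not be used.)  It is needed because the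
  right-hand side \<open>F * \<phi>\<close> below need not be integrable for every admissible \<open>\<phi>\<close>, and the Bochner
  integral would then be \<open>0\<close>.\<close>

definition ext_integral :: "'a measure \<Rightarrow> ('a \<Rightarrow> real) \<Rightarrow> ereal" where
  "ext_integral M f =
     enn2ereal (\<integral>\<^sup>+x. ennreal (f x) \<partial>M) - enn2ereal (\<integral>\<^sup>+x. ennreal (- f x) \<partial>M)"

definition admissible :: "'a::euclidean_space set \<Rightarrow> ('a \<Rightarrow> real) \<Rightarrow> ('a \<Rightarrow> real) set" where
  "admissible \<Omega> p = {\<phi> \<in> Linfty \<Omega> \<inter> W01p \<Omega> p. AE x in lebesgue_on \<Omega>. 0 \<le> \<phi> x}"

text \<open>Where the gradient vanishes the vector field \<open>|\<nabla>u|\<^sup>p\<^sup>-\<^sup>2\<nabla>u\<close> is zero.\<close>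

definition plap_form ::
  "'a::euclidean_space set \<Rightarrow> ('a \<Rightarrow> real) \<Rightarrow> ('a \<Rightarrow> real) \<Rightarrow> ('a \<Rightarrow> real) \<Rightarrow> real" where
  "plap_form \<Omega> p u \<phi> =
     (LINT x|lebesgue_on \<Omega>.
        norm (weak_grad \<Omega> u x) powr (p x - 2) * (weak_grad \<Omega> u x \<bullet> weak_grad \<Omega> \<phi> x))"

definition plap_ge ::
  "'a::euclidean_space set \<Rightarrow> ('a \<Rightarrow> real) \<Rightarrow> ('a \<Rightarrow> real) \<Rightarrow> ('a \<Rightarrow> real) \<Rightarrow> bool" where
  "plap_ge \<Omega> p u F \<longleftrightarrow>
     (\<forall>\<phi>\<in>admissible \<Omega> p.
        ereal (- plap_form \<Omega> p u \<phi>) \<ge> ext_integral (lebesgue_on \<Omega>) (\<lambda>x. F x * \<phi> x))"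

definition plap_le ::
  "'a::euclidean_space set \<Rightarrow> ('a \<Rightarrow> real) \<Rightarrow> ('a \<Rightarrow> real) \<Rightarrow> ('a \<Rightarrow> real) \<Rightarrow> bool" where
  "plap_le \<Omega> p u F \<longleftrightarrow>
     (\<forall>\<phi>\<in>admissible \<Omega> p.
        ereal (- plap_form \<Omega> p u \<phi>) \<le> ext_integral (lebesgue_on \<Omega>) (\<lambda>x. F x * \<phi> x))"

section \<open>Essential bounds and the intermediate set\<close>

definition ess_sup_on :: "'a::euclidean_space set \<Rightarrow> ('a \<Rightarrow> real) \<Rightarrow> ereal" where
  "ess_sup_on A u = esssup (lebesgue_on A) (\<lambda>x. ereal (u x))"

definition ess_inf_on :: "'a::euclidean_space set \<Rightarrow> ('a \<Rightarrow> real) \<Rightarrow> ereal" where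
  "ess_inf_on A u = - ess_sup_on A (\<lambda>x. - u x)"

definition half_nbhd :: "'a::euclidean_space set \<Rightarrow> 'a set \<Rightarrow> 'a set" where
  "half_nbhd \<Omega> \<Omega>' = {x \<in> \<Omega>. infdist x \<Omega>' < setdist \<Omega>' (frontier \<Omega>) / 2}"

end

theory Submission
  imports Defs
begin

text \<open>De Giorgi's iteration on balls so small that the exponent oscillates little.  On such a ball
  the Sobolev exponent of \<open>min p\<close> exceeds \<open>(max p) q'\<close>, where \<open>q'\<close> is conjugate to \<open>inf q\<^sub>0\<close>, so
  the terms on the right of the Caccioppoli inequality for the truncations \<open>max 0 (u - k)\<close> are
  subordinate to the gradient.  Testing with a cut off solution gives a bound on \<open>u\<close> in a
  Lebesgue space beyond \<open>L\<^sup>P\<^sup>q\<^sup>'\<close>, in terms of the modulars of \<open>H\<close> and \<open>u\<close> only, and iterating over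
  increasing levels and shrinking balls turns it into a supremum bound.  Finitely many balls cover
  the closure of \<open>\<Omega>'\<close>, and the bound from below is the bound from above for \<open>- u\<close>.\<close>

section \<open>Smooth cutoff functions\<close>

text \<open>The variable exponent destroys homogeneity. Multiples of a subsolution need not satisfy
  the same inequality, and on a ball the gradient is controlled only in the power \<open>s\<close>,
  while the right-hand side carries the larger power \<open>P\<close>. An energy estimate thus
  bounds a quantity by a higher power of itself, which shrinking the ball alone does not cure. For
  this reason the argument has two stages. The preliminary bound replaces part of the power
  \<open>P\<close> by the modular of \<open>u\<close>, which is given, so that what remains is
  sublinear and can be absorbed. Once a starting value is available, the higher power becomes an
  advantage: it is the exponent \<open>1 + \<alpha>\<close> of the recursion, and the height
  \<open>K\<close> of the levels is chosen after the starting value. The constant therefore depends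
  on the modulars.

  Two requirements shape the statements. Constants have to be fixed before \<open>u\<close> and
  \<open>H\<close>, so each estimate first produces its constant and then quantifies over
  subsolutions. Test functions have to be bounded, so an excess over a level is truncated from above
  as well before it is used in the weak inequality, and the truncation height tends to infinity
  afterwards.\<close>

lemma Ck_const: "Ck k (\<lambda>x::'a::euclidean_space. c)"
  by (induction k arbitrary: c) auto

lemma Ck_Suc_imp: "Ck (Suc k) f \<Longrightarrow> Ck k f"
proof (induction k arbitrary: f)
  case 0
  then show ?case by (simp add: differentiable_imp_continuous_on)
next
  case (Suc k)
  then show ?case by (metis Ck.simps(2))
qed

lemma Ck_Suc_has_derivative:
  fixes f :: "'a::euclidean_space \<Rightarrow> real"
  assumes "Ck (Suc k) f"
  shows "(f has_derivative frechet_derivative f (at x)) (at x)"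
proof -
  have "f differentiable (at x)"
    using assms by (auto simp: differentiable_on_def)
  then show ?thesis by (simp add: frechet_derivative_works)
qed

text \<open>\<open>frechet_derivative\<close> is defined by choice. This rule lets the closure
  properties below name their derivatives explicitly.\<close>

lemma Ck_SucI:
  fixes f :: "'a::euclidean_space \<Rightarrow> real"
  assumes "\<And>x. (f has_derivative f' x) (at x)" "\<And>b. b \<in> Basis \<Longrightarrow> Ck k (\<lambda>x. f' x b)"
  shows "Ck (Suc k) f"
proof -
  have "frechet_derivative f (at x) = f' x" for x
    using frechet_derivative_at[OF assms(1)] by simp
  moreover have "f differentiable_on UNIV"
    using assms(1) by (auto simp: differentiable_on_def differentiable_def)
  ultimately show ?thesis using assms(2) by simp
qed

lemma Ck_add: "Ck k f \<Longrightarrow> Ck k g \<Longrightarrow> Ck k (\<lambda>x. f x + g x)"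
proof (induction k arbitrary: f g)
  case 0
  then show ?case by (simp add: continuous_on_add)
next
  case (Suc k)
  show ?case
  proof (rule Ck_SucI)
    show "((\<lambda>x. f x + g x) has_derivative
        (\<lambda>h. frechet_derivative f (at x) h + frechet_derivative g (at x) h)) (at x)" for x
      using Suc.prems by (intro has_derivative_add Ck_Suc_has_derivative)
    show "b \<in> Basis \<Longrightarrow>
        Ck k (\<lambda>x. frechet_derivative f (at x) b + frechet_derivative g (at x) b)" for b
      using Suc.prems by (intro Suc.IH) auto
  qed
qed

lemma Ck_mult: "Ck k f \<Longrightarrow> Ck k g \<Longrightarrow> Ck k (\<lambda>x. f x * g x)"
proof (induction k arbitrary: f g)
  case 0
  then show ?case by (simp add: continuous_on_mult)
next
  case (Suc k)
  note C = Suc.prems[THEN Ck_Suc_imp]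
  show ?case
  proof (rule Ck_SucI)
    show "((\<lambda>x. f x * g x) has_derivative
        (\<lambda>h. f x * frechet_derivative g (at x) h + frechet_derivative f (at x) h * g x)) (at x)" for x
      using Suc.prems by (intro has_derivative_mult Ck_Suc_has_derivative)
    show "b \<in> Basis \<Longrightarrow>
        Ck k (\<lambda>x. f x * frechet_derivative g (at x) b + frechet_derivative f (at x) b * g x)" for b
      using Suc.prems C by (intro Ck_add Suc.IH) auto
  qed
qed

lemma Ck_cmult: "Ck k f \<Longrightarrow> Ck k (\<lambda>x. c * f x)"
  by (intro Ck_mult Ck_const)

lemma Ck_uminus: "Ck k f \<Longrightarrow> Ck k (\<lambda>x. - f x)"
  using Ck_cmult[of k f "-1"] by simp

lemma Ck_diff: "Ck k f \<Longrightarrow> Ck k g \<Longrightarrow> Ck k (\<lambda>x. f x - g x)"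
  using Ck_add[OF _ Ck_uminus] by fastforce

lemma Ck_power: "Ck k f \<Longrightarrow> Ck k (\<lambda>x. f x ^ n)"
  by (induction n) (auto intro: Ck_const Ck_mult)

lemma Ck_prod: "finite A \<Longrightarrow> (\<And>a. a \<in> A \<Longrightarrow> Ck k (f a)) \<Longrightarrow> Ck k (\<lambda>x. \<Prod>a\<in>A. f a x)"
  by (induction A rule: finite_induct) (auto intro: Ck_const Ck_mult)

lemma Ck_inner: "Ck k (\<lambda>x::'a::euclidean_space. x \<bullet> c)"
proof (cases k)
  case 0
  then show ?thesis by (auto intro!: continuous_intros)
next
  case (Suc n)
  show ?thesis unfolding Suc
  proof (rule Ck_SucI)
    show "((\<lambda>x. x \<bullet> c) has_derivative (\<lambda>h. h \<bullet> c)) (at x)" for x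
      by (auto intro!: derivative_eq_intros)
  qed (rule Ck_const)
qed

lemma Ck_norm_square: "Ck k (\<lambda>x::'a::euclidean_space. (norm (x - c))\<^sup>2)"
proof (cases k)
  case 0
  then show ?thesis by (auto intro!: continuous_intros)
next
  case (Suc n)
  show ?thesis unfolding Suc
  proof (rule Ck_SucI)
    show "((\<lambda>x. (norm (x - c))\<^sup>2) has_derivative (\<lambda>h. 2 * (x \<bullet> h) - 2 * (c \<bullet> h))) (at x)" for x
      unfolding power2_norm_eq_inner
      by (auto intro!: derivative_eq_intros simp: algebra_simps inner_commute)
    show "Ck n (\<lambda>x. 2 * (x \<bullet> b) - 2 * (c \<bullet> b))" for b
      by (intro Ck_diff Ck_cmult Ck_inner Ck_const)
  qed
qed

text \<open>The sequence \<open>f\<close> packages a smooth function of one variable with all its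
  derivatives. The chain rule leads from \<open>f n\<close> to \<open>f (Suc n)\<close>, so the
  induction on \<open>k\<close> never leaves the family.\<close>

lemma Ck_compose:
  assumes f: "\<And>n x. (f n has_real_derivative f (Suc n) x) (at x)"
  shows "Ck k u \<Longrightarrow> Ck k (\<lambda>x. f n (u x))"
proof (induction k arbitrary: n u)
  case 0
  have "continuous_on UNIV (f n)"
    using f by (meson DERIV_continuous_on has_field_derivative_at_within)
  then show ?case using 0
    by (auto intro: continuous_on_compose2)
next
  case (Suc k)
  note C = Suc.prems[THEN Ck_Suc_imp]
  show ?case
  proof (rule Ck_SucI)
    show "((\<lambda>x. f n (u x)) has_derivative
        (\<lambda>h. f (Suc n) (u x) * frechet_derivative u (at x) h)) (at x)" for x
      using has_derivative_compose[OF Ck_Suc_has_derivative[OF Suc.prems]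
          f[unfolded has_field_derivative_def]] by (simp add: mult.commute)
    show "b \<in> Basis \<Longrightarrow> Ck k (\<lambda>x. f (Suc n) (u x) * frechet_derivative u (at x) b)" for b
      using Suc.prems C by (intro Ck_mult Suc.IH) auto
  qed
qed

section \<open>Functions that are flat at the origin, and a smooth step\<close>

definition flat_poly :: "real poly \<Rightarrow> real \<Rightarrow> real" where
  "flat_poly P x = (if x \<le> 0 then 0 else poly P (1 / x) * exp (- (1 / x)))"

lemma poly_exp_tendsto_0: "((\<lambda>y. poly P y * exp (- y)) \<longlongrightarrow> (0::real)) at_top"
proof -
  have "((\<lambda>y. \<Sum>i\<le>degree P. coeff P i * (y ^ i / exp y)) \<longlongrightarrow> (\<Sum>i\<le>degree P. coeff P i * 0)) at_top"
    by (intro tendsto_sum tendsto_mult tendsto_const tendsto_power_div_exp_0)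
  then show ?thesis
    by (simp add: poly_altdef sum_distrib_right exp_minus divide_inverse mult.assoc)
qed

text \<open>The products P(1/x) exp(-1/x), extended by 0, are closed under differentiation, which
  yields derivatives of every order at once. With y = 1/x, the factor \<open>[:0,0,1:]\<close> is
  y^2, the inner derivative up to sign, and \<open>P - pderiv P\<close> comes from the product
  rule.\<close>

lemma flat_poly_has_derivative:
  "(flat_poly P has_real_derivative flat_poly ([:0,0,1:] * (P - pderiv P)) x) (at x)"
proof -
  consider "x < 0" | "x > 0" | "x = 0" by linarith
  then show ?thesis
  proof cases
    case 1
    have "((\<lambda>x. 0) has_real_derivative 0) (at x)" by simp
    then have "(flat_poly P has_real_derivative 0) (at x)"
      by (rule has_field_derivative_transform_within_open[of _ _ _ "{..<0}"])
        (use 1 in \<open>auto simp: flat_poly_def\<close>)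
    then show ?thesis using 1 by (simp add: flat_poly_def)
  next
    case 2
    have "((\<lambda>x. poly P (1 / x) * exp (- (1 / x))) has_real_derivative
        poly ([:0,0,1:] * (P - pderiv P)) (1 / x) * exp (- (1 / x))) (at x)"
      using 2
      by (auto intro!: derivative_eq_intros DERIV_chain2[where f = "poly P"] poly_DERIV
          simp: field_simps power2_eq_square)
    then have "(flat_poly P has_real_derivative
        poly ([:0,0,1:] * (P - pderiv P)) (1 / x) * exp (- (1 / x))) (at x)"
      by (rule has_field_derivative_transform_within_open[of _ _ _ "{0<..}"])
        (use 2 in \<open>auto simp: flat_poly_def\<close>)
    then show ?thesis using 2 by (simp add: flat_poly_def)
  next
    case 3
    \<comment> \<open>The difference quotient at 0 carries one more factor 1/h, which
      \<open>pCons 0 P\<close> takes up. The exponential beats this polynomial as well.\<close>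
    have "((\<lambda>h. poly (pCons 0 P) (1 / h) * exp (- (1 / h))) \<longlongrightarrow> 0) (at_right 0)"
      by (rule filterlim_compose[OF poly_exp_tendsto_0])
        (simp add: filterlim_inverse_at_top_right flip: inverse_eq_divide)
    then have r: "((\<lambda>h. flat_poly P h / h) \<longlongrightarrow> 0) (at_right 0)"
      by (rule tendsto_cong[THEN iffD1, rotated])
        (auto simp: eventually_at_right_field flat_poly_def intro!: exI[of _ 1])
    have "((\<lambda>h. 0) \<longlongrightarrow> (0::real)) (at_left 0)" by simp
    then have l: "((\<lambda>h. flat_poly P h / h) \<longlongrightarrow> 0) (at_left 0)"
      by (rule tendsto_cong[THEN iffD1, rotated])
        (auto simp: eventually_at_left_field flat_poly_def intro!: exI[of _ "-1"])
    have "((\<lambda>h. flat_poly P h / h) \<longlongrightarrow> 0) (at 0)"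
      using l r filterlim_split_at_real by blast
    then show ?thesis using 3 by (simp add: DERIV_def flat_poly_def)
  qed
qed

definition flat :: "real \<Rightarrow> real" where
  "flat = flat_poly 1"

lemma Ck_flat:
  assumes "Ck k u"
  shows "Ck k (\<lambda>x. flat (u x))"
proof -
  define f where "f n = flat_poly (((\<lambda>P. [:0,0,1:] * (P - pderiv P)) ^^ n) 1)" for n
  have "Ck k (\<lambda>x. f 0 (u x))"
    by (rule Ck_compose[OF _ assms]) (unfold f_def funpow.simps o_def, rule flat_poly_has_derivative)
  then show ?thesis by (simp add: f_def flat_def)
qed

lemma flat_altdef: "flat x = (if x \<le> 0 then 0 else exp (- (1 / x)))"
  by (simp add: flat_def flat_poly_def)

definition flat' :: "real \<Rightarrow> real" where
  "flat' x = (if x \<le> 0 then 0 else (1 / x)\<^sup>2 * exp (- (1 / x)))"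

lemma flat_has_derivative: "(flat has_real_derivative flat' x) (at x)"
proof -
  have "flat' x = flat_poly ([:0,0,1:] * (1 - pderiv 1)) x"
    by (auto simp: flat'_def flat_poly_def power2_eq_square)
  then show ?thesis
    unfolding flat_def using flat_poly_has_derivative[of 1 x] by simp
qed

text \<open>With y = 1/x the upper bound reads y^2 / 2 \<le> exp y, and the left side is a term of
  the exponential series.\<close>

lemma flat'_bounds: "0 \<le> flat' x" "flat' x \<le> 2"
proof -
  have "(1 / x)\<^sup>2 * exp (- (1 / x)) \<le> 2" if "x > 0"
  proof -
    have "(1 / x)\<^sup>2 / 2 \<le> exp (1 / x)"
      using exp_lower_Taylor_quadratic[of "1 / x"] that
      by (smt (verit) zero_le_divide_1_iff)
    then have "(1 / x)\<^sup>2 \<le> 2 * exp (1 / x)" by simp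
    then have "(1 / x)\<^sup>2 * exp (- (1 / x)) \<le> 2 * exp (1 / x) * exp (- (1 / x))"
      by (intro mult_right_mono) auto
    then show ?thesis by (simp add: mult.assoc flip: exp_add)
  qed
  then show "0 \<le> flat' x" "flat' x \<le> 2" by (auto simp: flat'_def)
qed

text \<open>A composition of two flat functions is a smooth step that needs no quotient, so that its
  smoothness only requires the chain rule.\<close>

definition smooth_step :: "real \<Rightarrow> real" where
  "smooth_step t = 1 - exp 1 * flat (1 - exp 1 * flat t)"

lemma Ck_smooth_step: "Ck k u \<Longrightarrow> Ck k (\<lambda>x. smooth_step (u x))"
  unfolding smooth_step_def by (intro Ck_diff Ck_cmult Ck_const Ck_flat)

lemma flat_nonneg: "0 \<le> flat x" by (simp add: flat_altdef)

lemma flat_le: "x \<le> 1 \<Longrightarrow> flat x \<le> exp (- 1)"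
  by (auto simp: flat_altdef field_simps)

lemma flat_ge: "x \<ge> 1 \<Longrightarrow> flat x \<ge> exp (- 1)"
  by (auto simp: flat_altdef field_simps)

text \<open>The factors \<open>exp 1\<close> normalise \<open>flat 1 = exp (- 1)\<close> to 1. For t
  \<le> 0 the inner argument is 1, so the subtracted term is exactly 1. For t \<ge> 1 the inner
  argument is at most 0 and the subtracted term vanishes.\<close>

lemma smooth_step_0: "t \<le> 0 \<Longrightarrow> smooth_step t = 0"
  by (simp add: smooth_step_def flat_altdef flip: exp_add)

lemma smooth_step_1:
  assumes "t \<ge> 1" shows "smooth_step t = 1"
proof -
  have "exp 1 * exp (- 1) \<le> exp 1 * flat t"
    using flat_ge[OF assms] by (intro mult_left_mono) auto
  then have "1 - exp 1 * flat t \<le> 0" by (simp flip: exp_add)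
  then show ?thesis by (simp add: smooth_step_def flat_altdef[of "1 - exp 1 * flat t"])
qed

lemma smooth_step_bounds: "0 \<le> smooth_step t" "smooth_step t \<le> 1"
proof -
  have "exp 1 * flat (1 - exp 1 * flat t) \<le> exp 1 * exp (- 1)"
    by (intro mult_left_mono flat_le) (auto simp: flat_nonneg)
  then show "0 \<le> smooth_step t" by (simp add: smooth_step_def flip: exp_add)
  show "smooth_step t \<le> 1" by (simp add: smooth_step_def flat_nonneg)
qed

definition smooth_step' :: "real \<Rightarrow> real" where
  "smooth_step' t = (exp 1)\<^sup>2 * flat' (1 - exp 1 * flat t) * flat' t"

lemma smooth_step_has_derivative: "(smooth_step has_real_derivative smooth_step' t) (at t)"
  unfolding smooth_step_def[abs_def] smooth_step'_def
  by (rule derivative_eq_intros DERIV_chain2[OF flat_has_derivative] flat_has_derivative refl)+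
    (simp add: power2_eq_square)

text \<open>Each of the two nested copies of \<open>flat\<close> contributes a derivative of at most
  2 and a normalising factor \<open>exp 1\<close>.\<close>

lemma smooth_step'_bound: "\<bar>smooth_step' t\<bar> \<le> 4 * (exp 1)\<^sup>2"
proof -
  have "flat' (1 - exp 1 * flat t) * flat' t \<le> 2 * 2"
    by (intro mult_mono flat'_bounds) auto
  then show ?thesis
    using flat'_bounds by (simp add: smooth_step'_def abs_mult mult.assoc)
qed

section \<open>Gradients of smooth functions and compact support\<close>

definition smooth :: "('a::euclidean_space \<Rightarrow> real) \<Rightarrow> bool" where
  "smooth f \<longleftrightarrow> (\<forall>k. Ck k f)"

definition grad :: "('a::euclidean_space \<Rightarrow> real) \<Rightarrow> 'a \<Rightarrow> 'a" where
  "grad f x = (\<Sum>b\<in>Basis. frechet_derivative f (at x) b *\<^sub>R b)"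

lemma smooth_has_derivative: "smooth f \<Longrightarrow> (f has_derivative (\<lambda>h. grad f x \<bullet> h)) (at x)"
proof -
  assume "smooth f"
  then have D: "(f has_derivative frechet_derivative f (at x)) (at x)"
    unfolding smooth_def using Ck_Suc_has_derivative by blast
  then have l: "linear (frechet_derivative f (at x))"
    by (rule has_derivative_linear)
  have "frechet_derivative f (at x) h = grad f x \<bullet> h" for h
  proof -
    have "frechet_derivative f (at x) h = frechet_derivative f (at x) (\<Sum>b\<in>Basis. (h \<bullet> b) *\<^sub>R b)"
      by (simp add: euclidean_representation)
    also have "\<dots> = (\<Sum>b\<in>Basis. (h \<bullet> b) * frechet_derivative f (at x) b)"
      using l by (simp add: linear_sum linear_cmul)
    also have "\<dots> = grad f x \<bullet> h"
      unfolding grad_def inner_sum_left inner_scaleR_left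
      by (intro sum.cong refl) (simp add: inner_commute mult.commute)
    finally show ?thesis .
  qed
  then have "frechet_derivative f (at x) = (\<lambda>h. grad f x \<bullet> h)" by (rule ext)
  then show ?thesis using D by simp
qed

lemma smooth_frechet: "smooth f \<Longrightarrow> frechet_derivative f (at x) h = grad f x \<bullet> h"
  using frechet_derivative_at[OF smooth_has_derivative] by metis

lemma grad_eqI:
  assumes "(f has_derivative (\<lambda>h. g \<bullet> h)) (at x)"
  shows "grad f x = g"
  unfolding grad_def frechet_derivative_at[OF assms, symmetric]
  by (rule euclidean_representation)

lemma smooth_continuous: "smooth f \<Longrightarrow> continuous_on UNIV f"
  unfolding smooth_def by (metis Ck.simps(1))

lemma smooth_measurable [measurable]: "smooth f \<Longrightarrow> f \<in> borel_measurable borel"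
  by (intro borel_measurable_continuous_onI smooth_continuous)

lemma smooth_grad_continuous: "smooth f \<Longrightarrow> continuous_on UNIV (grad f)"
proof -
  assume "smooth f"
  then have "Ck (Suc 0) f" unfolding smooth_def by blast
  then have "continuous_on UNIV (\<lambda>x. frechet_derivative f (at x) b)" if "b \<in> Basis" for b
    using that by simp
  then show ?thesis
    unfolding grad_def[abs_def] by (intro continuous_intros) auto
qed

lemma smooth_grad_measurable [measurable]: "smooth f \<Longrightarrow> grad f \<in> borel_measurable borel"
  by (intro borel_measurable_continuous_onI smooth_grad_continuous)

lemma smooth_mult: "smooth f \<Longrightarrow> smooth g \<Longrightarrow> smooth (\<lambda>x. f x * g x)"
  by (auto simp: smooth_def intro: Ck_mult)

lemma smooth_power: "smooth f \<Longrightarrow> smooth (\<lambda>x. f x ^ n)"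
  by (auto simp: smooth_def intro: Ck_power)

lemma grad_mult:
  assumes "smooth f" "smooth g"
  shows "grad (\<lambda>x. f x * g x) x = f x *\<^sub>R grad g x + g x *\<^sub>R grad f x"
proof (rule grad_eqI)
  show "((\<lambda>x. f x * g x) has_derivative (\<lambda>h. (f x *\<^sub>R grad g x + g x *\<^sub>R grad f x) \<bullet> h)) (at x)"
    using has_derivative_mult[OF assms[THEN smooth_has_derivative]]
    by (simp add: inner_add_left mult.commute)
qed

lemma grad_power:
  assumes "smooth f"
  shows "grad (\<lambda>x. f x ^ n) x = (of_nat n * f x ^ (n - 1)) *\<^sub>R grad f x"
proof (rule grad_eqI)
  show "((\<lambda>x. f x ^ n) has_derivative
      (\<lambda>h. ((of_nat n * f x ^ (n - 1)) *\<^sub>R grad f x) \<bullet> h)) (at x)"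
    by (rule has_derivative_eq_rhs[OF has_derivative_power[OF smooth_has_derivative[OF assms]]])
      (simp add: fun_eq_iff mult_ac)
qed

lemma test_functions_iff:
  "\<phi> \<in> test_functions \<Omega> \<longleftrightarrow> smooth \<phi> \<and> (\<exists>K. compact K \<and> K \<subseteq> \<Omega> \<and> (\<forall>x. x \<notin> K \<longrightarrow> \<phi> x = 0))"
    (is "?L \<longleftrightarrow> ?R")
proof
  assume ?L
  then show ?R
    using closure_subset[of "{x. \<phi> x \<noteq> 0}"]
    unfolding test_functions_def smooth_def by blast
next
  assume ?R
  then obtain K where K: "smooth \<phi>" "compact K" "K \<subseteq> \<Omega>" "\<And>x. x \<notin> K \<Longrightarrow> \<phi> x = 0"
    by blast
  have "closure {x. \<phi> x \<noteq> 0} \<subseteq> K"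
    by (rule closure_minimal) (use K in \<open>auto simp: compact_imp_closed\<close>)
  moreover from this have "compact (closure {x. \<phi> x \<noteq> 0})"
    using K(2) by (metis closed_closure compact_Int_closed inf.absorb_iff2)
  ultimately show ?L
    using K(1,3) by (simp add: test_functions_def smooth_def)
qed

lemma test_smooth [dest]: "\<phi> \<in> test_functions \<Omega> \<Longrightarrow> smooth \<phi>"
  by (simp add: test_functions_iff)

lemma test_mono: "\<phi> \<in> test_functions A \<Longrightarrow> A \<subseteq> B \<Longrightarrow> \<phi> \<in> test_functions B"
  unfolding test_functions_iff by blast

lemma test_mult: "\<phi> \<in> test_functions A \<Longrightarrow> smooth f \<Longrightarrow> (\<lambda>x. \<phi> x * f x) \<in> test_functions A"
  unfolding test_functions_iff by (auto intro: smooth_mult)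

lemma test_power: "\<phi> \<in> test_functions A \<Longrightarrow> n > 0 \<Longrightarrow> (\<lambda>x. \<phi> x ^ n) \<in> test_functions A"
  unfolding test_functions_iff by (auto intro: smooth_power)

text \<open>The complement of \<open>K\<close> is open, so \<open>f\<close> agrees with 0 in a whole
  neighbourhood of \<open>x\<close>.\<close>

lemma grad_zero_outside:
  assumes "closed K" "\<And>x. x \<notin> K \<Longrightarrow> f x = 0" "x \<notin> K"
  shows "grad f x = 0"
proof (rule grad_eqI)
  have "((\<lambda>x. 0) has_derivative (\<lambda>h. 0 \<bullet> h)) (at x)" by simp
  then show "(f has_derivative (\<lambda>h. 0 \<bullet> h)) (at x)"
    by (rule has_derivative_transform_within_open[of _ _ _ _ "- K"]) (use assms in auto)
qed

lemma compact_support_bounded: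
  fixes f :: "'a::euclidean_space \<Rightarrow> 'b::real_normed_vector"
  assumes "continuous_on UNIV f" "compact K" "\<And>x. x \<notin> K \<Longrightarrow> f x = 0"
  obtains B where "B > 0" "\<And>x. norm (f x) \<le> B"
proof -
  have "compact (f ` K)"
    using assms by (intro compact_continuous_image) (auto intro: continuous_on_subset)
  then obtain B where "B > 0" "\<And>y. y \<in> f ` K \<Longrightarrow> norm y \<le> B"
    using compact_imp_bounded bounded_pos by metis
  then show ?thesis
    using that[of B] assms(3) by (metis imageI less_eq_real_def norm_zero)
qed

lemma test_bounded:
  assumes "\<phi> \<in> test_functions A"
  obtains B where "B > 0" "\<And>x. \<bar>\<phi> x\<bar> \<le> B" "\<And>x. norm (grad \<phi> x) \<le> B"
proof -
  obtain K where K: "smooth \<phi>" "compact K" "\<And>x. x \<notin> K \<Longrightarrow> \<phi> x = 0"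
    using assms unfolding test_functions_iff by blast
  obtain B where B: "B > 0" "\<And>x. norm (\<phi> x) \<le> B"
    by (rule compact_support_bounded[OF smooth_continuous[OF K(1)] K(2,3)]) auto
  obtain B' where B': "B' > 0" "\<And>x. norm (grad \<phi> x) \<le> B'"
    by (rule compact_support_bounded[OF smooth_grad_continuous[OF K(1)] K(2)
        grad_zero_outside[OF compact_imp_closed[OF K(2)] K(3)]]) auto
  show ?thesis
    by (rule that[of "B + B'"]) (use B B' in \<open>auto intro: order_trans[OF _ add_increasing] order_trans[OF _ add_increasing2] less_imp_le\<close>)
qed

text \<open>The squared distance is used because it is a polynomial and hence smooth at the centre
  too. After normalisation by the difference of the squared radii, the argument of the step is at
  least 1 on the inner ball and at most 0 outside the outer one.\<close>

definition cutoff :: "'a::euclidean_space \<Rightarrow> real \<Rightarrow> real \<Rightarrow> 'a \<Rightarrow> real" where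
  "cutoff c r R x = smooth_step ((R\<^sup>2 - (norm (x - c))\<^sup>2) / (R\<^sup>2 - r\<^sup>2))"

lemma cutoff_smooth: "smooth (cutoff c r R)"
  unfolding smooth_def cutoff_def[abs_def] divide_inverse
  by (intro allI Ck_smooth_step Ck_mult Ck_const Ck_diff Ck_norm_square)

lemma cutoff_bounds: "0 \<le> cutoff c r R x" "cutoff c r R x \<le> 1"
  by (simp_all add: cutoff_def smooth_step_bounds)

lemma cutoff_eq_1: "0 \<le> r \<Longrightarrow> r < R \<Longrightarrow> x \<in> cball c r \<Longrightarrow> cutoff c r R x = 1"
  unfolding cutoff_def
  by (rule smooth_step_1)
    (auto simp: dist_norm norm_minus_commute power_strict_mono power_mono le_divide_eq)

lemma cutoff_eq_0: "0 \<le> r \<Longrightarrow> r < R \<Longrightarrow> x \<notin> ball c R \<Longrightarrow> cutoff c r R x = 0"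
  unfolding cutoff_def
  by (rule smooth_step_0)
    (auto simp: dist_norm norm_minus_commute power_strict_mono power_mono divide_le_0_iff less_imp_le)

lemma cutoff_test: "0 \<le> r \<Longrightarrow> r < R \<Longrightarrow> cball c R \<subseteq> A \<Longrightarrow> cutoff c r R \<in> test_functions A"
  unfolding test_functions_iff
  by (intro conjI cutoff_smooth exI[of _ "cball c R"] compact_cball allI impI)
    (assumption, rule cutoff_eq_0, auto)

text \<open>The derivative of the argument has norm 2 |x - c| / (R^2 - r^2). On the outer ball |x -
  c| \<le> R + r, and this factor cancels against R^2 - r^2 = (R - r)(R + r). The rest is the bound
  for \<open>smooth_step'\<close>.\<close>

lemma grad_cutoff_bound:
  assumes "0 \<le> r" "r < R"
  shows "norm (grad (cutoff c r R) x) \<le> 8 * (exp 1)\<^sup>2 / (R - r)"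
proof (cases "x \<in> cball c R")
  case False
  have "grad (cutoff c r R) x = 0"
    by (rule grad_zero_outside[OF closed_cball cutoff_eq_0[OF assms] False]) auto
  then show ?thesis using assms by simp
next
  case True
  define d where "d = R\<^sup>2 - r\<^sup>2"
  have d: "d > 0" using assms by (simp add: d_def power_strict_mono)
  let ?t = "(R\<^sup>2 - (norm (x - c))\<^sup>2) / d"
  have "((\<lambda>x. (norm (x - c))\<^sup>2) has_derivative (\<lambda>h. (2 *\<^sub>R (x - c)) \<bullet> h)) (at x)"
    unfolding power2_norm_eq_inner
    by (auto intro!: derivative_eq_intros simp: algebra_simps inner_commute)
  from has_derivative_diff[OF has_derivative_const[of "R\<^sup>2"] this]
  have "((\<lambda>x. (R\<^sup>2 - (norm (x - c))\<^sup>2) / d) has_derivative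
      (\<lambda>h. (- ((2 *\<^sub>R (x - c)) \<bullet> h)) / d)) (at x)"
    unfolding divide_inverse by (drule_tac has_derivative_mult_left) simp
  from has_derivative_compose[OF this smooth_step_has_derivative[unfolded has_field_derivative_def]]
  have "(cutoff c r R has_derivative
      (\<lambda>h. (- (smooth_step' ?t * 2 / d) *\<^sub>R (x - c)) \<bullet> h)) (at x)"
    by (simp add: cutoff_def[abs_def] d_def mult_ac)
  then have "grad (cutoff c r R) x = - (smooth_step' ?t * 2 / d) *\<^sub>R (x - c)"
    by (rule grad_eqI)
  then have "norm (grad (cutoff c r R) x) = \<bar>smooth_step' ?t\<bar> * (2 / d * norm (x - c))"
    using d by (simp add: abs_mult)
  also have "\<dots> \<le> (4 * (exp 1)\<^sup>2) * (2 / (R - r))"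
  proof (rule mult_mono)
    have "2 / d * norm (x - c) \<le> 2 / d * (R + r)"
      using True d assms by (intro mult_left_mono) (auto simp: dist_norm norm_minus_commute)
    also have "\<dots> = 2 / (R - r)"
    proof -
      have "R + r \<noteq> 0" using assms by simp
      moreover have "d = (R - r) * (R + r)" by (simp add: d_def power2_eq_square algebra_simps)
      ultimately show ?thesis by (metis nonzero_mult_divide_mult_cancel_right times_divide_eq_left)
    qed
    finally show "2 / d * norm (x - c) \<le> 2 / (R - r)" .
  qed (use smooth_step'_bound d in auto)
  finally show ?thesis by simp
qed

section \<open>Translations and the fundamental lemma\<close>

lemma lborel_shift: "distr lborel borel (\<lambda>x::'a::euclidean_space. x + h) = lborel"
  using lborel_distr_plus[of h] by (simp add: add.commute[of _ h])

lemma nn_integral_shift: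
  fixes f :: "'a::euclidean_space \<Rightarrow> ennreal"
  assumes [measurable]: "f \<in> borel_measurable borel"
  shows "(\<integral>\<^sup>+x. f (x + h) \<partial>lborel) = (\<integral>\<^sup>+x. f x \<partial>lborel)"
proof -
  have "(\<integral>\<^sup>+x. f x \<partial>lborel) = (\<integral>\<^sup>+x. f x \<partial>distr lborel borel (\<lambda>x. x + h))"
    by (simp add: lborel_shift)
  also have "\<dots> = (\<integral>\<^sup>+x. f (x + h) \<partial>lborel)"
    by (rule nn_integral_distr) auto
  finally show ?thesis by simp
qed

lemma integral_shift:
  fixes f :: "'a::euclidean_space \<Rightarrow> 'b::{banach, second_countable_topology}"
  assumes [measurable]: "f \<in> borel_measurable borel"
  shows "(\<integral>x. f (x + h) \<partial>lborel) = (\<integral>x. f x \<partial>lborel)"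
proof -
  have "(\<integral>x. f x \<partial>lborel) = (\<integral>x. f x \<partial>distr lborel borel (\<lambda>x. x + h))"
    by (simp add: lborel_shift)
  also have "\<dots> = (\<integral>x. f (x + h) \<partial>lborel)"
    by (rule integral_distr) auto
  finally show ?thesis by simp
qed

lemma integrable_shift:
  fixes f :: "'a::euclidean_space \<Rightarrow> 'b::{banach, second_countable_topology}"
  assumes "integrable lborel f"
  shows "integrable lborel (\<lambda>x. f (x + h))"
proof -
  have "integrable (distr lborel borel (\<lambda>x. x + h)) f"
    using assms by (simp add: lborel_shift)
  then show ?thesis
    by (subst (asm) integrable_distr_eq) (use assms in auto)
qed

text \<open>Integrable functions are built from indicators by sums and dominated limits, so
  indicators are the essential case. For an open set, a point inside stays inside under small
  shifts, so the mass lost tends to 0 by dominated convergence. A general set is reached by outer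
  regularity.\<close>

lemma translation_continuous_L1:
  fixes f :: "'a::euclidean_space \<Rightarrow> 'b::{banach, second_countable_topology}"
  assumes "integrable lborel f" and h: "h \<longlonglongrightarrow> 0"
  shows "(\<lambda>n. \<integral>x. norm (f (x + h n) - f x) \<partial>lborel) \<longlonglongrightarrow> 0"
  using assms(1)
proof (induction rule: integrable_induct)
  case (base A c)
  have A [measurable]: "A \<in> sets borel" and Af: "emeasure lborel A < \<infinity>"
    using base by auto
  define I where "I B n = (\<integral>x. \<bar>indicator B (x + h n) - indicator B x :: real\<bar> \<partial>lborel)"
    for B :: "'a set" and n :: nat
  have iint: "integrable lborel (\<lambda>x. indicator B x :: real)"
    if "B \<in> sets borel" "emeasure lborel B < \<infinity>" for B :: "'a set"
    using that by (simp add: integrable_indicator_iff)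
  have open_case: "I U \<longlonglongrightarrow> 0" if U: "open U" "emeasure lborel U < \<infinity>" for U
  proof -
    have [measurable]: "U \<in> sets borel" using U by auto
    note i = iint[OF \<open>U \<in> sets borel\<close> U(2)]
    have "(\<lambda>n. \<integral>x. max 0 (indicator U x - indicator U (x + h n)) \<partial>lborel) \<longlonglongrightarrow> (\<integral>x. (0::real) \<partial>(lborel::'a measure))"
    proof (rule integral_dominated_convergence[where w = "indicator U"])
      show "AE x in lborel. (\<lambda>n. max 0 (indicator U x - indicator U (x + h n))) \<longlonglongrightarrow> (0::real)"
      proof (intro AE_I2)
        fix x :: 'a
        have lim: "(\<lambda>n. x + h n) \<longlonglongrightarrow> x"
          using tendsto_add[OF tendsto_const[of x] h] by simp
        show "(\<lambda>n. max 0 (indicator U x - indicator U (x + h n))) \<longlonglongrightarrow> (0::real)"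
        proof (rule tendsto_eventually)
          show "\<forall>\<^sub>F n in sequentially. max 0 (indicator U x - indicator U (x + h n)) = (0::real)"
          proof (cases "x \<in> U")
            case True
            then have "\<forall>\<^sub>F n in sequentially. x + h n \<in> U"
              using topological_tendstoD[OF lim U(1)] by blast
            then show ?thesis by eventually_elim (auto simp: True)
          qed (auto simp: indicator_def)
        qed
      qed
      show "AE x in lborel. norm (max 0 (indicator U x - indicator U (x + h n) :: real)) \<le> indicator U x" for n
        by (auto simp: indicator_def)
    qed (use i in auto)
    moreover have "I U n = 2 * (\<integral>x. max 0 (indicator U x - indicator U (x + h n)) \<partial>lborel)" for n
    proof -
      \<comment> \<open>Pointwise |b - a| = 2 max(0, a - b) + (b - a). The last difference
        integrates to 0 by translation invariance, so it suffices to control the points that leave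
        \<open>U\<close>. No statement about the points that enter it is required.\<close>
      have e: "\<bar>indicator U (x + h n) - indicator U x :: real\<bar> =
          2 * max 0 (indicator U x - indicator U (x + h n)) + (indicator U (x + h n) - indicator U x)"
        for x :: 'a
        by (auto simp: indicator_def)
      show ?thesis unfolding I_def e
        using i integrable_shift[OF i, of "h n"] integral_shift[of "indicator U :: 'a \<Rightarrow> real" "h n"]
        by simp
    qed
    then have "I U = (\<lambda>n. 2 * (\<integral>x. max 0 (indicator U x - indicator U (x + h n)) \<partial>lborel))" by (rule ext)
    ultimately show ?thesis
      using tendsto_mult_left[of _ 0 sequentially "2::real"] by simp
  qed
  have "I A \<longlonglongrightarrow> 0"
  proof (rule LIMSEQ_I)
    fix e :: real assume e: "0 < e"
    obtain U where U: "open U" "A \<subseteq> U" "emeasure lborel (U - A) < ennreal (e / 4)"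
      using outer_regular_lborel[OF A, of "e / 4"] e by auto
    have [measurable]: "U \<in> sets borel" using U by auto
    have "emeasure lborel U \<le> emeasure lborel A + emeasure lborel (U - A)"
      by (metis (no_types) A Diff_partition U(1,2) borel_open emeasure_subadditive sets.Diff sets_lborel)
    also have "\<dots> < \<infinity>" using Af U(3) by (auto simp: less_top[symmetric] top_unique dest: order_less_trans)
    finally have Uf: "emeasure lborel U < \<infinity>" .
    have UAf: "emeasure lborel (U - A) < \<infinity>" using U(3) by (simp add: order_less_trans[OF _ ennreal_less_top])
    note iA = iint[OF A Af] and iU = iint[OF \<open>U \<in> sets borel\<close> Uf]
      and iD = iint[of "U - A", OF _ UAf, simplified]
    have mD: "(\<integral>x. indicator (U - A) x \<partial>lborel) < e / 4"
    proof -
      have "measure lborel (U - A) < e / 4"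
        using U(3) e UAf by (simp add: emeasure_eq_ennreal_measure ennreal_less_iff)
      then show ?thesis by simp
    qed
    obtain N where N: "\<And>n. n \<ge> N \<Longrightarrow> \<bar>I U n\<bar> < e / 2"
      using LIMSEQ_D[OF open_case[OF U(1) Uf], of "e / 2"] e by auto
    have "\<bar>I A n\<bar> < e" if "n \<ge> N" for n
    proof -
      have "I A n \<le> (\<integral>x. \<bar>indicator U (x + h n) - indicator U x\<bar> + (indicator (U - A) (x + h n) + indicator (U - A) x) \<partial>lborel)"
        unfolding I_def
      proof (rule integral_mono)
        show "\<bar>indicator A (x + h n) - indicator A x\<bar> \<le>
          \<bar>indicator U (x + h n) - indicator U x\<bar> + (indicator (U - A) (x + h n) + indicator (U - A) x :: real)" for x
          using U(2) by (auto simp: indicator_def)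
      qed (use iA iU iD integrable_shift in \<open>auto intro!: Bochner_Integration.integrable_add integrable_abs Bochner_Integration.integrable_diff\<close>)
      also have "\<dots> = I U n + 2 * (\<integral>x. indicator (U - A) x \<partial>lborel)"
        unfolding I_def
        using iU integrable_shift[OF iU, of "h n"] iD integrable_shift[OF iD, of "h n"]
          integral_shift[of "indicator (U - A) :: 'a \<Rightarrow> real" "h n"]
        by simp
      also have "\<dots> < e" using N[OF that] mD by linarith
      finally show ?thesis by (simp add: I_def)
    qed
    then show "\<exists>N. \<forall>n\<ge>N. norm (I A n - 0) < e" by auto
  qed
  then have "(\<lambda>n. I A n * norm c) \<longlonglongrightarrow> 0" by (rule tendsto_mult_left_zero)
  then show ?case
    unfolding I_def by (simp flip: scaleR_diff_left)
next
  case (add f g)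
  have "(\<lambda>n. (\<integral>x. norm (f (x + h n) - f x) \<partial>lborel) + (\<integral>x. norm (g (x + h n) - g x) \<partial>lborel)) \<longlonglongrightarrow> 0"
    using tendsto_add[OF add.IH] by simp
  then show ?case
  proof (rule Lim_null_comparison[rotated], intro always_eventually allI)
    fix n
    note i = add.hyps integrable_shift[OF add.hyps(1), of "h n"] integrable_shift[OF add.hyps(2), of "h n"]
    have "(\<integral>x. norm (f (x + h n) + g (x + h n) - (f x + g x)) \<partial>lborel) \<le>
        (\<integral>x. norm (f (x + h n) - f x) + norm (g (x + h n) - g x) \<partial>lborel)"
      by (rule integral_mono) (use i in \<open>auto intro: norm_diff_triangle_ineq\<close>)
    also have "\<dots> = (\<integral>x. norm (f (x + h n) - f x) \<partial>lborel) + (\<integral>x. norm (g (x + h n) - g x) \<partial>lborel)"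
      using i by simp
    finally show "norm (\<integral>x. norm (f (x + h n) + g (x + h n) - (f x + g x)) \<partial>lborel) \<le>
        (\<integral>x. norm (f (x + h n) - f x) \<partial>lborel) + (\<integral>x. norm (g (x + h n) - g x) \<partial>lborel)"
      by simp
  qed
next
  case (lim f s)
  have "(\<lambda>i. \<integral>x. norm (s i x - f x) \<partial>lborel) \<longlonglongrightarrow> (\<integral>x. 0 \<partial>(lborel::'a measure))"
  proof (rule integral_dominated_convergence[where w = "\<lambda>x. 3 * norm (f x)"])
    show "AE x in lborel. (\<lambda>i. norm (s i x - f x)) \<longlonglongrightarrow> 0"
      using lim.hyps(2) by (auto intro!: AE_I2 simp: LIM_zero_iff tendsto_norm_zero_iff)
    show "AE x in lborel. norm (norm (s i x - f x)) \<le> 3 * norm (f x)" for i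
      using lim.hyps(3)[of _ i] by (auto intro!: AE_I2 order_trans[OF norm_triangle_ineq4])
  qed (use lim in auto)
  then have s0: "(\<lambda>i. \<integral>x. norm (s i x - f x) \<partial>lborel) \<longlonglongrightarrow> 0" by simp
  show ?case
  proof (rule LIMSEQ_I)
    fix e :: real assume e: "0 < e"
    obtain i where "norm ((\<integral>x. norm (s i x - f x) \<partial>lborel) - 0) < e / 4"
      using LIMSEQ_D[OF s0, of "e / 4"] e by auto
    then have i: "(\<integral>x. norm (s i x - f x) \<partial>lborel) < e / 4" by simp
    obtain N where N: "\<And>n. n \<ge> N \<Longrightarrow> norm ((\<integral>x. norm (s i (x + h n) - s i x) \<partial>lborel) - 0) < e / 2"
      using LIMSEQ_D[OF lim.IH[of i], of "e / 2"] e by auto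
    have "(\<integral>x. norm (f (x + h n) - f x) \<partial>lborel) < e" if "n \<ge> N" for n
    proof -
      note j = lim.hyps(1)[of i] lim.hyps(4) integrable_shift[OF lim.hyps(1)[of i], of "h n"] integrable_shift[OF lim.hyps(4), of "h n"]
      have [measurable]: "s i \<in> borel_measurable borel" "f \<in> borel_measurable borel"
        using j by auto
      have "(\<integral>x. norm (f (x + h n) - f x) \<partial>lborel) \<le> (\<integral>x. norm (s i (x + h n) - s i x)
          + (norm (s i (x + h n) - f (x + h n)) + norm (s i x - f x)) \<partial>lborel)"
      proof (rule integral_mono)
        show "norm (f (x + h n) - f x) \<le> norm (s i (x + h n) - s i x)
          + (norm (s i (x + h n) - f (x + h n)) + norm (s i x - f x))" for x
        proof -
          have "f (x + h n) - f x = (s i (x + h n) - s i x) - (s i (x + h n) - f (x + h n)) + (s i x - f x)"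
            by simp
          then show ?thesis
            by (smt (verit) norm_triangle_ineq norm_triangle_ineq4)
        qed
      qed (use j in auto)
      also have "\<dots> = (\<integral>x. norm (s i (x + h n) - s i x) \<partial>lborel) + 2 * (\<integral>x. norm (s i x - f x) \<partial>lborel)"
        using j integral_shift[of "\<lambda>x. norm (s i x - f x)" "h n"] by simp
      also have "\<dots> < e" using N[OF that] i by simp
      finally show ?thesis .
    qed
    then show "\<exists>N. \<forall>n\<ge>N. norm ((\<integral>x. norm (f (x + h n) - f x) \<partial>lborel) - 0) < e"
      by auto
  qed
qed

text \<open>The step vanishes on the nonpositive half-line, so these products never exceed the box
  indicator. Inside the open box every argument eventually passes 1, so the limit is attained after
  finitely many indices.\<close>

lemma box_indicator_limit:
  fixes a c :: "'a::euclidean_space"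
  obtains \<psi> :: "nat \<Rightarrow> 'a \<Rightarrow> real" where
    "\<And>n. \<psi> n \<in> test_functions UNIV" "\<And>n x. \<bar>\<psi> n x\<bar> \<le> indicator (box a c) x"
    "\<And>x. (\<lambda>n. \<psi> n x) \<longlonglongrightarrow> indicator (box a c) x"
proof -
  define \<psi> where "\<psi> n x = (\<Prod>b\<in>Basis. smooth_step (real n * (x \<bullet> b - a \<bullet> b)) * smooth_step (real n * (c \<bullet> b - x \<bullet> b)))"
    for n and x :: 'a
  have out: "\<psi> n x = 0" if nb: "x \<notin> box a c" for n x
  proof -
    obtain b where b: "b \<in> Basis" "x \<bullet> b \<le> a \<bullet> b \<or> c \<bullet> b \<le> x \<bullet> b"
      using nb unfolding mem_box not_less[symmetric] by blast
    then have "smooth_step (real n * (x \<bullet> b - a \<bullet> b)) * smooth_step (real n * (c \<bullet> b - x \<bullet> b)) = 0"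
      by (auto intro!: smooth_step_0 mult_nonneg_nonpos)
    with b(1) show ?thesis unfolding \<psi>_def by (intro prod_zero) auto
  qed
  have bd: "0 \<le> \<psi> n x" "\<psi> n x \<le> 1" for n x
    unfolding \<psi>_def
    by (auto intro!: prod_nonneg prod_le_1 mult_le_one smooth_step_bounds mult_nonneg_nonneg)
  show ?thesis
  proof
    show "\<psi> n \<in> test_functions UNIV" for n
    proof -
      have "smooth (\<psi> n)"
        unfolding smooth_def \<psi>_def
        by (intro allI Ck_prod Ck_mult Ck_smooth_step Ck_diff Ck_const Ck_inner) auto
      moreover have "compact (cbox a c)" "\<And>x. x \<notin> cbox a c \<Longrightarrow> \<psi> n x = 0"
        using out box_subset_cbox by auto blast
      ultimately show ?thesis unfolding test_functions_iff by blast
    qed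
    show "\<bar>\<psi> n x\<bar> \<le> indicator (box a c) x" for n x
      using bd[of n x] out[of x n] by (auto simp: indicator_def)
    show "(\<lambda>n. \<psi> n x) \<longlonglongrightarrow> indicator (box a c) x" for x
    proof (cases "x \<in> box a c")
      case True
      have ev: "\<forall>\<^sub>F n in sequentially. smooth_step (real n * d) = 1" if "d > 0" for d
      proof -
        have "filterlim (\<lambda>n. real n * d) at_top sequentially"
          by (rule filterlim_at_top_mult_tendsto_pos[OF tendsto_const that filterlim_real_sequentially])
        then have "\<forall>\<^sub>F n in sequentially. real n * d \<ge> 1"
          by (simp add: filterlim_at_top)
        then show ?thesis by eventually_elim (rule smooth_step_1)
      qed
      have "\<forall>\<^sub>F n in sequentially. \<forall>b\<in>Basis. smooth_step (real n * (x \<bullet> b - a \<bullet> b)) * smooth_step (real n * (c \<bullet> b - x \<bullet> b)) = 1"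
      proof (intro eventually_ball_finite ballI)
        fix b :: 'a assume "b \<in> Basis"
        then have "\<forall>\<^sub>F n in sequentially. smooth_step (real n * (x \<bullet> b - a \<bullet> b)) = 1"
          "\<forall>\<^sub>F n in sequentially. smooth_step (real n * (c \<bullet> b - x \<bullet> b)) = 1"
          using True by (auto intro!: ev simp: mem_box)
        then show "\<forall>\<^sub>F n in sequentially. smooth_step (real n * (x \<bullet> b - a \<bullet> b)) * smooth_step (real n * (c \<bullet> b - x \<bullet> b)) = 1"
          by eventually_elim simp
      qed simp
      then have "\<forall>\<^sub>F n in sequentially. \<psi> n x = indicator (box a c) x"
        by eventually_elim (simp add: \<psi>_def True)
      then show ?thesis by (rule tendsto_eventually)
    qed (simp add: out)
  qed
qed

text \<open>Test functions approximate indicators of boxes, so \<open>g\<close> integrates to 0 over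
  every box. Hence the measures with densities g^+ and g^- agree on boxes, and therefore everywhere,
  and the densities coincide almost everywhere.\<close>

lemma fundamental_lemma:
  fixes g :: "'a::euclidean_space \<Rightarrow> real"
  assumes g: "integrable lborel g"
    and 0: "\<And>\<psi>. \<psi> \<in> test_functions UNIV \<Longrightarrow> (\<integral>x. g x * \<psi> x \<partial>lborel) = 0"
  shows "AE x in lborel. g x = 0"
proof -
  have gm [measurable]: "g \<in> borel_measurable borel" using g by auto
  have box0: "(\<integral>x. g x * indicator (box a c) x \<partial>lborel) = 0" for a c
  proof -
    obtain \<psi> :: "nat \<Rightarrow> 'a \<Rightarrow> real" where \<psi>:
      "\<And>n. \<psi> n \<in> test_functions UNIV" "\<And>n x. \<bar>\<psi> n x\<bar> \<le> indicator (box a c) x"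
      "\<And>x. (\<lambda>n. \<psi> n x) \<longlonglongrightarrow> indicator (box a c) x"
      using box_indicator_limit[of a c] by blast
    have [measurable]: "\<psi> n \<in> borel_measurable borel" for n
      using \<psi>(1) by (auto intro: smooth_measurable)
    have "(\<lambda>n. \<integral>x. g x * \<psi> n x \<partial>lborel) \<longlonglongrightarrow> (\<integral>x. g x * indicator (box a c) x \<partial>lborel)"
    proof (rule integral_dominated_convergence[where w = "\<lambda>x. norm (g x)"])
      show "AE x in lborel. norm (g x * \<psi> n x) \<le> norm (g x)" for n
      proof (intro AE_I2)
        fix x :: 'a
        have "\<bar>\<psi> n x\<bar> \<le> 1" using \<psi>(2)[of n x] by (rule order_trans) (auto simp: indicator_def)
        then show "norm (g x * \<psi> n x) \<le> norm (g x)" by (simp add: abs_mult mult_left_le)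
      qed
      show "AE x in lborel. (\<lambda>n. g x * \<psi> n x) \<longlonglongrightarrow> g x * indicator (box a c) x"
        using \<psi>(3) by (intro AE_I2 tendsto_mult_left)
    qed (use g in auto)
    then show ?thesis using 0[OF \<psi>(1)] by (simp add: LIMSEQ_const_iff)
  qed
  \<comment> \<open>\<open>ennreal\<close> truncates negative values to 0, so these are the measures
    with densities g^+ and g^-. Boxes form an intersection-stable generator of the Borel
    sets.\<close>
  have "density lborel (\<lambda>x. ennreal (g x)) = density lborel (\<lambda>x. ennreal (- g x))"
  proof (rule measure_eqI_generator_eq)
    let ?E = "range (\<lambda>(a, b). box a b::'a set)"
    show "Int_stable ?E" by (auto simp: Int_stable_def box_Int_box)
    show "?E \<subseteq> Pow UNIV" "sets (density lborel (\<lambda>x. ennreal (g x))) = sigma_sets UNIV ?E"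
      "sets (density lborel (\<lambda>x. ennreal (- g x))) = sigma_sets UNIV ?E"
      by (simp_all add: borel_eq_box)
    let ?A = "\<lambda>n::nat. box (- (real n *\<^sub>R One)) (real n *\<^sub>R One) :: 'a set"
    show "range ?A \<subseteq> ?E" "(\<Union>i. ?A i) = UNIV"
      unfolding UN_box_eq_UNIV by auto
    have e: "emeasure (density lborel (\<lambda>x. ennreal (f x))) (box a c)
       = ennreal (\<integral>x. max 0 (f x) * indicator (box a c) x \<partial>lborel)"
      if f: "integrable lborel f" for f :: "'a \<Rightarrow> real" and a c
    proof -
      have [measurable]: "f \<in> borel_measurable borel" using f by auto
      have "emeasure (density lborel (\<lambda>x. ennreal (f x))) (box a c)
          = (\<integral>\<^sup>+x. ennreal (f x) * indicator (box a c) x \<partial>lborel)"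
        by (rule emeasure_density) auto
      also have "\<dots> = (\<integral>\<^sup>+x. ennreal (max 0 (f x) * indicator (box a c) x) \<partial>lborel)"
        by (intro nn_integral_cong) (auto simp: indicator_def max_def ennreal_neg)
      also have "\<dots> = ennreal (\<integral>x. max 0 (f x) * indicator (box a c) x \<partial>lborel)"
        by (rule nn_integral_eq_integral)
          (use f in \<open>auto intro!: integrable_real_mult_indicator\<close>)
      finally show ?thesis .
    qed
    have "integrable lborel (\<lambda>x. - g x)" using g by auto
    note ee = e[OF g] e[OF this]
    show "emeasure (density lborel (\<lambda>x. ennreal (g x))) (?A i) \<noteq> \<infinity>" for i
      unfolding ee by simp
    show "emeasure (density lborel (\<lambda>x. ennreal (g x))) X = emeasure (density lborel (\<lambda>x. ennreal (- g x))) X"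
      if XE: "X \<in> ?E" for X
    proof -
      obtain a c where X: "X = box a c" using XE by auto
      have "(\<integral>x. max 0 (g x) * indicator X x \<partial>lborel) - (\<integral>x. max 0 (- g x) * indicator X x \<partial>lborel)
          = (\<integral>x. max 0 (g x) * indicator X x - max 0 (- g x) * indicator X x \<partial>lborel)"
        unfolding X
        by (rule Bochner_Integration.integral_diff[symmetric])
          (use g in \<open>auto intro!: integrable_real_mult_indicator\<close>)
      also have "\<dots> = (\<integral>x. g x * indicator X x \<partial>lborel)"
        by (intro Bochner_Integration.integral_cong) (auto simp: indicator_def)
      finally show ?thesis
        unfolding X ee using box0[of a c] by (simp add: X)
    qed
  qed
  then have "AE x in lborel. ennreal (g x) = ennreal (- g x)"
    by (intro sigma_finite_measure.density_unique[OF lborel.sigma_finite_measure_axioms]) auto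
  then show ?thesis
  proof eventually_elim
    case (elim x)
    then show ?case
      by (cases "g x \<ge> 0") (auto simp: ennreal_neg ennreal_eq_0_iff dest: sym)
  qed
qed

section \<open>Integrable functions with integrable weak gradient\<close>

definition W11 :: "('a::euclidean_space \<Rightarrow> real) \<Rightarrow> ('a \<Rightarrow> 'a) \<Rightarrow> bool" where
  "W11 u G \<longleftrightarrow> integrable lborel u \<and> integrable lborel G \<and>
     (\<forall>\<phi>\<in>test_functions UNIV. \<forall>h.
        (\<integral>x. u x * (grad \<phi> x \<bullet> h) \<partial>lborel) = - (\<integral>x. \<phi> x * (G x \<bullet> h) \<partial>lborel))"

lemma W11D:
  assumes "W11 u G"
  shows "integrable lborel u" "integrable lborel G"
    "u \<in> borel_measurable borel" "G \<in> borel_measurable borel"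
    "\<phi> \<in> test_functions UNIV \<Longrightarrow>
      (\<integral>x. u x * (grad \<phi> x \<bullet> h) \<partial>lborel) = - (\<integral>x. \<phi> x * (G x \<bullet> h) \<partial>lborel)"
  using assms unfolding W11_def by auto

lemma integrable_bounded_mult:
  fixes f :: "'a \<Rightarrow> real" and g :: "'a \<Rightarrow> 'b::{banach, second_countable_topology}"
  assumes "integrable M g" "f \<in> borel_measurable M" "\<And>x. \<bar>f x\<bar> \<le> B"
  shows "integrable M (\<lambda>x. f x *\<^sub>R g x)"
proof (rule Bochner_Integration.integrable_bound[of M "\<lambda>x. B *\<^sub>R g x"])
  show "AE x in M. norm (f x *\<^sub>R g x) \<le> norm (B *\<^sub>R g x)"
    using assms(3) by (intro AE_I2) (auto intro!: mult_right_mono order_trans[OF assms(3)])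
qed (use assms in auto)

lemma integrable_test_mult:
  fixes g :: "'a::euclidean_space \<Rightarrow> 'b::{banach, second_countable_topology}"
  assumes "integrable lborel g" "\<phi> \<in> test_functions A"
  shows "integrable lborel (\<lambda>x. \<phi> x *\<^sub>R g x)"
proof -
  obtain B where "\<And>x. \<bar>\<phi> x\<bar> \<le> B" using test_bounded[OF assms(2)] by metis
  then show ?thesis
    using assms by (intro integrable_bounded_mult) auto
qed

lemma integrable_mult_test:
  fixes g :: "'a::euclidean_space \<Rightarrow> real"
  assumes "integrable lborel g" "\<phi> \<in> test_functions A"
  shows "integrable lborel (\<lambda>x. g x * \<phi> x)"
  using integrable_test_mult[OF assms] by (simp add: mult.commute)

lemma integrable_mult_grad:
  fixes g :: "'a::euclidean_space \<Rightarrow> real"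
  assumes "integrable lborel g" "\<phi> \<in> test_functions A"
  shows "integrable lborel (\<lambda>x. g x *\<^sub>R grad \<phi> x)"
proof -
  obtain B where B: "B > 0" "\<And>x. norm (grad \<phi> x) \<le> B" using test_bounded[OF assms(2)] by metis
  have [measurable]: "grad \<phi> \<in> borel_measurable borel" using assms(2) by auto
  show ?thesis
  proof (rule Bochner_Integration.integrable_bound[of lborel "\<lambda>x. B * g x"])
    show "AE x in lborel. norm (g x *\<^sub>R grad \<phi> x) \<le> norm (B * g x)"
      using B by (intro AE_I2) (simp add: abs_mult mult.commute[of B] mult_left_mono)
  qed (use assms in auto)
qed

lemma integrable_mult_grad_inner:
  fixes g :: "'a::euclidean_space \<Rightarrow> real"
  assumes "integrable lborel g" "\<phi> \<in> test_functions A"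
  shows "integrable lborel (\<lambda>x. g x * (grad \<phi> x \<bullet> h))"
  using integrable_inner_left[OF integrable_mult_grad[OF assms], of h] by simp

lemma W11I:
  assumes "integrable lborel u" "integrable lborel G"
    "\<And>\<phi> b. \<phi> \<in> test_functions UNIV \<Longrightarrow> b \<in> Basis \<Longrightarrow>
      (\<integral>x. u x * (grad \<phi> x \<bullet> b) \<partial>lborel) = - (\<integral>x. \<phi> x * (G x \<bullet> b) \<partial>lborel)"
  shows "W11 u G"
  unfolding W11_def
proof (intro conjI assms(1,2) ballI allI)
  fix \<phi> :: "'a \<Rightarrow> real" and h :: 'a assume \<phi>: "\<phi> \<in> test_functions UNIV"
  have e: "v \<bullet> h = (\<Sum>b\<in>Basis. (h \<bullet> b) * (v \<bullet> b))" for v :: 'a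
    by (subst euclidean_inner) (simp add: mult.commute)
  have i1: "integrable lborel (\<lambda>x. u x * (grad \<phi> x \<bullet> b))" for b
    by (rule integrable_mult_grad_inner[OF assms(1) \<phi>])
  have i2: "integrable lborel (\<lambda>x. \<phi> x * (G x \<bullet> b))" for b
    using integrable_test_mult[OF _ \<phi>, of "\<lambda>x. G x \<bullet> b"] assms(2) by (cases "b = 0") auto
  have "(\<integral>x. u x * (grad \<phi> x \<bullet> h) \<partial>lborel)
      = (\<integral>x. (\<Sum>b\<in>Basis. (h \<bullet> b) * (u x * (grad \<phi> x \<bullet> b))) \<partial>lborel)"
    by (subst e) (simp add: sum_distrib_left mult_ac)
  also have "\<dots> = (\<Sum>b\<in>Basis. (h \<bullet> b) * (\<integral>x. u x * (grad \<phi> x \<bullet> b) \<partial>lborel))"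
    using i1 by simp
  also have "\<dots> = - (\<Sum>b\<in>Basis. (h \<bullet> b) * (\<integral>x. \<phi> x * (G x \<bullet> b) \<partial>lborel))"
    by (simp add: assms(3)[OF \<phi>] sum_negf)
  also have "(\<Sum>b\<in>Basis. (h \<bullet> b) * (\<integral>x. \<phi> x * (G x \<bullet> b) \<partial>lborel))
      = (\<integral>x. (\<Sum>b\<in>Basis. (h \<bullet> b) * (\<phi> x * (G x \<bullet> b))) \<partial>lborel)"
    using i2 by simp
  also have "\<dots> = (\<integral>x. \<phi> x * (G x \<bullet> h) \<partial>lborel)"
    by (intro Bochner_Integration.integral_cong refl) (subst e, simp add: sum_distrib_left mult_ac)
  finally show "(\<integral>x. u x * (grad \<phi> x \<bullet> h) \<partial>lborel) = - (\<integral>x. \<phi> x * (G x \<bullet> h) \<partial>lborel)" .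
qed

lemma W11_diff:
  assumes "W11 u G" "W11 v F"
  shows "W11 (\<lambda>x. u x - v x) (\<lambda>x. G x - F x)"
proof (rule W11I)
  fix \<phi> :: "'a \<Rightarrow> real" and b :: 'a assume \<phi>: "\<phi> \<in> test_functions UNIV" "b \<in> Basis"
  have i: "integrable lborel (\<lambda>x. u x * (grad \<phi> x \<bullet> b))" "integrable lborel (\<lambda>x. v x * (grad \<phi> x \<bullet> b))"
    "integrable lborel (\<lambda>x. \<phi> x * (G x \<bullet> b))" "integrable lborel (\<lambda>x. \<phi> x * (F x \<bullet> b))"
    using assms[THEN W11D(1)] assms[THEN W11D(2)] \<phi>
      integrable_test_mult[OF _ \<phi>(1), of "\<lambda>x. G x \<bullet> b"] integrable_test_mult[OF _ \<phi>(1), of "\<lambda>x. F x \<bullet> b"]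
    by (auto intro: integrable_mult_grad_inner)
  show "(\<integral>x. (u x - v x) * (grad \<phi> x \<bullet> b) \<partial>lborel) = - (\<integral>x. \<phi> x * ((G x - F x) \<bullet> b) \<partial>lborel)"
    using i W11D(5)[OF assms(1) \<phi>(1), of b] W11D(5)[OF assms(2) \<phi>(1), of b]
    by (simp add: left_diff_distrib right_diff_distrib inner_diff_left)
qed (use assms[THEN W11D(1)] assms[THEN W11D(2)] in auto)

section \<open>Localisation, products with test functions, and limits\<close>

definition W11loc :: "'a::euclidean_space set \<Rightarrow> ('a \<Rightarrow> real) \<Rightarrow> ('a \<Rightarrow> 'a) \<Rightarrow> bool" where
  "W11loc \<Omega> u G \<longleftrightarrow> u \<in> borel_measurable borel \<and> G \<in> borel_measurable borel \<and>
     (\<forall>K. compact K \<and> K \<subseteq> \<Omega> \<longrightarrow> integrable lborel (\<lambda>x. indicator K x *\<^sub>R u x) \<and>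
        integrable lborel (\<lambda>x. indicator K x *\<^sub>R G x)) \<and>
     (\<forall>\<phi>\<in>test_functions \<Omega>. \<forall>b\<in>Basis.
        (\<integral>x. u x * (grad \<phi> x \<bullet> b) \<partial>lborel) = - (\<integral>x. \<phi> x * (G x \<bullet> b) \<partial>lborel))"

lemma W11loc_UNIV: "W11 u G \<Longrightarrow> W11loc UNIV u G"
  unfolding W11_def W11loc_def
  by (intro conjI allI impI integrable_mult_indicator) (auto simp: compact_imp_closed)

text \<open>This is the passage from local to global. If \<phi> is any test function, then \<eta>
  \<phi> has its support in \<Omega> and may be inserted in the local identity. Cutting
  \<open>u\<close> and \<open>G\<close> off by the indicator of the support of \<eta> makes them
  integrable without changing the products.\<close>

lemma W11loc_test_mult:
  assumes "W11loc \<Omega> u G" "\<eta> \<in> test_functions \<Omega>"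
  shows "W11 (\<lambda>x. \<eta> x * u x) (\<lambda>x. \<eta> x *\<^sub>R G x + u x *\<^sub>R grad \<eta> x)"
proof -
  obtain K where K: "smooth \<eta>" "compact K" "K \<subseteq> \<Omega>" "\<And>x. x \<notin> K \<Longrightarrow> \<eta> x = 0"
    using assms(2) unfolding test_functions_iff by blast
  define u' where "u' x = indicator K x *\<^sub>R u x" for x
  define G' where "G' x = indicator K x *\<^sub>R G x" for x
  have W: "integrable lborel u'" "integrable lborel G'"
    using assms(1) K unfolding W11loc_def u'_def[abs_def] G'_def[abs_def] by auto
  have eq: "\<eta> x * u x = \<eta> x * u' x" "\<eta> x *\<^sub>R G x = \<eta> x *\<^sub>R G' x" "u x *\<^sub>R grad \<eta> x = u' x *\<^sub>R grad \<eta> x" for x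
    using K(4)[of x] grad_zero_outside[where f = \<eta> and K = K and x = x, OF compact_imp_closed[OF K(2)] K(4)]
    by (auto simp: u'_def G'_def indicator_def)
  have "W11 (\<lambda>x. \<eta> x * u' x) (\<lambda>x. \<eta> x *\<^sub>R G' x + u' x *\<^sub>R grad \<eta> x)"
  proof (rule W11I)
    show "integrable lborel (\<lambda>x. \<eta> x * u' x)"
      using integrable_test_mult[OF W(1) assms(2)] by simp
    show "integrable lborel (\<lambda>x. \<eta> x *\<^sub>R G' x + u' x *\<^sub>R grad \<eta> x)"
      using integrable_test_mult[OF W(2) assms(2)] integrable_mult_grad[OF W(1) assms(2)] by simp
    fix \<phi> :: "'a \<Rightarrow> real" and b :: 'a assume \<phi>: "\<phi> \<in> test_functions UNIV" "b \<in> Basis"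
    have s: "smooth \<eta>" "smooth \<phi>" using assms(2) \<phi> by auto
    have \<eta>\<phi>: "(\<lambda>x. \<eta> x * \<phi> x) \<in> test_functions \<Omega>"
      using test_mult[OF assms(2) s(2)] .
    have i1: "integrable lborel (\<lambda>x. \<eta> x * u' x * (grad \<phi> x \<bullet> b))"
      using integrable_mult_grad_inner[OF integrable_test_mult[OF W(1) assms(2)] \<phi>(1)] by simp
    have i2: "integrable lborel (\<lambda>x. \<phi> x * u' x * (grad \<eta> x \<bullet> b))"
      using integrable_mult_grad_inner[OF integrable_test_mult[OF W(1) \<phi>(1)] assms(2)] by simp
    have i3: "integrable lborel (\<lambda>x. \<phi> x * (\<eta> x * (G' x \<bullet> b)))"
      using integrable_test_mult[OF integrable_test_mult[OF integrable_inner_left[OF W(2)] assms(2)] \<phi>(1)]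
        \<phi>(2) by simp
    have "(\<integral>x. u x * (grad (\<lambda>x. \<eta> x * \<phi> x) x \<bullet> b) \<partial>lborel) = - (\<integral>x. \<eta> x * \<phi> x * (G x \<bullet> b) \<partial>lborel)"
      using assms(1) \<eta>\<phi> \<phi>(2) unfolding W11loc_def by blast
    moreover have "(\<integral>x. u x * (grad (\<lambda>x. \<eta> x * \<phi> x) x \<bullet> b) \<partial>lborel) =
        (\<integral>x. \<eta> x * u' x * (grad \<phi> x \<bullet> b) + \<phi> x * u' x * (grad \<eta> x \<bullet> b) \<partial>lborel)"
    proof (intro Bochner_Integration.integral_cong refl)
      fix x
      have "u x * (grad (\<lambda>x. \<eta> x * \<phi> x) x \<bullet> b) = (\<eta> x * u x) * (grad \<phi> x \<bullet> b) + \<phi> x * ((u x *\<^sub>R grad \<eta> x) \<bullet> b)"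
        by (simp add: grad_mult[OF s] inner_add_left algebra_simps)
      then show "u x * (grad (\<lambda>x. \<eta> x * \<phi> x) x \<bullet> b) = \<eta> x * u' x * (grad \<phi> x \<bullet> b) + \<phi> x * u' x * (grad \<eta> x \<bullet> b)"
        unfolding eq by simp
    qed
    moreover have "\<dots> = (\<integral>x. \<eta> x * u' x * (grad \<phi> x \<bullet> b) \<partial>lborel) + (\<integral>x. \<phi> x * u' x * (grad \<eta> x \<bullet> b) \<partial>lborel)"
      by (rule Bochner_Integration.integral_add[OF i1 i2])
    moreover have "(\<integral>x. \<phi> x * ((\<eta> x *\<^sub>R G' x + u' x *\<^sub>R grad \<eta> x) \<bullet> b) \<partial>lborel)
        = (\<integral>x. \<phi> x * (\<eta> x * (G' x \<bullet> b)) + \<phi> x * u' x * (grad \<eta> x \<bullet> b) \<partial>lborel)"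
      by (intro Bochner_Integration.integral_cong refl) (simp add: inner_add_left algebra_simps)
    moreover have "\<dots> = (\<integral>x. \<phi> x * (\<eta> x * (G' x \<bullet> b)) \<partial>lborel) + (\<integral>x. \<phi> x * u' x * (grad \<eta> x \<bullet> b) \<partial>lborel)"
      by (rule Bochner_Integration.integral_add[OF i3 i2])
    moreover have "(\<integral>x. \<phi> x * (\<eta> x * (G' x \<bullet> b)) \<partial>lborel) = (\<integral>x. \<eta> x * \<phi> x * (G x \<bullet> b) \<partial>lborel)"
    proof (intro Bochner_Integration.integral_cong refl)
      fix x
      have "\<phi> x * ((\<eta> x *\<^sub>R G x) \<bullet> b) = \<eta> x * \<phi> x * (G x \<bullet> b)" by simp
      then show "\<phi> x * (\<eta> x * (G' x \<bullet> b)) = \<eta> x * \<phi> x * (G x \<bullet> b)" unfolding eq by simp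
    qed
    ultimately show "(\<integral>x. \<eta> x * u' x * (grad \<phi> x \<bullet> b) \<partial>lborel)
        = - (\<integral>x. \<phi> x * ((\<eta> x *\<^sub>R G' x + u' x *\<^sub>R grad \<eta> x) \<bullet> b) \<partial>lborel)"
      by linarith
  qed
  then show ?thesis by (simp add: eq)
qed

lemma W11_test_mult:
  assumes "W11 u G" "\<eta> \<in> test_functions A"
  shows "W11 (\<lambda>x. \<eta> x * u x) (\<lambda>x. \<eta> x *\<^sub>R G x + u x *\<^sub>R grad \<eta> x)"
  by (rule W11loc_test_mult[OF W11loc_UNIV[OF assms(1)] test_mono[OF assms(2)]]) simp

lemma W11_limit:
  assumes W: "\<And>n. W11 (u n) (G n)"
    and lim: "AE x in lborel. (\<lambda>n. u n x) \<longlonglongrightarrow> v x" "AE x in lborel. (\<lambda>n. G n x) \<longlonglongrightarrow> F x"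
    and bd: "\<And>n. AE x in lborel. \<bar>u n x\<bar> \<le> w x" "\<And>n. AE x in lborel. norm (G n x) \<le> w' x"
    and int: "integrable lborel w" "integrable lborel w'"
    and meas [measurable]: "v \<in> borel_measurable borel" "F \<in> borel_measurable borel"
  shows "W11 v F"
proof (rule W11I)
  have [measurable]: "u n \<in> borel_measurable borel" "G n \<in> borel_measurable borel" for n
    using W11D[OF W[of n]] by auto
  have [measurable]: "w \<in> borel_measurable borel" "w' \<in> borel_measurable borel"
    using int by auto
  show "integrable lborel v"
    by (rule integrable_dominated_convergence[where s = u and w = w]) (use lim bd int in auto)
  show "integrable lborel F"
    by (rule integrable_dominated_convergence[where s = G and w = w']) (use lim bd int in auto)
  fix \<phi> :: "'a \<Rightarrow> real" and b :: 'a assume \<phi>: "\<phi> \<in> test_functions UNIV" "b \<in> Basis"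
  obtain B where B: "B > 0" "\<And>x. \<bar>\<phi> x\<bar> \<le> B" "\<And>x. norm (grad \<phi> x) \<le> B"
    using test_bounded[OF \<phi>(1)] by metis
  have [measurable]: "\<phi> \<in> borel_measurable borel" "grad \<phi> \<in> borel_measurable borel"
    using \<phi> by auto
  have Bb: "\<bar>grad \<phi> x \<bullet> b\<bar> \<le> B" for x
    using B(3)[of x] Basis_le_norm[OF \<phi>(2), of "grad \<phi> x"] by linarith
  have "(\<lambda>n. \<integral>x. u n x * (grad \<phi> x \<bullet> b) \<partial>lborel) \<longlonglongrightarrow> (\<integral>x. v x * (grad \<phi> x \<bullet> b) \<partial>lborel)"
  proof (rule integral_dominated_convergence[where w = "\<lambda>x. w x * B"])
    show "AE x in lborel. (\<lambda>n. u n x * (grad \<phi> x \<bullet> b)) \<longlonglongrightarrow> v x * (grad \<phi> x \<bullet> b)"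
      using lim(1) by eventually_elim (intro tendsto_intros)
    show "AE x in lborel. norm (u n x * (grad \<phi> x \<bullet> b)) \<le> w x * B" for n
      using bd(1)[of n] by eventually_elim (use Bb B(1) in \<open>auto simp: abs_mult intro!: mult_mono\<close>)
  qed (use int in auto)
  moreover have "(\<lambda>n. - (\<integral>x. \<phi> x * (G n x \<bullet> b) \<partial>lborel)) \<longlonglongrightarrow> - (\<integral>x. \<phi> x * (F x \<bullet> b) \<partial>lborel)"
  proof (rule tendsto_minus, rule integral_dominated_convergence[where w = "\<lambda>x. B * w' x"])
    show "AE x in lborel. (\<lambda>n. \<phi> x * (G n x \<bullet> b)) \<longlonglongrightarrow> \<phi> x * (F x \<bullet> b)"
      using lim(2) by eventually_elim (intro tendsto_intros)
    show "AE x in lborel. norm (\<phi> x * (G n x \<bullet> b)) \<le> B * w' x" for n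
      using bd(2)[of n]
    proof eventually_elim
      case (elim x)
      have "\<bar>G n x \<bullet> b\<bar> \<le> w' x" using elim Basis_le_norm[OF \<phi>(2), of "G n x"] by linarith
      then show ?case using B by (auto simp: abs_mult intro!: mult_mono)
    qed
  qed (use int in auto)
  ultimately show "(\<integral>x. v x * (grad \<phi> x \<bullet> b) \<partial>lborel) = - (\<integral>x. \<phi> x * (F x \<bullet> b) \<partial>lborel)"
    using W11D(5)[OF W \<phi>(1), of _ b] LIMSEQ_unique by simp
qed

section \<open>Difference quotients\<close>

lemma Ck_shift: "Ck k f \<Longrightarrow> Ck k (\<lambda>x. f (x + c))"
proof (induction k arbitrary: f)
  case 0
  then show ?case
    by (auto intro!: continuous_on_compose2[of UNIV f] continuous_intros)
next
  case (Suc k)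
  show ?case
  proof (rule Ck_SucI)
    show "((\<lambda>x. f (x + c)) has_derivative frechet_derivative f (at (x + c))) (at x)" for x
      by (rule has_derivative_compose[where f = "\<lambda>x. x + c" and f' = "\<lambda>x. x", OF _ Ck_Suc_has_derivative[OF Suc.prems]])
        (auto intro!: derivative_eq_intros)
    show "b \<in> Basis \<Longrightarrow> Ck k (\<lambda>x. frechet_derivative f (at (x + c)) b)" for b
      using Suc.IH[of "\<lambda>x. frechet_derivative f (at x) b"] Suc.prems by simp
  qed
qed

lemma smooth_shift: "smooth f \<Longrightarrow> smooth (\<lambda>x. f (x + c))"
  by (simp add: smooth_def Ck_shift)

lemma grad_shift: "smooth f \<Longrightarrow> grad (\<lambda>x. f (x + c)) x = grad f (x + c)"
  by (rule grad_eqI, rule has_derivative_compose[where f = "\<lambda>x. x + c" and f' = "\<lambda>x. x", OF _ smooth_has_derivative])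
    (auto intro!: derivative_eq_intros)

lemma test_shift:
  assumes "\<phi> \<in> test_functions UNIV"
  shows "(\<lambda>x. \<phi> (x + c)) \<in> test_functions UNIV"
proof -
  obtain K where K: "smooth \<phi>" "compact K" "\<And>x. x \<notin> K \<Longrightarrow> \<phi> x = 0"
    using assms unfolding test_functions_iff by blast
  have "x \<notin> (\<lambda>x. x - c) ` K \<Longrightarrow> x + c \<notin> K" for x
    by (metis add_diff_cancel_right' imageI)
  moreover have "compact ((\<lambda>x. x - c) ` K)"
    using K(2) by (intro compact_continuous_image continuous_intros)
  ultimately show ?thesis
    unfolding test_functions_iff using K by (auto intro!: smooth_shift exI[of _ "(\<lambda>x. x - c) ` K"])
qed

text \<open>By translation invariance the inner integral of the norm does not depend on
  \<open>t\<close>, and the indicator keeps the range of \<open>t\<close> finite.\<close>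

lemma indicator_shift_integrable:
  fixes f :: "'a::euclidean_space \<Rightarrow> 'b::{banach, second_countable_topology}"
  assumes f: "integrable lborel f"
  shows "integrable (lborel \<Otimes>\<^sub>M lborel) (\<lambda>(t, x). indicator {0..1::real} t *\<^sub>R f (x + t *\<^sub>R h))"
proof (rule lborel_pair.Fubini_integrable)
  have [measurable]: "f \<in> borel_measurable borel" using f by auto
  show "(\<lambda>(t, x). indicator {0..1::real} t *\<^sub>R f (x + t *\<^sub>R h)) \<in> borel_measurable (lborel \<Otimes>\<^sub>M lborel)"
    by measurable
  have "(\<integral>x. norm (f (x + t *\<^sub>R h)) \<partial>lborel) = (\<integral>x. norm (f x) \<partial>lborel)" for t
    by (rule integral_shift[of "\<lambda>x. norm (f x)"]) simp
  then have e: "(\<integral>x. norm (case (t, x) of (t, x) \<Rightarrow> indicator {0..1::real} t *\<^sub>R f (x + t *\<^sub>R h)) \<partial>lborel)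
      = indicator {0..1} t * (\<integral>x. norm (f x) \<partial>lborel)" for t
    by simp
  show "integrable lborel (\<lambda>t. \<integral>x. norm (case (t, x) of (t, x) \<Rightarrow> indicator {0..1::real} t *\<^sub>R f (x + t *\<^sub>R h)) \<partial>lborel)"
    unfolding e by (intro integrable_mult_left) (simp add: integrable_indicator_iff)
  show "AE t in lborel. integrable lborel (\<lambda>x. case (t, x) of (t, x) \<Rightarrow> indicator {0..1::real} t *\<^sub>R f (x + t *\<^sub>R h))"
    using integrable_shift[OF f] by (auto intro!: AE_I2)
qed

text \<open>Both sides are tested against a smooth \<psi>. Translations move onto \<psi>, the weak
  gradient turns the integrand into derivatives of \<psi>, and there the fundamental theorem of
  calculus applies along the segment. The exceptional null set depends on \<open>h\<close>.\<close>

lemma W11_difference: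
  fixes u :: "'a::euclidean_space \<Rightarrow> real"
  assumes "W11 u G"
  shows "AE x in lborel. u (x + h) - u x = (\<integral>t. indicator {0..1} t * (G (x + t *\<^sub>R h) \<bullet> h) \<partial>lborel)"
proof -
  note W = W11D[OF assms]
  note [measurable] = W(3,4)
  define g where "g x = G x \<bullet> h" for x
  have g: "integrable lborel g" unfolding g_def using W(2) by (cases "h = 0") auto
  have [measurable]: "g \<in> borel_measurable borel" using g by auto
  note J = indicator_shift_integrable[OF g, of h]
  define k where "k x = (\<integral>t. indicator {0..1} t * g (x + t *\<^sub>R h) \<partial>lborel)" for x
  have k: "integrable lborel k"
    unfolding k_def using lborel_pair.integrable_fst'[OF lborel_pair.integrable_product_swap[OF J]]
    by (simp add: case_prod_unfold)
  have "AE x in lborel. u (x + h) - u x - k x = 0"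
  proof (rule fundamental_lemma)
    show "integrable lborel (\<lambda>x. u (x + h) - u x - k x)"
      using W(1) k integrable_shift[OF W(1), of h] by auto
    fix \<psi> :: "'a \<Rightarrow> real" assume \<psi>: "\<psi> \<in> test_functions UNIV"
    have [measurable]: "\<psi> \<in> borel_measurable borel" "grad \<psi> \<in> borel_measurable borel"
      using \<psi> by auto
    obtain B where B: "B > 0" "\<And>x. \<bar>\<psi> x\<bar> \<le> B" "\<And>x. norm (grad \<psi> x) \<le> B"
      using test_bounded[OF \<psi>(1)] by metis
    have Jp: "integrable (lborel \<Otimes>\<^sub>M lborel) (\<lambda>(t, x). indicator {0..1} t * g (x + t *\<^sub>R h) * \<psi> x)"
      using integrable_bounded_mult[OF J, of "\<lambda>p. \<psi> (snd p)" B] B(2)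
      by (simp add: case_prod_unfold mult_ac)
    have Ju: "integrable (lborel \<Otimes>\<^sub>M lborel) (\<lambda>(t::real, x). indicator {0..1} t * (u x * (grad \<psi> (x - t *\<^sub>R h) \<bullet> h)))"
    proof -
      have "integrable (lborel \<Otimes>\<^sub>M lborel) (\<lambda>p. (grad \<psi> (snd p - fst p *\<^sub>R h) \<bullet> h) *\<^sub>R
          (case p of (t, x) \<Rightarrow> indicator {0..1::real} t *\<^sub>R u (x + t *\<^sub>R 0)))"
      proof (rule integrable_bounded_mult[OF indicator_shift_integrable[OF W(1)]])
        show "\<bar>grad \<psi> (snd p - fst p *\<^sub>R h) \<bullet> h\<bar> \<le> B * norm h" for p
          using Cauchy_Schwarz_ineq2[of "grad \<psi> (snd p - fst p *\<^sub>R h)" h] B(3)[of "snd p - fst p *\<^sub>R h"]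
          by (meson mult_right_mono norm_ge_zero order_trans)
      qed measurable
      then show ?thesis by (simp add: case_prod_unfold mult_ac)
    qed
    have "(\<integral>x. k x * \<psi> x \<partial>lborel) = (\<integral>x. (\<integral>t. indicator {0..1} t * g (x + t *\<^sub>R h) * \<psi> x \<partial>lborel) \<partial>lborel)"
      unfolding k_def by simp
    also have "\<dots> = (\<integral>t. (\<integral>x. indicator {0..1} t * g (x + t *\<^sub>R h) * \<psi> x \<partial>lborel) \<partial>lborel)"
      using lborel_pair.Fubini_integral[OF Jp] by simp
    also have "\<dots> = (\<integral>t. (\<integral>x. - (indicator {0..1} t * (u x * (grad \<psi> (x - t *\<^sub>R h) \<bullet> h))) \<partial>lborel) \<partial>lborel)"
    proof (rule Bochner_Integration.integral_cong[OF refl])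
      fix t :: real
      have "(\<integral>x. g (x + t *\<^sub>R h) * \<psi> x \<partial>lborel) = (\<integral>x. g (x + t *\<^sub>R h) * \<psi> ((x + t *\<^sub>R h) - t *\<^sub>R h) \<partial>lborel)"
        by simp
      also have "\<dots> = (\<integral>x. g x * \<psi> (x - t *\<^sub>R h) \<partial>lborel)"
        by (rule integral_shift[of "\<lambda>x. g x * \<psi> (x - t *\<^sub>R h)"]) measurable
      also have "\<dots> = - (\<integral>x. u x * (grad (\<lambda>x. \<psi> (x - t *\<^sub>R h)) x \<bullet> h) \<partial>lborel)"
        using W(5)[OF test_shift[OF \<psi>, of "- t *\<^sub>R h"], of h] by (simp add: g_def mult.commute)
      also have "\<dots> = - (\<integral>x. u x * (grad \<psi> (x - t *\<^sub>R h) \<bullet> h) \<partial>lborel)"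
        using grad_shift[of \<psi> "- t *\<^sub>R h"] \<psi> by auto
      finally show "(\<integral>x. indicator {0..1} t * g (x + t *\<^sub>R h) * \<psi> x \<partial>lborel) =
          (\<integral>x. - (indicator {0..1} t * (u x * (grad \<psi> (x - t *\<^sub>R h) \<bullet> h))) \<partial>lborel)"
        by (simp add: mult.assoc)
    qed
    also have "\<dots> = - (\<integral>x. (\<integral>t. indicator {0..1} t * (u x * (grad \<psi> (x - t *\<^sub>R h) \<bullet> h)) \<partial>lborel) \<partial>lborel)"
      using lborel_pair.Fubini_integral[OF Ju] by simp
    \<comment> \<open>For fixed \<open>x\<close> the integrand in \<open>t\<close> is
      \<open>u x\<close> times the derivative of t \<mapsto> -\<psi>(x - t h), so the inner integral
      is a difference of boundary values.\<close>
    also have "\<dots> = - (\<integral>x. u x * (\<psi> x - \<psi> (x - h)) \<partial>lborel)"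
    proof (intro arg_cong[where f = uminus] Bochner_Integration.integral_cong refl)
      fix x :: 'a
      have l: "((\<lambda>t. x - t *\<^sub>R h) has_derivative (\<lambda>s. - (s *\<^sub>R h))) (at t)" for t :: real
        by (auto intro!: derivative_eq_intros)
      have s: "smooth \<psi>" using \<psi> by auto
      have d: "((\<lambda>t. - \<psi> (x - t *\<^sub>R h)) has_real_derivative grad \<psi> (x - t *\<^sub>R h) \<bullet> h) (at t)" for t
        unfolding has_field_derivative_def
        by (rule has_derivative_eq_rhs[OF has_derivative_minus[OF has_derivative_compose[OF l smooth_has_derivative[OF s]]]])
          (simp add: fun_eq_iff)
      have "has_bochner_integral lborel (\<lambda>t. (grad \<psi> (x - t *\<^sub>R h) \<bullet> h) * indicator {0..1} t)
          (- \<psi> (x - 1 *\<^sub>R h) - (- \<psi> (x - 0 *\<^sub>R h)))"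
      proof (rule has_bochner_integral_FTC_Icc_real[OF _ d])
        show "isCont (\<lambda>t. grad \<psi> (x - t *\<^sub>R h) \<bullet> h) t" for t
          using smooth_grad_continuous[OF s]
          by (intro continuous_inner continuous_const isCont_o2[where f = "\<lambda>t. x - t *\<^sub>R h" and g = "grad \<psi>"])
            (auto intro!: continuous_intros simp: continuous_on_eq_continuous_at)
      qed simp
      then show "(\<integral>t. indicator {0..1} t * (u x * (grad \<psi> (x - t *\<^sub>R h) \<bullet> h)) \<partial>lborel) = u x * (\<psi> x - \<psi> (x - h))"
        by (simp add: has_bochner_integral_iff mult_ac)
    qed
    finally have 1: "(\<integral>x. k x * \<psi> x \<partial>lborel) = - (\<integral>x. u x * (\<psi> x - \<psi> (x - h)) \<partial>lborel)" .
    have \<psi>h: "(\<lambda>x. \<psi> (x - h)) \<in> test_functions UNIV" using test_shift[OF \<psi>, of "- h"] by simp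
    have "(\<integral>x. u (x + h) * \<psi> x \<partial>lborel) = (\<integral>x. u (x + h) * \<psi> ((x + h) - h) \<partial>lborel)" by simp
    also have "\<dots> = (\<integral>x. u x * \<psi> (x - h) \<partial>lborel)"
      by (rule integral_shift[of "\<lambda>x. u x * \<psi> (x - h)"]) measurable
    finally have 2: "(\<integral>x. u (x + h) * \<psi> x \<partial>lborel) = (\<integral>x. u x * \<psi> (x - h) \<partial>lborel)" .
    note i = integrable_mult_test[OF W(1) \<psi>] integrable_mult_test[OF W(1) \<psi>h]
      integrable_mult_test[OF k \<psi>] integrable_mult_test[OF integrable_shift[OF W(1), of h] \<psi>]
    show "(\<integral>x. (u (x + h) - u x - k x) * \<psi> x \<partial>lborel) = 0"
      using i 1 2 by (simp add: left_diff_distrib right_diff_distrib)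
  qed
  then show ?thesis by eventually_elim (simp add: k_def g_def)
qed

text \<open>Subtracting the derivative from the quotient leaves the average over t in [0,1] of g(x +
  t e b) - g(x), where g is the component of \<open>G\<close> along \<open>b\<close>. By Fubini its
  norm is at most the average of the translation differences \<open>D n t\<close>, which tend to 0
  and are bounded by twice the norm of g.\<close>

lemma W11_quotient_L1:
  fixes u :: "'a::euclidean_space \<Rightarrow> real" and e :: "nat \<Rightarrow> real"
  assumes "W11 u G" and e: "e \<longlonglongrightarrow> 0" "\<And>n. e n \<noteq> 0"
  shows "(\<lambda>n. \<integral>x. \<bar>(u (x + e n *\<^sub>R b) - u x) / e n - G x \<bullet> b\<bar> \<partial>lborel) \<longlonglongrightarrow> 0"
proof -
  note W = W11D[OF assms(1)]
  note [measurable] = W(3,4)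
  define g where "g x = G x \<bullet> b" for x
  have g: "integrable lborel g" unfolding g_def using W(2) by simp
  have [measurable]: "g \<in> borel_measurable borel" using g by auto
  define D where "D n t = (\<integral>x. \<bar>g (x + t *\<^sub>R (e n *\<^sub>R b)) - g x\<bar> \<partial>lborel)" for n t
  have D_nn: "0 \<le> D n t" for n t unfolding D_def by simp
  have D_le: "D n t \<le> 2 * (\<integral>x. \<bar>g x\<bar> \<partial>lborel)" for n t
  proof -
    have "D n t \<le> (\<integral>x. \<bar>g (x + t *\<^sub>R (e n *\<^sub>R b))\<bar> + \<bar>g x\<bar> \<partial>lborel)"
      unfolding D_def by (rule integral_mono) (use g integrable_shift[OF g] in auto)
    also have "\<dots> = 2 * (\<integral>x. \<bar>g x\<bar> \<partial>lborel)"
      using g integrable_shift[OF g] integral_shift[of "\<lambda>x. \<bar>g x\<bar>"] by simp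
    finally show ?thesis .
  qed
  have lim: "(\<lambda>n. \<integral>t. indicator {0..1} t * D n t \<partial>lborel) \<longlonglongrightarrow> (\<integral>t. 0 \<partial>(lborel :: real measure))"
  proof (rule integral_dominated_convergence[where w = "\<lambda>t. indicator {0..1} t * (2 * (\<integral>x. \<bar>g x\<bar> \<partial>lborel))"])
    show "AE t in lborel. (\<lambda>n. indicator {0..1} t * D n t) \<longlonglongrightarrow> 0"
    proof (intro AE_I2 tendsto_mult_right_zero)
      fix t :: real
      have "(\<lambda>n. t *\<^sub>R (e n *\<^sub>R b)) \<longlonglongrightarrow> t *\<^sub>R (0 *\<^sub>R b)" by (intro tendsto_intros e)
      then show "(\<lambda>n. D n t) \<longlonglongrightarrow> 0"
        unfolding D_def using translation_continuous_L1[OF g, of "\<lambda>n. t *\<^sub>R (e n *\<^sub>R b)"] by simp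
    qed
    show "AE t in lborel. norm (indicator {0..1} t * D n t) \<le> indicator {0..1} t * (2 * (\<integral>x. \<bar>g x\<bar> \<partial>lborel))" for n
      using D_le D_nn by (auto intro!: AE_I2 simp: indicator_def)
    show "(\<lambda>t. indicator {0..1} t * D n t) \<in> borel_measurable lborel" for n
      unfolding D_def by measurable
  qed (auto simp: integrable_indicator_iff)
  have le: "(\<integral>x. \<bar>(u (x + e n *\<^sub>R b) - u x) / e n - G x \<bullet> b\<bar> \<partial>lborel) \<le> (\<integral>t. indicator {0..1} t * D n t \<partial>lborel)" for n
  proof -
    define F where "F t x = indicator {0..1::real} t * (g (x + t *\<^sub>R (e n *\<^sub>R b)) - g x)" for t x
    have [measurable]: "(\<lambda>(t, x). F t x) \<in> borel_measurable (lborel \<Otimes>\<^sub>M lborel)"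
      unfolding F_def by measurable
    have "integrable (lborel \<Otimes>\<^sub>M lborel) (\<lambda>p. (case p of (t, x) \<Rightarrow> indicator {0..1::real} t *\<^sub>R g (x + t *\<^sub>R (e n *\<^sub>R b)))
        - (case p of (t, x) \<Rightarrow> indicator {0..1::real} t *\<^sub>R g (x + t *\<^sub>R 0)))"
      by (intro Bochner_Integration.integrable_diff indicator_shift_integrable g)
    then have J: "integrable (lborel \<Otimes>\<^sub>M lborel) (\<lambda>(t, x). F t x)"
      by (simp add: F_def case_prod_unfold right_diff_distrib)
    then have Jn: "integrable (lborel \<Otimes>\<^sub>M lborel) (\<lambda>(t, x). \<bar>F t x\<bar>)"
      using integrable_abs[OF J] by (simp add: case_prod_unfold)
    have q: "AE x in lborel. (u (x + e n *\<^sub>R b) - u x) / e n - g x = (\<integral>t. F t x \<partial>lborel)"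
      using W11_difference[OF assms(1), of "e n *\<^sub>R b"] 
        lborel_pair.AE_integrable_fst'[OF lborel_pair.integrable_product_swap[OF indicator_shift_integrable[OF g, of "e n *\<^sub>R b"]]]
    proof eventually_elim
      case (elim x)
      then have i: "integrable lborel (\<lambda>t. indicator {0..1} t * g (x + t *\<^sub>R (e n *\<^sub>R b)))" by simp
      have "(u (x + e n *\<^sub>R b) - u x) / e n = (\<integral>t. indicator {0..1} t * g (x + t *\<^sub>R (e n *\<^sub>R b)) \<partial>lborel)"
        using elim(1) e(2)[of n] by (simp add: g_def mult.left_commute)
      moreover have "(\<integral>t. F t x \<partial>lborel) = (\<integral>t. indicator {0..1} t * g (x + t *\<^sub>R (e n *\<^sub>R b)) \<partial>lborel) - g x"
        unfolding F_def right_diff_distrib using i by (simp add: integrable_indicator_iff)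
      ultimately show ?case by simp
    qed
    have "(\<integral>x. \<bar>(u (x + e n *\<^sub>R b) - u x) / e n - G x \<bullet> b\<bar> \<partial>lborel) = (\<integral>x. \<bar>\<integral>t. F t x \<partial>lborel\<bar> \<partial>lborel)"
    proof (rule integral_cong_AE)
      show "AE x in lborel. \<bar>(u (x + e n *\<^sub>R b) - u x) / e n - G x \<bullet> b\<bar> = \<bar>\<integral>t. F t x \<partial>lborel\<bar>"
        using q by eventually_elim (simp add: g_def)
    qed measurable
    also have "\<dots> \<le> (\<integral>x. (\<integral>t. \<bar>F t x\<bar> \<partial>lborel) \<partial>lborel)"
    proof (rule integral_mono)
      show "integrable lborel (\<lambda>x. \<integral>t. \<bar>F t x\<bar> \<partial>lborel)"
        using lborel_pair.integrable_fst'[OF lborel_pair.integrable_product_swap[OF Jn]] by simp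
      show "integrable lborel (\<lambda>x. \<bar>\<integral>t. F t x \<partial>lborel\<bar>)"
        using lborel_pair.integrable_fst'[OF lborel_pair.integrable_product_swap[OF J]] by simp
    qed simp
    also have "\<dots> = (\<integral>t. (\<integral>x. \<bar>F t x\<bar> \<partial>lborel) \<partial>lborel)"
      by (rule lborel_pair.Fubini_integral[OF Jn, simplified])
    also have "\<dots> = (\<integral>t. indicator {0..1} t * D n t \<partial>lborel)"
      unfolding D_def F_def by (simp add: abs_mult)
    finally show ?thesis .
  qed
  show ?thesis
    by (rule Lim_null_comparison[of _ "\<lambda>n. \<integral>t. indicator {0..1} t * D n t \<partial>lborel"])
      (use le lim in auto)
qed

text \<open>The chain rule is obtained from difference quotients, so no mollification is needed.\<close>

lemma W11_chain:
  fixes u :: "'a::euclidean_space \<Rightarrow> real"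
  assumes "W11 u G" and T: "\<And>y. (T has_real_derivative T' y) (at y)"
    and cont: "continuous_on UNIV T'" and L: "\<And>y. \<bar>T' y\<bar> \<le> L" and T0: "T 0 = 0"
  shows "W11 (\<lambda>x. T (u x)) (\<lambda>x. T' (u x) *\<^sub>R G x)"
proof (rule W11I)
  note W = W11D[OF assms(1)]
  note [measurable] = W(3,4)
  have L0: "0 \<le> L" using L[of 0] by simp
  have [measurable]: "T' \<in> borel_measurable borel" by (intro borel_measurable_continuous_onI cont)
  have "continuous_on UNIV T" using T by (meson DERIV_continuous_on has_field_derivative_at_within)
  then have [measurable]: "T \<in> borel_measurable borel" by (intro borel_measurable_continuous_onI)
  have Lip: "\<bar>T y - T z\<bar> \<le> L * \<bar>y - z\<bar>" for y z
    using field_differentiable_bound[of UNIV T T' L y z] T L by (simp add: has_field_derivative_at_within)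
  show iT: "integrable lborel (\<lambda>x. T (u x))"
    by (rule Bochner_Integration.integrable_bound[of lborel "\<lambda>x. L * u x"])
      (use W(1) Lip[of _ 0] T0 L0 in \<open>auto simp: abs_mult\<close>)
  show iG: "integrable lborel (\<lambda>x. T' (u x) *\<^sub>R G x)"
    by (rule integrable_bounded_mult[OF W(2) _ L]) measurable
  fix \<phi> :: "'a \<Rightarrow> real" and b :: 'a assume \<phi>: "\<phi> \<in> test_functions UNIV" "b \<in> Basis"
  obtain B where B: "B > 0" "\<And>x. \<bar>\<phi> x\<bar> \<le> B" "\<And>x. norm (grad \<phi> x) \<le> B"
    using test_bounded[OF \<phi>(1)] by metis
  have s\<phi>: "smooth \<phi>" using \<phi> by auto
  have [measurable]: "\<phi> \<in> borel_measurable borel" "grad \<phi> \<in> borel_measurable borel"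
    using s\<phi> by auto
  define e0 :: "nat \<Rightarrow> real" where "e0 n = 1 / real (Suc n)" for n
  have e0: "e0 \<longlonglongrightarrow> 0" "e0 n > 0" for n
    unfolding e0_def using LIMSEQ_Suc[OF lim_1_over_n] by auto
  have e0nz: "e0 n \<noteq> 0" for n using e0(2)[of n] by simp
  \<comment> \<open>Convergence in the mean yields pointwise convergence only along a subsequence,
    and the nonlinear \<open>T\<close> requires pointwise convergence. The steps are therefore
    thinned out to \<open>e\<close>.\<close>
  obtain r where r: "strict_mono r"
    "AE x in lborel. (\<lambda>n. \<bar>(u (x + e0 (r n) *\<^sub>R b) - u x) / e0 (r n) - G x \<bullet> b\<bar>) \<longlonglongrightarrow> 0"
  proof -
    have "integrable lborel (\<lambda>x. \<bar>(u (x + e0 n *\<^sub>R b) - u x) / e0 n - G x \<bullet> b\<bar>)" for n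
      using W(1,2) integrable_shift[OF W(1), of "e0 n *\<^sub>R b"] by auto
    from tendsto_L1_AE_subseq[of lborel "\<lambda>n x. \<bar>(u (x + e0 n *\<^sub>R b) - u x) / e0 n - G x \<bullet> b\<bar>", OF this]
      W11_quotient_L1[OF assms(1) e0(1) e0nz, of b]
    show ?thesis using that by auto
  qed
  define e where "e n = e0 (r n)" for n
  have e: "e \<longlonglongrightarrow> 0" "\<And>n. e n > 0" "\<And>n. e n \<noteq> 0"
    using LIMSEQ_subseq_LIMSEQ[OF e0(1) r(1)] e0 e0nz by (auto simp: e_def[abs_def] o_def)
  define q where "q n x = (u (x + e n *\<^sub>R b) - u x) / e n" for n x
  define g where "g x = G x \<bullet> b" for x
  define Q where "Q n x = (T (u (x + e n *\<^sub>R b)) - T (u x)) / e n" for n x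
  have [measurable]: "q n \<in> borel_measurable borel" "Q n \<in> borel_measurable borel" "g \<in> borel_measurable borel" for n
    unfolding q_def[abs_def] Q_def[abs_def] g_def[abs_def] by measurable
  have iq: "integrable lborel (q n)" "integrable lborel (Q n)" "integrable lborel g" for n
    unfolding q_def[abs_def] Q_def[abs_def] g_def[abs_def]
    using W(1,2) iT integrable_shift[OF W(1), of "e n *\<^sub>R b"] integrable_shift[OF iT, of "e n *\<^sub>R b"]
    by auto
  have qL1: "(\<lambda>n. \<integral>x. \<bar>q n x - g x\<bar> \<partial>lborel) \<longlonglongrightarrow> 0"
    unfolding q_def g_def by (rule W11_quotient_L1[OF assms(1) e(1,3)])
  have Qq: "\<bar>Q n x\<bar> \<le> L * \<bar>q n x\<bar>" for n x
    using Lip[of "u (x + e n *\<^sub>R b)" "u x"] e(2)[of n] by (simp add: Q_def q_def field_simps abs_mult)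
  have lim: "AE x in lborel. (\<lambda>n. q n x) \<longlonglongrightarrow> g x \<and> (\<lambda>n. Q n x) \<longlonglongrightarrow> T' (u x) * g x"
    using r(2)
  proof eventually_elim
    case (elim x)
    have q: "(\<lambda>n. q n x) \<longlonglongrightarrow> g x"
      using elim unfolding q_def g_def e_def by (simp add: tendsto_rabs_zero_iff LIM_zero_iff)
    have u: "(\<lambda>n. u (x + e n *\<^sub>R b)) \<longlonglongrightarrow> u x"
    proof -
      have "(\<lambda>n. u x + e n * q n x) \<longlonglongrightarrow> u x + 0 * g x" by (intro tendsto_intros e q)
      then show ?thesis using e(3) by (simp add: q_def)
    qed
    \<comment> \<open>Caratheodory's slope function factors the increment of \<open>T\<close>
      without division by the increment of \<open>u\<close>, which may be zero.\<close>
    obtain c where c: "\<And>z. T z - T (u x) = c z * (z - u x)" "isCont c (u x)" "c (u x) = T' (u x)"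
      using T[of "u x"] unfolding DERIV_caratheodory_within[of _ _ _ UNIV, simplified] CARAT_DERIV by blast
    have "(\<lambda>n. c (u (x + e n *\<^sub>R b)) * q n x) \<longlonglongrightarrow> T' (u x) * g x"
      using isCont_tendsto_compose[OF c(2) u] c(3) q by (intro tendsto_mult) auto
    moreover have "Q n x = c (u (x + e n *\<^sub>R b)) * q n x" for n
      by (simp add: Q_def q_def c(1))
    ultimately show ?case using q by simp
  qed
  have Qlim: "(\<lambda>n. \<integral>x. \<bar>Q n x - T' (u x) * g x\<bar> \<partial>lborel) \<longlonglongrightarrow> 0"
  proof -
    \<comment> \<open>The quotients \<open>Q n\<close> have no common integrable majorant, because
      they are bounded only by L |q n|. After subtraction of L |q n - g|, which already tends to 0
      in the mean, the positive part is dominated by 2 L |g|.\<close>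
    define d where "d n x = max 0 (\<bar>Q n x - T' (u x) * g x\<bar> - L * \<bar>q n x - g x\<bar>)" for n x
    have iTg: "integrable lborel (\<lambda>x. T' (u x) * g x)"
      using integrable_bounded_mult[OF iq(3) _ L, of u] by simp
    have d0: "(\<lambda>n. \<integral>x. d n x \<partial>lborel) \<longlonglongrightarrow> (\<integral>x. 0 \<partial>(lborel :: 'a measure))"
    proof (rule integral_dominated_convergence[where w = "\<lambda>x. 2 * L * \<bar>g x\<bar>"])
      show "AE x in lborel. (\<lambda>n. d n x) \<longlonglongrightarrow> 0"
        using lim
      proof eventually_elim
        case (elim x)
        have "(\<lambda>n. d n x) \<longlonglongrightarrow> max 0 (\<bar>T' (u x) * g x - T' (u x) * g x\<bar> - L * \<bar>g x - g x\<bar>)"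
          unfolding d_def by (intro tendsto_intros elim[THEN conjunct1] elim[THEN conjunct2])
        then show ?case by simp
      qed
      show "AE x in lborel. norm (d n x) \<le> 2 * L * \<bar>g x\<bar>" for n
      proof (intro AE_I2)
        fix x
        have "L * \<bar>q n x\<bar> \<le> L * (\<bar>q n x - g x\<bar> + \<bar>g x\<bar>)" using L0 by (intro mult_left_mono) auto
        moreover have "\<bar>T' (u x) * g x\<bar> \<le> L * \<bar>g x\<bar>" using L by (simp add: abs_mult mult_right_mono)
        ultimately have "\<bar>Q n x - T' (u x) * g x\<bar> \<le> L * \<bar>q n x - g x\<bar> + 2 * (L * \<bar>g x\<bar>)"
          using Qq[of n x] abs_triangle_ineq4[of "Q n x" "T' (u x) * g x"] unfolding distrib_left by linarith
        moreover have "0 \<le> L * \<bar>g x\<bar>" using L0 by simp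
        ultimately show "norm (d n x) \<le> 2 * L * \<bar>g x\<bar>"
          unfolding d_def by (simp add: mult.assoc)
      qed
      show "d n \<in> borel_measurable lborel" for n unfolding d_def[abs_def] by measurable
    qed (use iq in auto)
    have le: "(\<integral>x. \<bar>Q n x - T' (u x) * g x\<bar> \<partial>lborel) \<le> (\<integral>x. d n x \<partial>lborel) + L * (\<integral>x. \<bar>q n x - g x\<bar> \<partial>lborel)" for n
    proof -
      have id: "integrable lborel (d n)"
        unfolding d_def[abs_def] using iq iTg by (intro integrable_max) auto
      have "(\<integral>x. \<bar>Q n x - T' (u x) * g x\<bar> \<partial>lborel) \<le> (\<integral>x. d n x + L * \<bar>q n x - g x\<bar> \<partial>lborel)"
        by (rule integral_mono) (use id iq iTg in \<open>auto simp: d_def\<close>)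
      also have "\<dots> = (\<integral>x. d n x \<partial>lborel) + L * (\<integral>x. \<bar>q n x - g x\<bar> \<partial>lborel)"
        using id iq by simp
      finally show ?thesis .
    qed
    have "(\<lambda>n. (\<integral>x. d n x \<partial>lborel) + L * (\<integral>x. \<bar>q n x - g x\<bar> \<partial>lborel)) \<longlonglongrightarrow> 0 + L * 0"
      using d0 qL1 by (intro tendsto_intros) auto
    then have z: "(\<lambda>n. (\<integral>x. d n x \<partial>lborel) + L * (\<integral>x. \<bar>q n x - g x\<bar> \<partial>lborel)) \<longlonglongrightarrow> 0" by simp
    show ?thesis
      by (rule Lim_null_comparison[OF always_eventually z]) (simp add: le)
  qed
  have i1: "integrable lborel (\<lambda>x. \<phi> x * (T' (u x) * g x))"
    using integrable_test_mult[OF integrable_bounded_mult[OF iq(3) _ L, of u] \<phi>(1)] by simp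
  have i2: "integrable lborel (\<lambda>x. \<phi> x * Q n x)" for n
    using integrable_test_mult[OF iq(2) \<phi>(1)] by simp
  have right: "(\<lambda>n. \<integral>x. \<phi> x * Q n x \<partial>lborel) \<longlonglongrightarrow> (\<integral>x. \<phi> x * (T' (u x) * g x) \<partial>lborel)"
  proof (rule LIM_zero_cancel, rule Lim_null_comparison[OF always_eventually, rule_format])
    show "(\<lambda>n. B * (\<integral>x. \<bar>Q n x - T' (u x) * g x\<bar> \<partial>lborel)) \<longlonglongrightarrow> 0"
      using tendsto_mult_left[OF Qlim, of B] by simp
    fix n
    have iTg: "integrable lborel (\<lambda>x. T' (u x) * g x)"
      using integrable_bounded_mult[OF iq(3) _ L, of u] by simp
    have "norm (\<integral>x. \<phi> x * Q n x - \<phi> x * (T' (u x) * g x) \<partial>lborel)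
        \<le> (\<integral>x. norm (\<phi> x * Q n x - \<phi> x * (T' (u x) * g x)) \<partial>lborel)"
      by (rule integral_norm_bound)
    also have "\<dots> \<le> (\<integral>x. B * \<bar>Q n x - T' (u x) * g x\<bar> \<partial>lborel)"
    proof (rule integral_mono)
      show "norm (\<phi> x * Q n x - \<phi> x * (T' (u x) * g x)) \<le> B * \<bar>Q n x - T' (u x) * g x\<bar>" for x
        using B(2)[of x] by (simp add: abs_mult mult_right_mono flip: right_diff_distrib)
    qed (use i1 i2 iq iTg in auto)
    finally have "norm (\<integral>x. \<phi> x * Q n x - \<phi> x * (T' (u x) * g x) \<partial>lborel)
        \<le> (\<integral>x. B * \<bar>Q n x - T' (u x) * g x\<bar> \<partial>lborel)" .
    then show "norm ((\<integral>x. \<phi> x * Q n x \<partial>lborel) - (\<integral>x. \<phi> x * (T' (u x) * g x) \<partial>lborel)) \<le> B * (\<integral>x. \<bar>Q n x - T' (u x) * g x\<bar> \<partial>lborel)"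
      using i1 i2 by simp
  qed
  \<comment> \<open>Integration by parts for difference quotients: translation invariance moves the
    shift from \<open>T (u x)\<close> to the test function.\<close>
  have parts: "(\<integral>x. \<phi> x * Q n x \<partial>lborel) = (\<integral>x. T (u x) * ((\<phi> (x - e n *\<^sub>R b) - \<phi> x) / e n) \<partial>lborel)" for n
  proof -
    have \<phi>s: "(\<lambda>x. \<phi> (x - e n *\<^sub>R b)) \<in> test_functions UNIV" using test_shift[OF \<phi>(1), of "- e n *\<^sub>R b"] by simp
    have "(\<integral>x. T (u (x + e n *\<^sub>R b)) * \<phi> x \<partial>lborel) = (\<integral>x. T (u (x + e n *\<^sub>R b)) * \<phi> ((x + e n *\<^sub>R b) - e n *\<^sub>R b) \<partial>lborel)"
      by simp
    also have "\<dots> = (\<integral>x. T (u x) * \<phi> (x - e n *\<^sub>R b) \<partial>lborel)"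
      by (rule integral_shift[of "\<lambda>x. T (u x) * \<phi> (x - e n *\<^sub>R b)"]) measurable
    finally have 1: "(\<integral>x. T (u (x + e n *\<^sub>R b)) * \<phi> x \<partial>lborel) = (\<integral>x. T (u x) * \<phi> (x - e n *\<^sub>R b) \<partial>lborel)" .
    note i = integrable_mult_test[OF iT \<phi>(1)] integrable_mult_test[OF iT \<phi>s]
      integrable_mult_test[OF integrable_shift[OF iT, of "e n *\<^sub>R b"] \<phi>(1)]
    have "(\<integral>x. \<phi> x * Q n x \<partial>lborel) = (\<integral>x. (T (u (x + e n *\<^sub>R b)) * \<phi> x - T (u x) * \<phi> x) / e n \<partial>lborel)"
      unfolding Q_def by (intro Bochner_Integration.integral_cong refl) (simp add: algebra_simps diff_divide_distrib)
    also have "\<dots> = ((\<integral>x. T (u x) * \<phi> (x - e n *\<^sub>R b) \<partial>lborel) - (\<integral>x. T (u x) * \<phi> x \<partial>lborel)) / e n"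
      using i 1 by simp
    also have "\<dots> = (\<integral>x. (T (u x) * \<phi> (x - e n *\<^sub>R b) - T (u x) * \<phi> x) / e n \<partial>lborel)"
      using i by simp
    also have "\<dots> = (\<integral>x. T (u x) * ((\<phi> (x - e n *\<^sub>R b) - \<phi> x) / e n) \<partial>lborel)"
      by (intro Bochner_Integration.integral_cong refl) (simp add: algebra_simps diff_divide_distrib)
    finally show ?thesis .
  qed
  have left: "(\<lambda>n. \<integral>x. T (u x) * ((\<phi> (x - e n *\<^sub>R b) - \<phi> x) / e n) \<partial>lborel) \<longlonglongrightarrow> (\<integral>x. T (u x) * - (grad \<phi> x \<bullet> b) \<partial>lborel)"
  proof (rule integral_dominated_convergence[where w = "\<lambda>x. \<bar>T (u x)\<bar> * B"])
    have dl: "((\<lambda>t. \<phi> (x - t *\<^sub>R b)) has_real_derivative - (grad \<phi> (x - t *\<^sub>R b) \<bullet> b)) (at t)" for x t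
    proof -
      have l: "((\<lambda>t. x - t *\<^sub>R b) has_derivative (\<lambda>s. - (s *\<^sub>R b))) (at t)"
        by (auto intro!: derivative_eq_intros)
      show ?thesis
        unfolding has_field_derivative_def
        by (rule has_derivative_eq_rhs[OF has_derivative_compose[OF l smooth_has_derivative[OF s\<phi>]]])
          (simp add: fun_eq_iff)
    qed
    show "AE x in lborel. (\<lambda>n. T (u x) * ((\<phi> (x - e n *\<^sub>R b) - \<phi> x) / e n)) \<longlonglongrightarrow> T (u x) * - (grad \<phi> x \<bullet> b)"
    proof (intro AE_I2 tendsto_mult_left)
      fix x
      have "((\<lambda>h. (\<phi> (x - h *\<^sub>R b) - \<phi> x) / h) \<longlongrightarrow> - (grad \<phi> x \<bullet> b)) (at 0)"
        using dl[of x 0] by (simp add: DERIV_def)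
      then show "(\<lambda>n. (\<phi> (x - e n *\<^sub>R b) - \<phi> x) / e n) \<longlonglongrightarrow> - (grad \<phi> x \<bullet> b)"
        by (rule filterlim_compose) (use e in \<open>auto simp: filterlim_at\<close>)
    qed
    show "AE x in lborel. norm (T (u x) * ((\<phi> (x - e n *\<^sub>R b) - \<phi> x) / e n)) \<le> \<bar>T (u x)\<bar> * B" for n
    proof (intro AE_I2)
      fix x
      have nb: "\<bar>grad \<phi> y \<bullet> b\<bar> \<le> B" for y
        using B(3)[of y] Basis_le_norm[OF \<phi>(2), of "grad \<phi> y"] by linarith
      have "norm (\<phi> (x - e n *\<^sub>R b) - \<phi> (x - 0 *\<^sub>R b)) \<le> B * norm (e n - 0)"
        by (rule field_differentiable_bound[of UNIV "\<lambda>t. \<phi> (x - t *\<^sub>R b)" "\<lambda>t. - (grad \<phi> (x - t *\<^sub>R b) \<bullet> b)"])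
          (use dl nb in auto)
      then have "\<bar>(\<phi> (x - e n *\<^sub>R b) - \<phi> x) / e n\<bar> \<le> B" using e(2)[of n] by (simp add: field_simps)
      then show "norm (T (u x) * ((\<phi> (x - e n *\<^sub>R b) - \<phi> x) / e n)) \<le> \<bar>T (u x)\<bar> * B"
        by (simp only: real_norm_def abs_mult) (intro mult_left_mono, auto)
    qed
  qed (use iT in auto)
  have "(\<integral>x. T (u x) * - (grad \<phi> x \<bullet> b) \<partial>lborel) = (\<integral>x. \<phi> x * (T' (u x) * g x) \<partial>lborel)"
    using LIMSEQ_unique[OF left right[unfolded parts]] .
  then show "(\<integral>x. T (u x) * (grad \<phi> x \<bullet> b) \<partial>lborel) = - (\<integral>x. \<phi> x * (T' (u x) *\<^sub>R G x \<bullet> b) \<partial>lborel)"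
    by (simp add: g_def)
qed

section \<open>Truncation at a level\<close>

lemma max_square_has_derivative: "((\<lambda>z::real. (max 0 (z - c))\<^sup>2) has_real_derivative 2 * max 0 (z - c)) (at z)"
proof -
  consider "z < c" | "z > c" | "z = c" by linarith
  then show ?thesis
  proof cases
    case 1
    have "((\<lambda>z. 0) has_real_derivative 0) (at z)" by simp
    then have "((\<lambda>z. (max 0 (z - c))\<^sup>2) has_real_derivative 0) (at z)"
      by (rule has_field_derivative_transform_within_open[of _ _ _ "{..<c}"]) (use 1 in auto)
    then show ?thesis using 1 by simp
  next
    case 2
    have "((\<lambda>z. (z - c)\<^sup>2) has_real_derivative 2 * (z - c)) (at z)"
      by (auto intro!: derivative_eq_intros)
    then have "((\<lambda>z. (max 0 (z - c))\<^sup>2) has_real_derivative 2 * (z - c)) (at z)"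
      by (rule has_field_derivative_transform_within_open[of _ _ _ "{c<..}"]) (use 2 in auto)
    then show ?thesis using 2 by simp
  next
    case 3
    have A: "((\<lambda>h. max 0 h) \<longlongrightarrow> 0) (at (0::real))"
      using tendsto_max[OF tendsto_const[of 0] tendsto_ident_at[of 0 UNIV]] by simp
    have "((\<lambda>h. (max 0 h)\<^sup>2 / h) \<longlongrightarrow> 0) (at (0::real))"
      by (rule Lim_transform_eventually[OF A])
        (auto simp: eventually_at power2_eq_square max_def intro!: exI[of _ 1])
    then show ?thesis using 3 by (simp add: DERIV_def)
  qed
qed

text \<open>The truncation is the limit of continuously differentiable functions whose derivatives
  rise linearly from 0 at \<open>k\<close> to 1 at k + 1/N. A difference of two squares realises
  them. All these derivatives vanish at \<open>k\<close> itself, so the limit is the indicator of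
  the strict superlevel set, and no separate argument is needed on the set where u = k.\<close>

lemma W11_excess:
  fixes u :: "'a::euclidean_space \<Rightarrow> real"
  assumes "W11 u G" "0 \<le> k"
  shows "W11 (\<lambda>x. max 0 (u x - k)) (\<lambda>x. indicator {x. u x > k} x *\<^sub>R G x)"
proof -
  note W = W11D[OF assms(1)]
  note [measurable] = W(3,4)
  define N where "N n = real (Suc n)" for n
  define T where "T n y = N n / 2 * ((max 0 (y - k))\<^sup>2 - (max 0 (y - (k + 1 / N n)))\<^sup>2)" for n y
  define T' where "T' n y = N n * (max 0 (y - k) - max 0 (y - (k + 1 / N n)))" for n y
  have N: "N n > 0" for n by (simp add: N_def)
  have der: "(T n has_real_derivative T' n y) (at y)" for n y
    unfolding T_def[abs_def] T'_def
    by (rule DERIV_cong[OF DERIV_cmult[OF DERIV_diff[OF max_square_has_derivative max_square_has_derivative]]])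
      (simp add: algebra_simps)
  have T'b: "0 \<le> T' n y" "T' n y \<le> 1" for n y
  proof -
    have "0 \<le> max 0 (y - k) - max 0 (y - (k + a)) \<and> max 0 (y - k) - max 0 (y - (k + a)) \<le> a"
      if "0 < a" for a :: real
      using that by (auto simp: max_def)
    from this[OF divide_pos_pos[OF zero_less_one N[of n]]]
    have "0 \<le> max 0 (y - k) - max 0 (y - (k + 1 / N n))" "max 0 (y - k) - max 0 (y - (k + 1 / N n)) \<le> 1 / N n"
      by blast+
    moreover have "N n * (1 / N n) = 1" using N[of n] by simp
    ultimately show "0 \<le> T' n y" "T' n y \<le> 1"
      unfolding T'_def using N[of n] mult_left_mono[of _ "1 / N n" "N n"]
      by (metis less_imp_le mult_nonneg_nonneg, metis less_imp_le)
  qed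
  \<comment> \<open>Here \<open>k\<close> has to be nonnegative: a function that does not vanish at
    0 would make the composition non-integrable over the whole space.\<close>
  have T0: "T n 0 = 0" for n
  proof -
    have "1 / N n > 0" using N by simp
    then have "0 - (k + 1 / N n) \<le> 0" "0 - k \<le> 0" using assms(2) by linarith+
    then show ?thesis unfolding T_def by (simp add: max_def)
  qed
  have Wn: "W11 (\<lambda>x. T n (u x)) (\<lambda>x. T' n (u x) *\<^sub>R G x)" for n
  proof (rule W11_chain[OF assms(1) der])
    show "continuous_on UNIV (T' n)" unfolding T'_def[abs_def] by (intro continuous_intros)
    show "\<bar>T' n y\<bar> \<le> 1" for y using T'b[of n y] by simp
  qed (rule T0)
  have Tle: "\<bar>T n y\<bar> \<le> \<bar>y\<bar>" for n y
    using field_differentiable_bound[of UNIV "T n" "T' n" 1 y 0] der T'b T0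
    by (simp add: has_field_derivative_at_within)
  have ev: "\<forall>\<^sub>F n in sequentially. 1 / N n < d" if "d > 0" for d
    using order_tendstoD(2)[OF LIMSEQ_Suc[OF lim_1_over_n] that] by (simp add: N_def)
  have lim0: "(\<lambda>n. 1 / N n) \<longlonglongrightarrow> 0"
    using LIMSEQ_Suc[OF lim_1_over_n] by (simp add: N_def)
  have sq: "M / 2 * (z\<^sup>2 - (z - 1 / M)\<^sup>2) = z - 1 / M / 2" if "0 < M" for M z :: real
  proof -
    define a where "a = 1 / M"
    have "M / 2 * (z\<^sup>2 - (z - a)\<^sup>2) = z * (M * a) - a * (M * a) / 2"
      by (simp add: power2_eq_square algebra_simps)
    moreover have "M * a = 1" using that by (simp add: a_def)
    ultimately show ?thesis by (simp add: a_def)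
  qed
  have Tlim: "(\<lambda>n. T n y) \<longlonglongrightarrow> max 0 (y - k)" for y
  proof (cases "y > k")
    case True
    have "\<forall>\<^sub>F n in sequentially. y - k - 1 / N n / 2 = T n y"
      using ev[OF diff_gt_0_iff_gt[THEN iffD2, OF True]]
    proof eventually_elim
      case (elim n)
      have m: "max 0 (y - k) = y - k" "max 0 (y - (k + 1 / N n)) = y - k - 1 / N n"
        using True elim by linarith+
      show ?case unfolding T_def m by (rule sq[OF N, symmetric])
    qed
    moreover have "(\<lambda>n. y - k - 1 / N n / 2) \<longlonglongrightarrow> y - k - 0 / 2"
      by (intro tendsto_intros lim0) auto
    ultimately have "(\<lambda>n. T n y) \<longlonglongrightarrow> y - k - 0 / 2" by (rule Lim_transform_eventually[rotated])
    then show ?thesis using True by (simp add: max_def)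
  next
    case False
    have m: "max 0 (y - k) = 0" "max 0 (y - (k + 1 / N n)) = 0" for n
      using divide_pos_pos[OF zero_less_one N[of n]] False by linarith+
    then show ?thesis unfolding T_def m by simp
  qed
  have T'lim: "(\<lambda>n. T' n (u x) *\<^sub>R G x) \<longlonglongrightarrow> indicator {x. u x > k} x *\<^sub>R G x" for x
  proof (rule tendsto_eventually)
    show "\<forall>\<^sub>F n in sequentially. T' n (u x) *\<^sub>R G x = indicator {x. u x > k} x *\<^sub>R G x"
    proof (cases "u x > k")
      case True
      show ?thesis using ev[OF diff_gt_0_iff_gt[THEN iffD2, OF True]]
      proof eventually_elim
        case (elim n)
        have m: "max 0 (u x - k) = u x - k" "max 0 (u x - (k + 1 / N n)) = u x - k - 1 / N n"
          using True elim by linarith+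
        show ?case unfolding T'_def m using N[of n] True by simp
      qed
    next
      case False
      have m: "max 0 (u x - k) = 0" "max 0 (u x - (k + 1 / N n)) = 0" for n
        using divide_pos_pos[OF zero_less_one N[of n]] False by linarith+
      show ?thesis unfolding T'_def m using False by simp
    qed
  qed
  show ?thesis
  proof (rule W11_limit[of "\<lambda>n x. T n (u x)" "\<lambda>n x. T' n (u x) *\<^sub>R G x", OF Wn, where w = "\<lambda>x. \<bar>u x\<bar>" and w' = "\<lambda>x. norm (G x)"])
    show "AE x in lborel. norm (T' n (u x) *\<^sub>R G x) \<le> norm (G x)" for n
      using T'b by (intro AE_I2) (simp add: mult_left_le_one_le)
  qed (use Tlim T'lim Tle W in auto)
qed

declare smooth_measurable [measurable del] smooth_grad_measurable [measurable del]

section \<open>A Sobolev inequality\<close>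

text \<open>Young's inequality for the functions normalised by \<open>A\<close> and
  \<open>B\<close>. If one of these is 0 the normalisation is impossible, but then that function
  vanishes almost everywhere. Stated with upper bounds instead of norms, the rule composes directly
  with earlier estimates.\<close>

lemma nn_Hoelder:
  fixes f g :: "'a \<Rightarrow> real"
  assumes [measurable]: "f \<in> borel_measurable M" "g \<in> borel_measurable M"
    and nn: "\<And>x. 0 \<le> f x" "\<And>x. 0 \<le> g x"
    and ab: "0 < a" "0 < b" "a + b = 1"
    and f: "(\<integral>\<^sup>+x. ennreal (f x) \<partial>M) \<le> ennreal A" and g: "(\<integral>\<^sup>+x. ennreal (g x) \<partial>M) \<le> ennreal B"
    and AB: "0 \<le> A" "0 \<le> B"
  shows "(\<integral>\<^sup>+x. ennreal (f x powr a * g x powr b) \<partial>M) \<le> ennreal (A powr a * B powr b)"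
proof -
  have zero: "AE x in M. h x = 0" if "h \<in> borel_measurable M" "\<And>x. 0 \<le> h x" "(\<integral>\<^sup>+x. ennreal (h x) \<partial>M) \<le> ennreal 0" for h :: "'a \<Rightarrow> real"
  proof -
    have "(\<integral>\<^sup>+x. ennreal (h x) \<partial>M) = 0" using that(3) by simp
    then have "AE x in M. ennreal (h x) = 0" by (subst (asm) nn_integral_0_iff_AE) (use that in auto)
    then show ?thesis by eventually_elim (use that(2) in \<open>auto simp: ennreal_eq_0_iff intro: antisym\<close>)
  qed
  consider "A = 0 \<or> B = 0" | "A > 0" "B > 0" using AB by linarith
  then show ?thesis
  proof cases
    case 1
    then have "AE x in M. f x powr a * g x powr b = 0"
    proof
      assume "A = 0"
      then have "AE x in M. f x = 0" using zero[of f] f nn by simp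
      then show ?thesis by eventually_elim simp
    next
      assume "B = 0"
      then have "AE x in M. g x = 0" using zero[of g] g nn by simp
      then show ?thesis by eventually_elim simp
    qed
    then have "(\<integral>\<^sup>+x. ennreal (f x powr a * g x powr b) \<partial>M) = (\<integral>\<^sup>+x. 0 \<partial>M)"
      by (intro nn_integral_cong_AE) (auto elim!: eventually_mono)
    then show ?thesis by simp
  next
    case 2
    have pw: "f x powr a * g x powr b \<le> A powr a * B powr b * (a / A * f x + b / B * g x)" for x
    proof (cases "f x = 0 \<or> g x = 0")
      case True
      have "0 \<le> A powr a * B powr b * (a / A * f x + b / B * g x)"
        using ab 2 nn by (intro mult_nonneg_nonneg add_nonneg_nonneg) auto
      moreover have "f x powr a * g x powr b = 0" using True by auto
      ultimately show ?thesis by linarith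
    next
      case False
      then have "f x > 0" "g x > 0" using nn[of x] by auto
      then have "(f x / A) powr a * (g x / B) powr b \<le> a * (f x / A) + b * (g x / B)"
        using ab 2 by (intro Youngs_inequality_0) auto
      then have "f x powr a * g x powr b / (A powr a * B powr b) \<le> a * (f x / A) + b * (g x / B)"
        using nn 2 by (simp add: powr_divide)
      moreover have "0 < A powr a * B powr b" using 2 by simp
      ultimately show ?thesis by (simp add: pos_divide_le_eq mult.commute)
    qed
    have "(\<integral>\<^sup>+x. ennreal (f x powr a * g x powr b) \<partial>M)
        \<le> (\<integral>\<^sup>+x. ennreal (A powr a * B powr b) * (ennreal (a / A) * ennreal (f x) + ennreal (b / B) * ennreal (g x)) \<partial>M)"
      using pw nn ab 2 by (intro nn_integral_mono) (simp flip: ennreal_mult ennreal_plus add: ennreal_leI)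
    also have "\<dots> = ennreal (A powr a * B powr b) * (ennreal (a / A) * (\<integral>\<^sup>+x. ennreal (f x) \<partial>M) + ennreal (b / B) * (\<integral>\<^sup>+x. ennreal (g x) \<partial>M))"
      by (simp add: nn_integral_cmult nn_integral_add)
    also have "\<dots> \<le> ennreal (A powr a * B powr b) * (ennreal (a / A) * ennreal A + ennreal (b / B) * ennreal B)"
      using f g by (intro mult_left_mono add_mono) auto
    also have "\<dots> = ennreal (A powr a * B powr b)"
      using ab 2 by (simp flip: ennreal_mult ennreal_plus)
    finally show ?thesis .
  qed
qed

section \<open>Averages of the gradient over dilated balls\<close>

lemma nn_integral_dilate:
  fixes f :: "'a::euclidean_space \<Rightarrow> ennreal"
  assumes [measurable]: "f \<in> borel_measurable borel" and t: "t > 0"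
  shows "(\<integral>\<^sup>+z. f (x + t *\<^sub>R z) \<partial>lborel) = ennreal (t powr (- real DIM('a))) * (\<integral>\<^sup>+z. f z \<partial>lborel)"
proof -
  have "(\<integral>\<^sup>+z. f z \<partial>lborel) = ennreal (t ^ DIM('a)) * (\<integral>\<^sup>+z. f (x + t *\<^sub>R z) \<partial>lborel)"
    using t by (subst lborel_affine[of t x]) (simp_all add: nn_integral_density nn_integral_distr nn_integral_cmult)
  moreover have "t powr (- real DIM('a)) * t ^ DIM('a) = 1"
    using t by (simp add: powr_minus powr_realpow)
  ultimately show ?thesis
    using t by (simp flip: mult.assoc ennreal_mult)
qed

lemma nn_integral_powr_01:
  assumes "a < 1"
  shows "(\<integral>\<^sup>+t. ennreal (indicator {0<..<1} t * t powr (- a)) \<partial>lborel) \<le> ennreal (1 / (1 - a))"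
proof -
  have "((\<lambda>t. t powr (- a)) has_integral (1 powr (- a + 1) / (- a + 1))) {0..1}"
    by (rule has_integral_powr_from_0) (use assms in auto)
  then have "(\<integral>\<^sup>+t. ennreal (indicator {0..1} t * t powr (- a)) \<partial>lborel) = ennreal (1 powr (- a + 1) / (- a + 1))"
    by (intro nn_integral_has_integral_lebesgue) auto
  moreover have "(\<integral>\<^sup>+t. ennreal (indicator {0<..<1} t * t powr (- a)) \<partial>lborel) \<le> (\<integral>\<^sup>+t. ennreal (indicator {0..1} t * t powr (- a)) \<partial>lborel)"
    by (intro nn_integral_mono ennreal_leI mult_right_mono) (auto simp: indicator_def)
  ultimately show ?thesis by simp
qed

text \<open>Every z in \<open>Z\<close> has length between 2\<rho> and 4\<rho>, so x + z lies
  outside the support for every x in the ball. Hence v(x) is minus the increment along the segment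
  from x to x + z. Averaging over \<open>Z\<close> gives the bound, and 4\<rho> is the maximal
  length of z. The centre of \<open>Z\<close> is made explicit so that the set depends only on
  \<rho>.\<close>

lemma sobolev_potential:
  fixes v :: "'a::euclidean_space \<Rightarrow> real"
  assumes W: "W11 v G" and \<rho>: "0 < \<rho>" and supp: "\<And>x. x \<notin> ball x0 \<rho> \<Longrightarrow> v x = 0"
  obtains Z :: "'a set" where "Z = ball ((3 * \<rho>) *\<^sub>R (SOME b. b \<in> Basis)) \<rho>"
    "AE x in lborel. ennreal (\<bar>v x\<bar>) * emeasure lborel Z \<le>
       ennreal (4 * \<rho>) * (\<integral>\<^sup>+t. indicator {0<..<1} t * (\<integral>\<^sup>+z. indicator Z z * ennreal (norm (G (x + t *\<^sub>R z))) \<partial>lborel) \<partial>lborel)"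
proof
  note W' = W11D[OF W]
  note [measurable] = W'(3,4)
  define e :: 'a where "e = (SOME b. b \<in> Basis)"
  have e: "norm e = 1" unfolding e_def by (simp add: SOME_Basis)
  define Z where "Z = ball ((3 * \<rho>) *\<^sub>R e) \<rho>"
  show "Z = ball ((3 * \<rho>) *\<^sub>R (SOME b. b \<in> Basis)) \<rho>" by (simp add: Z_def e_def)
  have [measurable]: "Z \<in> sets borel" by (simp add: Z_def)
  have Zn: "2 * \<rho> < norm z" "norm z < 4 * \<rho>" if "z \<in> Z" for z
  proof -
    have d: "norm ((3 * \<rho>) *\<^sub>R e - z) < \<rho>" using that by (simp add: Z_def dist_norm)
    have n: "norm ((3 * \<rho>) *\<^sub>R e) = 3 * \<rho>" using \<rho> e by simp
    show "2 * \<rho> < norm z" "norm z < 4 * \<rho>"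
      using d n norm_triangle_ineq2[of "(3 * \<rho>) *\<^sub>R e" z] norm_triangle_ineq3[of "(3 * \<rho>) *\<^sub>R e" z] by linarith+
  qed
  define P where "P z x \<longleftrightarrow> v (x + z) - v x = (\<integral>t. indicator {0..1} t * (G (x + t *\<^sub>R z) \<bullet> z) \<partial>lborel)" for z x
  \<comment> \<open>The increment formula holds for almost every x once z is given. Fubini exchanges
    the order of the two exceptional sets, which requires the joint measurability shown
    next.\<close>
  have "AE z in lborel. AE x in lborel. P z x"
    unfolding P_def by (rule AE_I2) (rule W11_difference[OF W])
  moreover have "{p \<in> space (lborel \<Otimes>\<^sub>M lborel). P (fst p) (snd p)} \<in> sets (lborel \<Otimes>\<^sub>M lborel)"
    unfolding P_def by measurable
  ultimately have AE: "AE x in lborel. AE z in lborel. P z x"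
    using lborel_pair.AE_commute[of P] by blast
  show "AE x in lborel. ennreal (\<bar>v x\<bar>) * emeasure lborel Z \<le>
       ennreal (4 * \<rho>) * (\<integral>\<^sup>+t. indicator {0<..<1} t * (\<integral>\<^sup>+z. indicator Z z * ennreal (norm (G (x + t *\<^sub>R z))) \<partial>lborel) \<partial>lborel)"
    using AE
  proof eventually_elim
    case (elim x)
    show ?case
    proof (cases "x \<in> ball x0 \<rho>")
      case False
      then show ?thesis using supp by simp
    next
      case True
      have "ennreal (\<bar>v x\<bar>) * emeasure lborel Z = (\<integral>\<^sup>+z. indicator Z z * ennreal (\<bar>v x\<bar>) \<partial>lborel)"
        by (simp add: nn_integral_multc mult.commute)
      also have "\<dots> \<le> (\<integral>\<^sup>+z. indicator Z z * (ennreal (4 * \<rho>) * (\<integral>\<^sup>+t. indicator {0<..<1} t * ennreal (norm (G (x + t *\<^sub>R z))) \<partial>lborel)) \<partial>lborel)"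
      proof (rule nn_integral_mono_AE)
        show "AE z in lborel. indicator Z z * ennreal (\<bar>v x\<bar>) \<le> indicator Z z * (ennreal (4 * \<rho>) * (\<integral>\<^sup>+t. indicator {0<..<1} t * ennreal (norm (G (x + t *\<^sub>R z))) \<partial>lborel))"
          using elim
        proof eventually_elim
          case (elim z)
          show ?case
          proof (cases "z \<in> Z")
            case True
            note z = Zn[OF this]
            have "dist x x0 < \<rho>" using \<open>x \<in> ball x0 \<rho>\<close> by (simp add: dist_commute)
            then have "x + z \<notin> ball x0 \<rho>"
              using z norm_triangle_ineq4[of "x + z - x0" "x - x0"] by (auto simp: dist_norm norm_minus_commute)
            then have "v (x + z) = 0" by (rule supp)
            then have "\<bar>v x\<bar> = \<bar>\<integral>t. indicator {0..1} t * (G (x + t *\<^sub>R z) \<bullet> z) \<partial>lborel\<bar>"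
              using elim unfolding P_def by simp
            then have "ennreal \<bar>v x\<bar> \<le> (\<integral>\<^sup>+t. ennreal (norm (indicator {0..1} t * (G (x + t *\<^sub>R z) \<bullet> z))) \<partial>lborel)"
              by (cases "integrable lborel (\<lambda>t. indicator {0..1} t * (G (x + t *\<^sub>R z) \<bullet> z))")
                (auto dest: integral_norm_bound_ennreal simp: not_integrable_integral_eq)
            also have "\<dots> \<le> (\<integral>\<^sup>+t. ennreal (4 * \<rho>) * (indicator {0<..<1} t * ennreal (norm (G (x + t *\<^sub>R z)))) \<partial>lborel)"
            proof (rule nn_integral_mono_AE)
              \<comment> \<open>Dropping the endpoints prepares the later division by powers of
                \<open>t\<close>.\<close>
              have "AE t in lborel. t \<noteq> (0::real) \<and> t \<noteq> 1"
                by (intro AE_conjI AE_lborel_singleton)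
              then show "AE t in lborel. ennreal (norm (indicator {0..1} t * (G (x + t *\<^sub>R z) \<bullet> z))) \<le> ennreal (4 * \<rho>) * (indicator {0<..<1} t * ennreal (norm (G (x + t *\<^sub>R z))))"
              proof eventually_elim
                case (elim t)
                show ?case
                proof (cases "t \<in> {0<..<1}")
                  case True
                  have "\<bar>G (x + t *\<^sub>R z) \<bullet> z\<bar> \<le> 4 * \<rho> * norm (G (x + t *\<^sub>R z))"
                    using Cauchy_Schwarz_ineq2[of "G (x + t *\<^sub>R z)" z] z(2)
                      mult_left_mono[of "norm z" "4 * \<rho>" "norm (G (x + t *\<^sub>R z))"] by (simp add: mult.commute)
                  then show ?thesis using True \<rho> by (simp add: ennreal_leI flip: ennreal_mult)
                qed (use elim in \<open>auto simp: indicator_def\<close>)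
              qed
            qed
            also have "\<dots> = ennreal (4 * \<rho>) * (\<integral>\<^sup>+t. indicator {0<..<1} t * ennreal (norm (G (x + t *\<^sub>R z))) \<partial>lborel)"
              by (rule nn_integral_cmult) measurable
            finally show ?thesis by (intro mult_left_mono) auto
          qed simp
        qed
      qed
      also have "\<dots> = ennreal (4 * \<rho>) * (\<integral>\<^sup>+z. indicator Z z * (\<integral>\<^sup>+t. indicator {0<..<1} t * ennreal (norm (G (x + t *\<^sub>R z))) \<partial>lborel) \<partial>lborel)"
        by (subst nn_integral_cmult[symmetric]) (auto simp: mult.left_commute)
      also have "(\<integral>\<^sup>+z. indicator Z z * (\<integral>\<^sup>+t. indicator {0<..<1} t * ennreal (norm (G (x + t *\<^sub>R z))) \<partial>lborel) \<partial>lborel)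
          = (\<integral>\<^sup>+z. (\<integral>\<^sup>+t. indicator Z z * (indicator {0<..<1} t * ennreal (norm (G (x + t *\<^sub>R z)))) \<partial>lborel) \<partial>lborel)"
        by (intro nn_integral_cong nn_integral_cmult[symmetric]) measurable
      also have "\<dots> = (\<integral>\<^sup>+t. (\<integral>\<^sup>+z. indicator Z z * (indicator {0<..<1} t * ennreal (norm (G (x + t *\<^sub>R z)))) \<partial>lborel) \<partial>lborel)"
        by (rule lborel_pair.Fubini'[symmetric]) measurable
      also have "\<dots> = (\<integral>\<^sup>+t. indicator {0<..<1} t * (\<integral>\<^sup>+z. indicator Z z * ennreal (norm (G (x + t *\<^sub>R z))) \<partial>lborel) \<partial>lborel)"
        by (subst mult.left_commute) (intro nn_integral_cong nn_integral_cmult, measurable)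
      finally show ?thesis .
    qed
  qed
qed

text \<open>Only exponents strictly below the critical one are needed, which makes the inequality an
  application of Hoelder's inequality to the averages of the gradient over dilated balls.\<close>

lemma sobolev:
  fixes s r \<rho> :: real
  assumes s: "1 < s" "s < r" and sub: "real DIM('a) * (1 / s - 1 / r) < 1" and \<rho>: "0 < \<rho>"
  obtains C :: real where "0 < C"
    "\<And>(v :: 'a::euclidean_space \<Rightarrow> real) G x0 I. W11 v G \<Longrightarrow> (\<And>x. x \<notin> ball x0 \<rho> \<Longrightarrow> v x = 0) \<Longrightarrow> 0 \<le> I \<Longrightarrow>
      (\<integral>\<^sup>+x. ennreal (norm (G x) powr s) \<partial>lborel) \<le> ennreal I \<Longrightarrow>
      (\<integral>\<^sup>+x. ennreal (\<bar>v x\<bar> powr r) \<partial>lborel) \<le> ennreal (C * I powr (r / s))"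
proof -
  define Z :: "'a set" where "Z = ball ((3 * \<rho>) *\<^sub>R (SOME b. b \<in> Basis)) \<rho>"
  have [measurable]: "Z \<in> sets borel" by (simp add: Z_def)
  define z where "z = measure lborel Z"
  have z: "z > 0" using \<rho> unfolding z_def Z_def by (simp add: content_ball_pos)
  have emZ: "emeasure lborel Z = ennreal z"
    unfolding z_def Z_def by (rule emeasure_eq_ennreal_measure) (metis emeasure_lborel_ball_finite infinity_ennreal_def less_irrefl)
  define N where "N = real DIM('a)"
  have N0: "N > 0" by (simp add: N_def)
  \<comment> \<open>Raising the exponent from \<open>s\<close> to \<open>r\<close> costs a factor
    t^(-N \<kappa>) on the ball dilated by \<open>t\<close>. This factor is integrable near 0
    because N \<kappa> < 1, and \<open>M\<close> bounds its integral.\<close>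
  define \<kappa> where "\<kappa> = 1 / s - 1 / r"
  have \<kappa>: "\<kappa> > 0" "N * \<kappa> < 1" using s sub by (auto simp: \<kappa>_def N_def field_simps)
  define M where "M = 1 / (1 - N * \<kappa>)"
  have M: "M > 0" using \<kappa> by (simp add: M_def)
  define K where "K = (4 * \<rho> / z * z powr (1 - 1 / s) * M powr (1 - 1 / r)) powr r"
  have K: "K > 0" using \<rho> z M by (simp add: K_def)
  show ?thesis
  proof
    show "0 < K * (M * z)" using K M z by simp
    fix v :: "'a \<Rightarrow> real" and G x0 I
    assume W: "W11 v G" and supp: "\<And>x. x \<notin> ball x0 \<rho> \<Longrightarrow> v x = 0" and I: "0 \<le> I"
      and GI: "(\<integral>\<^sup>+x. ennreal (norm (G x) powr s) \<partial>lborel) \<le> ennreal I"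
    note [measurable] = W11D(3,4)[OF W]
    \<comment> \<open>The quantity \<open>J t x\<close> is used in two ways: it is bounded pointwise
      by t^(-N) I through the dilation, and its integral over \<open>x\<close> is at most z I for
      every \<open>t\<close>.\<close>
    define J where "J t x = (\<integral>\<^sup>+y. indicator Z y * ennreal (norm (G (x + t *\<^sub>R y)) powr s) \<partial>lborel)" for t x
    have Jm [measurable]: "(\<lambda>(t, x). J t x) \<in> borel_measurable (lborel \<Otimes>\<^sub>M lborel)"
      unfolding J_def by measurable
    have J1: "J t x \<le> ennreal (t powr (- N) * I)" if "t > 0" for t x
    proof -
      have "J t x \<le> (\<integral>\<^sup>+y. ennreal (norm (G (x + t *\<^sub>R y)) powr s) \<partial>lborel)"
        unfolding J_def by (intro nn_integral_mono) (auto simp: indicator_def)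
      also have "\<dots> = ennreal (t powr (- N)) * (\<integral>\<^sup>+y. ennreal (norm (G y) powr s) \<partial>lborel)"
        unfolding N_def by (rule nn_integral_dilate[OF _ that]) measurable
      also have "\<dots> \<le> ennreal (t powr (- N)) * ennreal I" by (intro mult_left_mono GI) auto
      finally show ?thesis using I by (simp flip: ennreal_mult)
    qed
    have J2: "(\<integral>\<^sup>+x. J t x \<partial>lborel) \<le> ennreal (z * I)" for t
    proof -
      have "(\<integral>\<^sup>+x. J t x \<partial>lborel) = (\<integral>\<^sup>+y. (\<integral>\<^sup>+x. indicator Z y * ennreal (norm (G (x + t *\<^sub>R y)) powr s) \<partial>lborel) \<partial>lborel)"
        unfolding J_def by (rule lborel_pair.Fubini') measurable
      also have "\<dots> = (\<integral>\<^sup>+y. indicator Z y * (\<integral>\<^sup>+x. ennreal (norm (G (x + t *\<^sub>R y)) powr s) \<partial>lborel) \<partial>lborel)"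
        by (subst nn_integral_cmult) auto
      also have "\<dots> = (\<integral>\<^sup>+y. indicator Z y * (\<integral>\<^sup>+x. ennreal (norm (G x) powr s) \<partial>lborel) \<partial>lborel)"
        by (subst nn_integral_shift[of "\<lambda>x. ennreal (norm (G x) powr s)"]) auto
      also have "\<dots> \<le> (\<integral>\<^sup>+y. indicator Z y * ennreal I \<partial>lborel)"
        by (intro nn_integral_mono mult_left_mono GI) auto
      also have "\<dots> = ennreal (z * I)"
        using I z by (simp add: nn_integral_multc emZ ennreal_mult)
      finally show ?thesis .
    qed
    define j where "j t x = enn2real (J t x)" for t x
    have jJ: "J t x = ennreal (j t x)" if "t > 0" for t x
      using J1[OF that, of x] unfolding j_def
      by (metis ennreal_enn2real ennreal_less_top order_le_less_trans)
    have j0: "0 \<le> j t x" for t x by (simp add: j_def)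
    have jm [measurable]: "(\<lambda>(t, x). j t x) \<in> borel_measurable (lborel \<Otimes>\<^sub>M lborel)"
      unfolding j_def by measurable
    have j1: "j t x \<le> t powr (- N) * I" if "t > 0" for t x
      using J1[OF that, of x] I unfolding jJ[OF that] by (subst (asm) ennreal_le_iff) auto
    have avg: "(\<integral>\<^sup>+y. indicator Z y * ennreal (norm (G (x + t *\<^sub>R y))) \<partial>lborel)
        \<le> ennreal (z powr (1 - 1 / s) * I powr \<kappa> * (t powr (- N * \<kappa>) * j t x powr (1 / r)))" if t: "t > 0" for t x
    proof -
      have "(\<integral>\<^sup>+y. indicator Z y * ennreal (norm (G (x + t *\<^sub>R y))) \<partial>lborel) =
          (\<integral>\<^sup>+y. ennreal ((indicator Z y * norm (G (x + t *\<^sub>R y)) powr s) powr (1 / s) * (indicator Z y) powr (1 - 1 / s)) \<partial>lborel)"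
        using s by (intro nn_integral_cong) (auto simp: indicator_def powr_powr)
      also have "\<dots> \<le> ennreal (j t x powr (1 / s) * z powr (1 - 1 / s))"
      proof (rule nn_Hoelder)
        show "(\<integral>\<^sup>+y. ennreal (indicator Z y * norm (G (x + t *\<^sub>R y)) powr s) \<partial>lborel) \<le> ennreal (j t x)"
          unfolding jJ[OF t, symmetric] J_def by (intro nn_integral_mono) (auto simp: indicator_def)
        show "(\<integral>\<^sup>+y. ennreal (indicator Z y) \<partial>lborel) \<le> ennreal z"
          by (simp add: ennreal_indicator emZ)
      qed (use s z j0 in auto)
      \<comment> \<open>The power 1/s is divided as 1/r + \<kappa>. The part with \<kappa> is spent
        on the pointwise bound, and the part with 1/r is kept for the integration over
        \<open>x\<close>.\<close>
      also have "j t x powr (1 / s) = j t x powr (1 / r) * j t x powr \<kappa>"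
        by (simp add: \<kappa>_def flip: powr_add)
      also have "ennreal (j t x powr (1 / r) * j t x powr \<kappa> * z powr (1 - 1 / s))
          \<le> ennreal (j t x powr (1 / r) * (t powr (- N) * I) powr \<kappa> * z powr (1 - 1 / s))"
        using j1[OF t, of x] j0 \<kappa> by (intro ennreal_leI mult_right_mono mult_left_mono powr_mono2) auto
      also have "j t x powr (1 / r) * (t powr (- N) * I) powr \<kappa> * z powr (1 - 1 / s) =
          z powr (1 - 1 / s) * I powr \<kappa> * (t powr (- N * \<kappa>) * j t x powr (1 / r))"
        using I by (simp add: powr_mult powr_powr mult_ac)
      finally show ?thesis .
    qed
    \<comment> \<open>Hoelder's inequality in \<open>t\<close> for the weight t^(-N \<kappa>) turns
      the integral of j^(1/r) into w^(1/r) times a power of \<open>M\<close>. After raising to the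
      power \<open>r\<close>, only the integral of \<open>w\<close> remains, and Fubini computes
      it.\<close>
    define w where "w x = (\<integral>\<^sup>+t. ennreal (indicator {0<..<1} t * (t powr (- N * \<kappa>) * j t x)) \<partial>lborel)" for x
    have wm [measurable]: "w \<in> borel_measurable borel" unfolding w_def[abs_def] by measurable
    have t_int: "(\<integral>\<^sup>+t. indicator {0<..<1} t * (\<integral>\<^sup>+y. indicator Z y * ennreal (norm (G (x + t *\<^sub>R y))) \<partial>lborel) \<partial>lborel)
        \<le> ennreal (z powr (1 - 1 / s) * I powr \<kappa> * (X powr (1 / r) * M powr (1 - 1 / r)))"
      if X: "w x = ennreal X" "0 \<le> X" for x X
    proof -
      have "(\<integral>\<^sup>+t. indicator {0<..<1} t * (\<integral>\<^sup>+y. indicator Z y * ennreal (norm (G (x + t *\<^sub>R y))) \<partial>lborel) \<partial>lborel)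
         \<le> (\<integral>\<^sup>+t. ennreal (z powr (1 - 1 / s) * I powr \<kappa>) * ennreal ((indicator {0<..<1} t * (t powr (- N * \<kappa>) * j t x)) powr (1 / r) * (indicator {0<..<1} t * t powr (- (N * \<kappa>))) powr (1 - 1 / r)) \<partial>lborel)"
      proof (intro nn_integral_mono)
        fix t :: real
        show "indicator {0<..<1} t * (\<integral>\<^sup>+y. indicator Z y * ennreal (norm (G (x + t *\<^sub>R y))) \<partial>lborel)
          \<le> ennreal (z powr (1 - 1 / s) * I powr \<kappa>) * ennreal ((indicator {0<..<1} t * (t powr (- N * \<kappa>) * j t x)) powr (1 / r) * (indicator {0<..<1} t * t powr (- (N * \<kappa>))) powr (1 - 1 / r))"
        proof (cases "t \<in> {0<..<1}")
          case True
          then have t: "t > 0" by simp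
          have "(t powr (- N * \<kappa>) * j t x) powr (1 / r) * (t powr (- (N * \<kappa>))) powr (1 - 1 / r)
              = ((t powr (- N * \<kappa>)) powr (1 / r) * (t powr (- N * \<kappa>)) powr (1 - 1 / r)) * j t x powr (1 / r)"
            using j0[of t x] by (simp add: powr_mult mult_ac)
          also have "(t powr (- N * \<kappa>)) powr (1 / r) * (t powr (- N * \<kappa>)) powr (1 - 1 / r) = (t powr (- N * \<kappa>)) powr (1 / r + (1 - 1 / r))"
            by (rule powr_add[symmetric])
          also have "\<dots> * j t x powr (1 / r) = t powr (- N * \<kappa>) * j t x powr (1 / r)" by simp
          finally show ?thesis using avg[OF t, of x] True by (simp flip: ennreal_mult)
        qed simp
      qed
      also have "\<dots> = ennreal (z powr (1 - 1 / s) * I powr \<kappa>) * (\<integral>\<^sup>+t. ennreal ((indicator {0<..<1} t * (t powr (- N * \<kappa>) * j t x)) powr (1 / r) * (indicator {0<..<1} t * t powr (- (N * \<kappa>))) powr (1 - 1 / r)) \<partial>lborel)"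
        by (rule nn_integral_cmult) measurable
      also have "\<dots> \<le> ennreal (z powr (1 - 1 / s) * I powr \<kappa>) * ennreal (X powr (1 / r) * M powr (1 - 1 / r))"
      proof (intro mult_left_mono nn_Hoelder)
        show "(\<integral>\<^sup>+t. ennreal (indicator {0<..<1} t * (t powr (- N * \<kappa>) * j t x)) \<partial>lborel) \<le> ennreal X"
          using X(1) unfolding w_def by simp
        show "(\<integral>\<^sup>+t. ennreal (indicator {0<..<1} t * t powr (- (N * \<kappa>))) \<partial>lborel) \<le> ennreal M"
          unfolding M_def by (rule nn_integral_powr_01[OF \<kappa>(2)])
      qed (use s M X j0 in auto)
      finally show ?thesis by (simp flip: ennreal_mult)
    qed
    obtain Z' :: "'a set" where Z': "Z' = ball ((3 * \<rho>) *\<^sub>R (SOME b. b \<in> Basis)) \<rho>"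
      "AE x in lborel. ennreal (\<bar>v x\<bar>) * emeasure lborel Z' \<le>
       ennreal (4 * \<rho>) * (\<integral>\<^sup>+t. indicator {0<..<1} t * (\<integral>\<^sup>+y. indicator Z' y * ennreal (norm (G (x + t *\<^sub>R y))) \<partial>lborel) \<partial>lborel)"
      using sobolev_potential[OF W \<rho> supp] .
    have "Z' = Z" by (simp add: Z'(1) Z_def)
    note pot = Z'(2)[unfolded this emZ]
    \<comment> \<open>If \<open>I\<close> were 0, the factor in front would be 0 and would swallow
      an infinite value of \<open>w\<close>. That case is settled separately, by showing that v
      vanishes almost everywhere.\<close>
    have pw: "AE x in lborel. ennreal (\<bar>v x\<bar> powr r) \<le> ennreal (K * I powr (\<kappa> * r)) * w x \<or> I = 0"
      using pot
    proof eventually_elim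
      case (elim x)
      show ?case
      proof (cases "w x")
        case (real X)
        have "ennreal (\<bar>v x\<bar> * z) \<le> ennreal (4 * \<rho> * (z powr (1 - 1 / s) * I powr \<kappa> * (X powr (1 / r) * M powr (1 - 1 / r))))"
          using order_trans[OF elim mult_left_mono[OF t_int[OF real(2,1)]]] \<rho> z by (simp add: ennreal_mult)
        then have "\<bar>v x\<bar> * z \<le> 4 * \<rho> * (z powr (1 - 1 / s) * I powr \<kappa> * (X powr (1 / r) * M powr (1 - 1 / r)))"
          using \<rho> by (subst (asm) ennreal_le_iff) auto
        then have "\<bar>v x\<bar> \<le> (4 * \<rho> / z * z powr (1 - 1 / s) * M powr (1 - 1 / r)) * I powr \<kappa> * X powr (1 / r)"
          unfolding pos_le_divide_eq[OF z, symmetric] by (simp add: mult_ac)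
        then have "\<bar>v x\<bar> powr r \<le> ((4 * \<rho> / z * z powr (1 - 1 / s) * M powr (1 - 1 / r)) * I powr \<kappa> * X powr (1 / r)) powr r"
          using s by (intro powr_mono2) auto
        also have "\<dots> = K * I powr (\<kappa> * r) * X"
        proof -
          have "(L * I powr \<kappa> * X powr (1 / r)) powr r = L powr r * (I powr \<kappa>) powr r * (X powr (1 / r)) powr r"
            if "0 \<le> L" for L
            using that by (simp add: powr_mult)
          from this[of "4 * \<rho> / z * z powr (1 - 1 / s) * M powr (1 - 1 / r)"] show ?thesis
            using s real(1) \<rho> z M by (simp add: powr_powr K_def)
        qed
        finally show ?thesis using real K by (simp add: ennreal_leI flip: ennreal_mult)
      next
        case top
        have "0 < K * I powr (\<kappa> * r)" if "I \<noteq> 0" using K I that by simp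
        then show ?thesis using top by (auto simp: ennreal_mult_top)
      qed
    qed
    have wint: "(\<integral>\<^sup>+x. w x \<partial>lborel) \<le> ennreal (M * (z * I))"
    proof -
      have "(\<integral>\<^sup>+x. w x \<partial>lborel) = (\<integral>\<^sup>+t. (\<integral>\<^sup>+x. ennreal (indicator {0<..<1} t * (t powr (- N * \<kappa>) * j t x)) \<partial>lborel) \<partial>lborel)"
        unfolding w_def by (rule lborel_pair.Fubini') measurable
      also have "\<dots> \<le> (\<integral>\<^sup>+t. ennreal (indicator {0<..<1} t * t powr (- (N * \<kappa>))) * ennreal (z * I) \<partial>lborel)"
      proof (intro nn_integral_mono)
        fix t :: real
        show "(\<integral>\<^sup>+x. ennreal (indicator {0<..<1} t * (t powr (- N * \<kappa>) * j t x)) \<partial>lborel) \<le> ennreal (indicator {0<..<1} t * t powr (- (N * \<kappa>))) * ennreal (z * I)"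
        proof (cases "t \<in> {0<..<1}")
          case True
          then have t: "t > 0" by simp
          have "(\<integral>\<^sup>+x. ennreal (t powr (- N * \<kappa>) * j t x) \<partial>lborel) = ennreal (t powr (- N * \<kappa>)) * (\<integral>\<^sup>+x. J t x \<partial>lborel)"
            unfolding jJ[OF t] by (subst nn_integral_cmult[symmetric]) (auto simp: j0 ennreal_mult)
          also have "\<dots> \<le> ennreal (t powr (- N * \<kappa>)) * ennreal (z * I)"
            by (intro mult_left_mono J2) auto
          finally show ?thesis using True by simp
        qed simp
      qed
      also have "\<dots> = (\<integral>\<^sup>+t. ennreal (indicator {0<..<1} t * t powr (- (N * \<kappa>))) \<partial>lborel) * ennreal (z * I)"
        by (rule nn_integral_multc) measurable
      also have "\<dots> \<le> ennreal M * ennreal (z * I)"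
        unfolding M_def by (intro mult_right_mono nn_integral_powr_01[OF \<kappa>(2)]) auto
      finally show ?thesis using M z I by (simp flip: ennreal_mult)
    qed
    show "(\<integral>\<^sup>+x. ennreal (\<bar>v x\<bar> powr r) \<partial>lborel) \<le> ennreal (K * (M * z) * I powr (r / s))"
    proof (cases "I = 0")
      case True
      have "AE x in lborel. v x = 0"
        using pot AE_I2
      proof -
        have "(\<integral>\<^sup>+x. w x \<partial>lborel) = 0" using wint True by simp
        then have "AE x in lborel. w x = 0" by (subst (asm) nn_integral_0_iff_AE) auto
        then show ?thesis using pot
        proof eventually_elim
          case (elim x)
          have "(\<integral>\<^sup>+t. indicator {0<..<1} t * (\<integral>\<^sup>+y. indicator Z y * ennreal (norm (G (x + t *\<^sub>R y))) \<partial>lborel) \<partial>lborel) \<le> 0"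
            using t_int[of x 0] elim(1) s by simp
          then have "ennreal \<bar>v x\<bar> * ennreal z = 0" using elim(2) by simp
          then show ?case using z by simp
        qed
      qed
      then have "(\<integral>\<^sup>+x. ennreal (\<bar>v x\<bar> powr r) \<partial>lborel) = (\<integral>\<^sup>+(x::'a). 0 \<partial>lborel)"
        by (intro nn_integral_cong_AE) (auto elim!: eventually_mono)
      then show ?thesis by simp
    next
      case False
      then have "(\<integral>\<^sup>+x. ennreal (\<bar>v x\<bar> powr r) \<partial>lborel) \<le> (\<integral>\<^sup>+x. ennreal (K * I powr (\<kappa> * r)) * w x \<partial>lborel)"
        using pw by (intro nn_integral_mono_AE) (auto elim!: eventually_mono)
      also have "\<dots> = ennreal (K * I powr (\<kappa> * r)) * (\<integral>\<^sup>+x. w x \<partial>lborel)"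
        by (rule nn_integral_cmult) measurable
      also have "\<dots> \<le> ennreal (K * I powr (\<kappa> * r)) * ennreal (M * (z * I))"
        by (intro mult_left_mono wint) auto
      also have "\<dots> = ennreal (K * (M * z) * (I powr (\<kappa> * r) * I powr 1))"
        using K M z I by (simp add: mult_ac flip: ennreal_mult)
      also have "I powr (\<kappa> * r) * I powr 1 = I powr (r / s)"
      proof -
        have "\<kappa> * r + 1 = r / s" using s by (simp add: \<kappa>_def left_diff_distrib)
        then show ?thesis by (metis powr_add)
      qed
      finally show ?thesis .
    qed
  qed
qed

section \<open>Weak gradients on open sets\<close>

lemma AE_lebesgue_on:
  assumes "\<Omega> \<in> sets borel"
  shows "(AE x in lebesgue_on \<Omega>. P x) \<longleftrightarrow> (AE x in lborel. x \<in> \<Omega> \<longrightarrow> P x)"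
  using assms by (simp add: AE_restrict_space_iff AE_completion_iff)

lemma nn_integral_lebesgue_on:
  assumes "\<Omega> \<in> sets borel"
  shows "(\<integral>\<^sup>+x. f x \<partial>lebesgue_on \<Omega>) = (\<integral>\<^sup>+x. f x * indicator \<Omega> x \<partial>lborel)"
  using assms by (simp add: nn_integral_restrict_space nn_integral_completion)

lemma measurable_lebesgue_on:
  "f \<in> borel_measurable borel \<Longrightarrow> f \<in> borel_measurable (lebesgue_on \<Omega>)"
  by (intro measurable_restrict_space1 measurable_completion) simp

lemma indicator_measurable_lebesgue:
  fixes f :: "'a::euclidean_space \<Rightarrow> 'b::real_normed_vector"
  assumes "\<Omega> \<in> sets borel"
  shows "f \<in> borel_measurable (lebesgue_on \<Omega>) \<longleftrightarrow> (\<lambda>x. indicator \<Omega> x *\<^sub>R f x) \<in> borel_measurable lebesgue"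
  using assms by (intro borel_measurable_restrict_space_iff) auto

text \<open>The bridge between two settings: the given definitions integrate over
  \<open>lebesgue_on\<close>, whereas translations and Fubini's theorem are applied to Borel
  functions and \<open>lborel\<close>.\<close>

lemma integral_lebesgue_on:
  fixes f f0 :: "'a::euclidean_space \<Rightarrow> 'b::euclidean_space"
  assumes "\<Omega> \<in> sets borel" "f \<in> borel_measurable (lebesgue_on \<Omega>)" "f0 \<in> borel_measurable borel"
    and eq: "AE x in lborel. x \<in> \<Omega> \<longrightarrow> f x = f0 x"
  shows "(\<integral>x. f x \<partial>lebesgue_on \<Omega>) = (\<integral>x. indicator \<Omega> x *\<^sub>R f0 x \<partial>lborel)"
    and "integrable (lebesgue_on \<Omega>) f \<longleftrightarrow> integrable lborel (\<lambda>x. indicator \<Omega> x *\<^sub>R f0 x)"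
proof -
  have [measurable]: "\<Omega> \<in> sets borel" "f0 \<in> borel_measurable borel" by fact+
  have m: "(\<lambda>x. indicator \<Omega> x *\<^sub>R f x) \<in> borel_measurable lebesgue"
    using assms indicator_measurable_lebesgue by blast
  have m0: "(\<lambda>x. indicator \<Omega> x *\<^sub>R f0 x) \<in> borel_measurable lborel" by measurable
  have m0': "(\<lambda>x. indicator \<Omega> x *\<^sub>R f0 x) \<in> borel_measurable lebesgue" by (rule measurable_completion[OF m0])
  have ae: "AE x in lebesgue. indicator \<Omega> x *\<^sub>R f x = indicator \<Omega> x *\<^sub>R f0 x"
    unfolding AE_completion_iff using eq by eventually_elim (auto simp: indicator_def)
  have "(\<integral>x. f x \<partial>lebesgue_on \<Omega>) = (\<integral>x. indicator \<Omega> x *\<^sub>R f x \<partial>lebesgue)"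
    using assms by (intro integral_restrict_space) auto
  also have "\<dots> = (\<integral>x. indicator \<Omega> x *\<^sub>R f0 x \<partial>lebesgue)"
    by (rule integral_cong_AE[OF m m0' ae])
  finally show "(\<integral>x. f x \<partial>lebesgue_on \<Omega>) = (\<integral>x. indicator \<Omega> x *\<^sub>R f0 x \<partial>lborel)"
    by (simp add: integral_completion[OF m0])
  have "integrable (lebesgue_on \<Omega>) f \<longleftrightarrow> integrable lebesgue (\<lambda>x. indicator \<Omega> x *\<^sub>R f x)"
    using assms by (intro integrable_restrict_space) auto
  also have "\<dots> \<longleftrightarrow> integrable lebesgue (\<lambda>x. indicator \<Omega> x *\<^sub>R f0 x)"
    by (rule integrable_cong_AE[OF m m0' ae])
  finally show "integrable (lebesgue_on \<Omega>) f \<longleftrightarrow> integrable lborel (\<lambda>x. indicator \<Omega> x *\<^sub>R f0 x)"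
    by (simp add: integrable_completion[OF m0])
qed

text \<open>The completion theorem for real functions is applied to each coordinate, and the
  finitely many null sets are united.\<close>

lemma borel_representative:
  fixes f :: "'a::euclidean_space \<Rightarrow> 'b::euclidean_space"
  assumes "\<Omega> \<in> sets borel" "f \<in> borel_measurable (lebesgue_on \<Omega>)"
  obtains f0 where "f0 \<in> borel_measurable borel" "AE x in lborel. x \<in> \<Omega> \<longrightarrow> f x = f0 x"
proof -
  have m: "(\<lambda>x. indicator \<Omega> x *\<^sub>R f x) \<in> borel_measurable lebesgue"
    using assms indicator_measurable_lebesgue by blast
  have "\<exists>g\<in>borel_measurable lborel. AE x in lborel. (indicator \<Omega> x *\<^sub>R f x) \<bullet> b = g x" for b
    by (rule completion_ex_borel_measurable_real) (use m in measurable)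
  then obtain g where g: "\<And>b. g b \<in> borel_measurable lborel" "\<And>b. AE x in lborel. (indicator \<Omega> x *\<^sub>R f x) \<bullet> b = g b x"
    by metis
  have "AE x in lborel. \<forall>b\<in>Basis. (indicator \<Omega> x *\<^sub>R f x) \<bullet> b = g b x"
    using g(2) by (intro AE_finite_allI) auto
  then have "AE x in lborel. x \<in> \<Omega> \<longrightarrow> f x = (\<Sum>b\<in>Basis. g b x *\<^sub>R b)"
  proof eventually_elim
    case (elim x)
    show ?case
    proof
      assume "x \<in> \<Omega>"
      then have "f x = (\<Sum>b\<in>Basis. (indicator \<Omega> x *\<^sub>R f x \<bullet> b) *\<^sub>R b)" by (simp add: euclidean_representation)
      also have "\<dots> = (\<Sum>b\<in>Basis. g b x *\<^sub>R b)" using elim by (intro sum.cong) auto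
      finally show "f x = (\<Sum>b\<in>Basis. g b x *\<^sub>R b)" .
    qed
  qed
  moreover have "(\<lambda>x. \<Sum>b\<in>Basis. g b x *\<^sub>R b) \<in> borel_measurable borel"
    using g(1) by (intro borel_measurable_sum borel_measurable_scaleR) auto
  ultimately show ?thesis using that by blast
qed

section \<open>Uniqueness of weak gradients\<close>

lemma W11_unique:
  assumes "W11 u G" "W11 u F"
  shows "AE x in lborel. G x = F x"
proof -
  have "AE x in lborel. (G x - F x) \<bullet> b = 0" for b
  proof (rule fundamental_lemma)
    have i: "integrable lborel (\<lambda>x. G x \<bullet> b)" "integrable lborel (\<lambda>x. F x \<bullet> b)"
      using assms[THEN W11D(2)] by auto
    then show "integrable lborel (\<lambda>x. (G x - F x) \<bullet> b)" by (simp add: inner_diff_left)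
    fix \<psi> :: "'a \<Rightarrow> real" assume \<psi>: "\<psi> \<in> test_functions UNIV"
    have "(\<integral>x. (G x - F x) \<bullet> b * \<psi> x \<partial>lborel) = (\<integral>x. \<psi> x * (G x \<bullet> b) \<partial>lborel) - (\<integral>x. \<psi> x * (F x \<bullet> b) \<partial>lborel)"
      using integrable_test_mult[OF i(1) \<psi>] integrable_test_mult[OF i(2) \<psi>]
      by (simp add: inner_diff_left right_diff_distrib mult.commute)
    also have "\<dots> = 0" using W11D(5)[OF assms(1) \<psi>, of b] W11D(5)[OF assms(2) \<psi>, of b] by simp
    finally show "(\<integral>x. (G x - F x) \<bullet> b * \<psi> x \<partial>lborel) = 0" .
  qed
  then have "AE x in lborel. \<forall>b\<in>Basis. (G x - F x) \<bullet> b = 0"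
    by (intro AE_finite_allI) auto
  then show ?thesis
    by eventually_elim (rule euclidean_eqI, simp add: inner_diff_left)
qed

text \<open>By Lindelof's theorem countably many of the balls cover the set, so the exceptional sets
  add up to a null set.\<close>

lemma AE_open_local:
  fixes \<Omega> :: "'a::euclidean_space set"
  assumes "\<And>x. x \<in> \<Omega> \<Longrightarrow> \<exists>r>0. AE y in lborel. y \<in> ball x r \<longrightarrow> P y"
  shows "AE y in lborel. y \<in> \<Omega> \<longrightarrow> P y"
proof -
  obtain r where r: "\<And>x. x \<in> \<Omega> \<Longrightarrow> r x > 0 \<and> (AE y in lborel. y \<in> ball x (r x) \<longrightarrow> P y)"
    using assms by metis
  obtain F where F: "F \<subseteq> (\<lambda>x. ball x (r x)) ` \<Omega>" "countable F" "\<Union>F = \<Union>((\<lambda>x. ball x (r x)) ` \<Omega>)"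
    by (rule Lindelof[of "(\<lambda>x. ball x (r x)) ` \<Omega>"]) auto
  have "AE y in lborel. \<forall>B\<in>F. y \<in> B \<longrightarrow> P y"
    using F(1) r by (subst AE_ball_countable[OF F(2)]) auto
  moreover have "\<Omega> \<subseteq> \<Union>F" unfolding F(3) using r by auto
  ultimately show ?thesis
    by (auto elim!: eventually_mono)
qed

text \<open>After multiplication by a cutoff, global uniqueness applies. Both product gradients
  contain the same term with \<open>u\<close>, so it cancels, and where the cutoff is 1 the
  gradients themselves remain.\<close>

lemma W11loc_unique:
  fixes \<Omega> :: "'a::euclidean_space set"
  assumes "open \<Omega>" "W11loc \<Omega> u G" "W11loc \<Omega> u F"
  shows "AE x in lborel. x \<in> \<Omega> \<longrightarrow> G x = F x"
proof (rule AE_open_local)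
  fix x assume "x \<in> \<Omega>"
  then obtain R where R: "R > 0" "cball x R \<subseteq> \<Omega>" using assms(1) open_contains_cball by blast
  have \<eta>: "cutoff x (R / 2) R \<in> test_functions \<Omega>" using R by (intro cutoff_test) auto
  have "AE y in lborel. y \<in> ball x (R / 2) \<longrightarrow> G y = F y"
    using W11_unique[OF W11loc_test_mult[OF assms(2) \<eta>] W11loc_test_mult[OF assms(3) \<eta>]]
  proof eventually_elim
    case (elim y)
    show ?case
    proof
      assume "y \<in> ball x (R / 2)"
      then have "cutoff x (R / 2) R y = 1" using R by (intro cutoff_eq_1) auto
      then show "G y = F y" using elim by simp
    qed
  qed
  then show "\<exists>r>0. AE y in lborel. y \<in> ball x r \<longrightarrow> G y = F y" using R by (intro exI[of _ "R / 2"]) auto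
qed

lemma weak_gradient_W11loc:
  assumes "open \<Omega>" and W: "has_weak_gradient \<Omega> u G"
    and m: "u0 \<in> borel_measurable borel" "G0 \<in> borel_measurable borel"
    and eq: "AE x in lborel. x \<in> \<Omega> \<longrightarrow> u x = u0 x" "AE x in lborel. x \<in> \<Omega> \<longrightarrow> G x = G0 x"
  shows "W11loc \<Omega> u0 G0"
  unfolding W11loc_def
proof (intro conjI allI impI ballI m)
  have \<Omega>: "\<Omega> \<in> sets borel" using assms(1) by auto
  have L: "locally_integrable \<Omega> u" "locally_integrable \<Omega> G"
    using W unfolding has_weak_gradient_def by auto
  {
    fix K assume K: "compact K \<and> K \<subseteq> \<Omega>"
    then have Kb: "K \<in> sets borel" by (auto simp: compact_imp_closed borel_closed)
    have i: "integrable (lebesgue_on K) u" "integrable (lebesgue_on K) G"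
      using L K unfolding locally_integrable_def by auto
    have "AE x in lborel. x \<in> K \<longrightarrow> u x = u0 x" using eq(1) by eventually_elim (use K in blast)
    from integral_lebesgue_on(2)[OF Kb borel_measurable_integrable[OF i(1)] m(1) this] i(1)
    show "integrable lborel (\<lambda>x. indicator K x *\<^sub>R u0 x)" by (rule iffD1)
    have "AE x in lborel. x \<in> K \<longrightarrow> G x = G0 x" using eq(2) by eventually_elim (use K in blast)
    from integral_lebesgue_on(2)[OF Kb borel_measurable_integrable[OF i(2)] m(2) this] i(2)
    show "integrable lborel (\<lambda>x. indicator K x *\<^sub>R G0 x)" by (rule iffD1)
  }
  fix \<phi> b assume \<phi>: "\<phi> \<in> test_functions \<Omega>" and b: "(b::'a) \<in> Basis"
  obtain K where K: "smooth \<phi>" "compact K" "K \<subseteq> \<Omega>" "\<And>x. x \<notin> K \<Longrightarrow> \<phi> x = 0"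
    using \<phi> unfolding test_functions_iff by blast
  have z: "\<phi> x = 0" "grad \<phi> x = 0" if "x \<notin> \<Omega>" for x
    using K(4)[of x] grad_zero_outside[where f = \<phi> and K = K and x = x, OF compact_imp_closed[OF K(2)] K(4)] K(3) that
    by auto
  have [measurable]: "u0 \<in> borel_measurable borel" "G0 \<in> borel_measurable borel"
    "\<phi> \<in> borel_measurable borel" "grad \<phi> \<in> borel_measurable borel"
    using m smooth_measurable[OF K(1)] smooth_grad_measurable[OF K(1)] by auto
  have [measurable]: "u \<in> borel_measurable (lebesgue_on \<Omega>)" "G \<in> borel_measurable (lebesgue_on \<Omega>)"
    using L unfolding locally_integrable_def by auto
  have [measurable]: "\<phi> \<in> borel_measurable (lebesgue_on \<Omega>)" "grad \<phi> \<in> borel_measurable (lebesgue_on \<Omega>)"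
    by (intro measurable_lebesgue_on; measurable)+
  have 1: "(\<integral>x. u x * (grad \<phi> x \<bullet> b) \<partial>lebesgue_on \<Omega>) = (\<integral>x. indicator \<Omega> x *\<^sub>R (u0 x * (grad \<phi> x \<bullet> b)) \<partial>lborel)"
    by (rule integral_lebesgue_on(1)[OF \<Omega>]) (use eq(1) in \<open>auto elim!: eventually_mono\<close>)
  have 2: "(\<integral>x. \<phi> x * (G x \<bullet> b) \<partial>lebesgue_on \<Omega>) = (\<integral>x. indicator \<Omega> x *\<^sub>R (\<phi> x * (G0 x \<bullet> b)) \<partial>lborel)"
    by (rule integral_lebesgue_on(1)[OF \<Omega>]) (use eq(2) in \<open>auto elim!: eventually_mono\<close>)
  have 3: "indicator \<Omega> x *\<^sub>R (u0 x * (grad \<phi> x \<bullet> b)) = u0 x * (grad \<phi> x \<bullet> b)"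
    "indicator \<Omega> x *\<^sub>R (\<phi> x * (G0 x \<bullet> b)) = \<phi> x * (G0 x \<bullet> b)" for x
    using z[of x] by (auto simp: indicator_def)
  have "(\<integral>x. u x * frechet_derivative \<phi> (at x) b \<partial>lebesgue_on \<Omega>) = - (\<integral>x. \<phi> x * (G x \<bullet> b) \<partial>lebesgue_on \<Omega>)"
    using W \<phi> b unfolding has_weak_gradient_def by blast
  then show "(\<integral>x. u0 x * (grad \<phi> x \<bullet> b) \<partial>lborel) = - (\<integral>x. \<phi> x * (G0 x \<bullet> b) \<partial>lborel)"
    using 1 2 by (simp only: smooth_frechet[OF K(1)] 3)
qed

text \<open>This is what makes the chosen \<open>weak_grad\<close> computable: it agrees almost
  everywhere with any explicitly constructed weak gradient.\<close>

lemma weak_grad_eq: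
  fixes \<Omega> :: "'a::euclidean_space set"
  assumes "open \<Omega>" "has_weak_gradient \<Omega> u G"
  shows "AE x in lborel. x \<in> \<Omega> \<longrightarrow> weak_grad \<Omega> u x = G x"
proof -
  have \<Omega>: "\<Omega> \<in> sets borel" using assms(1) by auto
  have W: "has_weak_gradient \<Omega> u (weak_grad \<Omega> u)"
    unfolding weak_grad_def using someI[of "has_weak_gradient \<Omega> u", OF assms(2)] .
  have m: "u \<in> borel_measurable (lebesgue_on \<Omega>)" "G \<in> borel_measurable (lebesgue_on \<Omega>)"
    "weak_grad \<Omega> u \<in> borel_measurable (lebesgue_on \<Omega>)"
    using W assms(2) unfolding has_weak_gradient_def locally_integrable_def by auto
  obtain u0 where u0: "u0 \<in> borel_measurable borel" "AE x in lborel. x \<in> \<Omega> \<longrightarrow> u x = u0 x"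
    using borel_representative[OF \<Omega> m(1)] .
  obtain G0 where G0: "G0 \<in> borel_measurable borel" "AE x in lborel. x \<in> \<Omega> \<longrightarrow> G x = G0 x"
    using borel_representative[OF \<Omega> m(2)] .
  obtain F0 where F0: "F0 \<in> borel_measurable borel" "AE x in lborel. x \<in> \<Omega> \<longrightarrow> weak_grad \<Omega> u x = F0 x"
    using borel_representative[OF \<Omega> m(3)] .
  have "AE x in lborel. x \<in> \<Omega> \<longrightarrow> F0 x = G0 x"
    by (rule W11loc_unique[OF assms(1) weak_gradient_W11loc[OF assms(1) W u0(1) F0(1) u0(2) F0(2)]
        weak_gradient_W11loc[OF assms u0(1) G0(1) u0(2) G0(2)]])
  then show ?thesis using G0(2) F0(2) by eventually_elim simp
qed

lemma W11_has_weak_gradient: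
  fixes \<Omega> :: "'a::euclidean_space set"
  assumes "open \<Omega>" "W11 v F"
  shows "has_weak_gradient \<Omega> v F"
proof -
  have \<Omega>: "\<Omega> \<in> sets borel" using assms(1) by auto
  note V = W11D[OF assms(2)]
  note [measurable] = V(3,4)
  have loc: "locally_integrable \<Omega> f" if f: "integrable lborel f" for f :: "'a \<Rightarrow> 'b::euclidean_space"
    unfolding locally_integrable_def
  proof (intro conjI allI impI)
    have fm: "f \<in> borel_measurable borel" using f by auto
    then show "f \<in> borel_measurable (lebesgue_on \<Omega>)" by (rule measurable_lebesgue_on)
    fix K assume "compact K \<and> K \<subseteq> \<Omega>"
    then have K: "K \<in> sets borel" by (auto simp: compact_imp_closed borel_closed)
    show "integrable (lebesgue_on K) f"
      by (rule integral_lebesgue_on(2)[OF K measurable_lebesgue_on[OF fm] fm, THEN iffD2])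
        (use K f in \<open>auto intro: integrable_mult_indicator\<close>)
  qed
  show ?thesis
    unfolding has_weak_gradient_def
  proof (intro conjI ballI loc V(1,2))
    fix \<phi> b assume \<phi>: "\<phi> \<in> test_functions \<Omega>" and b: "(b::'a) \<in> Basis"
    obtain K where K: "smooth \<phi>" "compact K" "K \<subseteq> \<Omega>" "\<And>x. x \<notin> K \<Longrightarrow> \<phi> x = 0"
      using \<phi> unfolding test_functions_iff by blast
    have z: "\<phi> x = 0" "grad \<phi> x = 0" if "x \<notin> \<Omega>" for x
      using K(4)[of x] grad_zero_outside[where f = \<phi> and K = K and x = x, OF compact_imp_closed[OF K(2)] K(4)] K(3) that
      by auto
    have [measurable]: "\<phi> \<in> borel_measurable borel" "grad \<phi> \<in> borel_measurable borel"
      using smooth_measurable[OF K(1)] smooth_grad_measurable[OF K(1)] by auto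
    have 1: "(\<integral>x. v x * (grad \<phi> x \<bullet> b) \<partial>lebesgue_on \<Omega>) = (\<integral>x. indicator \<Omega> x *\<^sub>R (v x * (grad \<phi> x \<bullet> b)) \<partial>lborel)"
      by (rule integral_lebesgue_on(1)[OF \<Omega> measurable_lebesgue_on]) auto
    have 2: "(\<integral>x. \<phi> x * (F x \<bullet> b) \<partial>lebesgue_on \<Omega>) = (\<integral>x. indicator \<Omega> x *\<^sub>R (\<phi> x * (F x \<bullet> b)) \<partial>lborel)"
      by (rule integral_lebesgue_on(1)[OF \<Omega> measurable_lebesgue_on]) auto
    have 3: "indicator \<Omega> x *\<^sub>R (v x * (grad \<phi> x \<bullet> b)) = v x * (grad \<phi> x \<bullet> b)"
      "indicator \<Omega> x *\<^sub>R (\<phi> x * (F x \<bullet> b)) = \<phi> x * (F x \<bullet> b)" for x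
      using z[of x] by (auto simp: indicator_def)
    show "(\<integral>x. v x * frechet_derivative \<phi> (at x) b \<partial>lebesgue_on \<Omega>) = - (\<integral>x. \<phi> x * (F x \<bullet> b) \<partial>lebesgue_on \<Omega>)"
      using V(5)[OF test_mono[OF \<phi>], of b] by (simp only: smooth_frechet[OF K(1)] 1 2 3 subset_UNIV)
  qed
qed

section \<open>Admissible test functions\<close>

lemma luxemburg_norm_zero:
  assumes "AE x in lebesgue_on \<Omega>. f x = 0"
  shows "luxemburg_norm \<Omega> p f = 0"
proof -
  have "(\<integral>\<^sup>+x. ennreal ((norm (f x) / l) powr p x) \<partial>lebesgue_on \<Omega>) = (\<integral>\<^sup>+x. 0 \<partial>lebesgue_on \<Omega>)" for l
    using assms by (intro nn_integral_cong_AE) (auto elim!: eventually_mono)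
  then have "{l. 0 < l \<and> (\<integral>\<^sup>+x. ennreal ((norm (f x) / l) powr p x) \<partial>lebesgue_on \<Omega>) \<le> 1} = {0<..}"
    by auto
  then show ?thesis unfolding luxemburg_norm_def by simp
qed

text \<open>A function with compact support in \<Omega> approximates itself, so membership in the
  closure is immediate. Boundedness of \<open>v\<close> together with the finite measure of \<Omega>
  gives its own modular, and only the gradient requires a hypothesis.\<close>

lemma admissibleI:
  fixes \<Omega> :: "'a::euclidean_space set"
  assumes \<Omega>: "open \<Omega>" "bounded \<Omega>" and p: "continuous_on \<Omega> p" "\<And>x. x \<in> \<Omega> \<Longrightarrow> 0 \<le> p x \<and> p x \<le> p2"
    and W: "W11 v F" and K: "compact K" "K \<subseteq> \<Omega>" "\<And>x. x \<notin> K \<Longrightarrow> v x = 0"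
    and v: "\<And>x. 0 \<le> v x" "\<And>x. v x \<le> M"
    and F: "integrable (lebesgue_on \<Omega>) (\<lambda>x. norm (F x) powr p x)"
  shows "v \<in> admissible \<Omega> p"
proof -
  have \<Omega>b: "\<Omega> \<in> sets borel" using \<Omega> by auto
  note V = W11D[OF W]
  have vm [measurable]: "v \<in> borel_measurable (lebesgue_on \<Omega>)" by (rule measurable_lebesgue_on[OF V(3)])
  have Fm [measurable]: "F \<in> borel_measurable (lebesgue_on \<Omega>)" by (rule measurable_lebesgue_on[OF V(4)])
  have pm [measurable]: "p \<in> borel_measurable (lebesgue_on \<Omega>)"
    by (rule continuous_imp_measurable_on_sets_lebesgue[OF p(1)]) (use \<Omega>b in auto)
  have hw: "has_weak_gradient \<Omega> v F" by (rule W11_has_weak_gradient[OF \<Omega>(1) W])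
  have eq: "AE x in lebesgue_on \<Omega>. weak_grad \<Omega> v x = F x"
    using weak_grad_eq[OF \<Omega>(1) hw] by (simp add: AE_lebesgue_on \<Omega>b)
  have wm: "weak_grad \<Omega> v \<in> borel_measurable (lebesgue_on \<Omega>)"
    using someI[of "has_weak_gradient \<Omega> v", OF hw]
    unfolding weak_grad_def has_weak_gradient_def locally_integrable_def by blast
  have fin: "finite_measure (lebesgue_on \<Omega>)"
    using \<Omega> by (intro finite_measure_lebesgue_on) (simp add: bounded_set_imp_lmeasurable \<Omega>b)
  have "v \<in> Lp_var \<Omega> p"
    unfolding Lp_var_def
  proof (intro CollectI conjI vm)
    show "integrable (lebesgue_on \<Omega>) (\<lambda>x. norm (v x) powr p x)"
    proof (rule finite_measure.integrable_const_bound[OF fin, where B = "(1 + M) powr p2"])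
      show "AE x in lebesgue_on \<Omega>. norm (norm (v x) powr p x) \<le> (1 + M) powr p2"
      proof (rule AE_I2)
        fix x assume "x \<in> space (lebesgue_on \<Omega>)"
        then have x: "x \<in> \<Omega>" by simp
        have "v x powr p x \<le> (1 + M) powr p x"
          using v[of x] p(2)[OF x] by (intro powr_mono2) auto
        \<comment> \<open>The base is 1 + M and not M: a base of at least 1 allows the variable
          exponent to be raised to \<open>p2\<close>.\<close>
        also have "\<dots> \<le> (1 + M) powr p2"
          using v[of x] p(2)[OF x] by (intro powr_mono) auto
        finally show "norm (norm (v x) powr p x) \<le> (1 + M) powr p2" using v by simp
      qed
    qed measurable
  qed
  moreover have "weak_grad \<Omega> v \<in> Lp_var \<Omega> p"
    unfolding Lp_var_def
  proof (intro CollectI conjI wm)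
    note [measurable] = wm
    show "integrable (lebesgue_on \<Omega>) (\<lambda>x. norm (weak_grad \<Omega> v x) powr p x)"
      by (rule integrable_cong_AE[THEN iffD1, OF _ _ _ F]) (use eq in \<open>measurable, auto elim!: eventually_mono\<close>)
  qed
  ultimately have W1: "v \<in> W1p \<Omega> p" unfolding W1p_def using hw by blast
  have Wc: "v \<in> W1p_compact \<Omega> p"
    unfolding W1p_compact_def using W1 K by (auto intro!: exI[of _ K])
  \<comment> \<open>The distance of \<open>v\<close> to itself involves \<open>weak_grad\<close> of
    the zero function, which is some chosen function and is known to vanish only almost
    everywhere.\<close>
  have "has_weak_gradient \<Omega> (\<lambda>x. 0) (\<lambda>x. 0::'a)"
    by (rule W11_has_weak_gradient[OF \<Omega>(1)]) (auto intro!: W11I)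
  then have "AE x in lebesgue_on \<Omega>. weak_grad \<Omega> (\<lambda>x. 0) x = 0"
    using weak_grad_eq[OF \<Omega>(1)] by (simp add: AE_lebesgue_on \<Omega>b)
  then have "W1p_norm \<Omega> p (\<lambda>x. v x - v x) = 0"
    unfolding W1p_norm_def by (simp add: luxemburg_norm_zero)
  then have "v \<in> W01p \<Omega> p"
    unfolding W01p_def using W1 Wc by (auto intro!: bexI[of _ v])
  moreover have "v \<in> Linfty \<Omega>"
    unfolding Linfty_def using v vm by (auto intro!: exI[of _ M])
  ultimately show ?thesis unfolding admissible_def using v by auto
qed

text \<open>All further estimates are made for Borel representatives, for which Fubini's theorem applies.\<close>

definition subsolution ::
  "'a::euclidean_space set \<Rightarrow> ('a \<Rightarrow> real) \<Rightarrow> ('a \<Rightarrow> real) \<Rightarrow> ('a \<Rightarrow> 'a) \<Rightarrow> ('a \<Rightarrow> real) \<Rightarrow> bool" where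
  "subsolution \<Omega> p u G H \<longleftrightarrow> W11loc \<Omega> u G \<and> H \<in> borel_measurable borel \<and> (\<forall>x. 0 \<le> H x) \<and>
     (\<integral>\<^sup>+x. ennreal (indicator \<Omega> x * \<bar>u x\<bar> powr p x) \<partial>lborel) < \<infinity> \<and>
     (\<integral>\<^sup>+x. ennreal (indicator \<Omega> x * norm (G x) powr p x) \<partial>lborel) < \<infinity> \<and>
     (\<forall>v F K M. W11 v F \<and> compact K \<and> K \<subseteq> \<Omega> \<and> (\<forall>x. 0 \<le> v x \<and> v x \<le> M) \<and> (\<forall>x. x \<notin> K \<longrightarrow> v x = 0) \<and>
        (\<integral>\<^sup>+x. ennreal (indicator \<Omega> x * norm (F x) powr p x) \<partial>lborel) < \<infinity> \<longrightarrow>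
        ennreal (\<integral>x. indicator \<Omega> x * (norm (G x) powr (p x - 2) * (G x \<bullet> F x)) \<partial>lborel)
          \<le> (\<integral>\<^sup>+x. ennreal (indicator \<Omega> x * (H x * (\<bar>u x\<bar> + 1) powr (p x - 1) * v x)) \<partial>lborel))"

lemma nn_integral_lebesgue_on_AE:
  assumes "\<Omega> \<in> sets borel" "AE x in lborel. x \<in> \<Omega> \<longrightarrow> f x = g x"
  shows "(\<integral>\<^sup>+x. ennreal (f x) \<partial>lebesgue_on \<Omega>) = (\<integral>\<^sup>+x. ennreal (indicator \<Omega> x * g x) \<partial>lborel)"
  unfolding nn_integral_lebesgue_on[OF assms(1)]
  using assms(2) by (intro nn_integral_cong_AE) (auto elim!: eventually_mono simp: indicator_def)

text \<open>Changing \<open>u\<close>, \<open>G\<close> and \<open>H\<close> on null sets alters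
  none of the integrals. The weak inequality for \<open>v\<close> can be quoted because the
  truncations used later satisfy \<open>admissibleI\<close>, and their chosen weak gradients may be
  replaced by the explicit ones.\<close>

lemma subsolution_of_weak:
  fixes \<Omega> :: "'a::euclidean_space set"
  assumes \<Omega>: "open \<Omega>" "bounded \<Omega>" and p: "continuous_on \<Omega> p" "\<And>x. x \<in> \<Omega> \<Longrightarrow> 0 \<le> p x \<and> p x \<le> p2"
    and hw: "has_weak_gradient \<Omega> u G" and u: "u \<in> Lp_var \<Omega> p" and G: "G \<in> Lp_var \<Omega> p"
    and H: "H \<in> Lp_var \<Omega> q" "AE x in lebesgue_on \<Omega>. 0 \<le> H x"
    and ineq: "\<And>\<phi>. \<phi> \<in> admissible \<Omega> p \<Longrightarrow>
      ennreal (\<integral>x. norm (G x) powr (p x - 2) * (G x \<bullet> weak_grad \<Omega> \<phi> x) \<partial>lebesgue_on \<Omega>)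
        \<le> (\<integral>\<^sup>+x. ennreal (H x * (\<bar>u x\<bar> + 1) powr (p x - 1) * \<phi> x) \<partial>lebesgue_on \<Omega>)"
  obtains u0 G0 H0 where "subsolution \<Omega> (\<lambda>x. if x \<in> \<Omega> then p x else 2) u0 G0 H0"
    "AE x in lborel. x \<in> \<Omega> \<longrightarrow> u x = u0 x"
    "(\<integral>\<^sup>+x. ennreal (indicator \<Omega> x * \<bar>u0 x\<bar> powr p x) \<partial>lborel) = ennreal (modular \<Omega> p u)"
    "(\<integral>\<^sup>+x. ennreal (indicator \<Omega> x * H0 x powr q x) \<partial>lborel) = ennreal (modular \<Omega> q H)"
proof -
  have \<Omega>b [measurable]: "\<Omega> \<in> sets borel" using \<Omega> by auto
  \<comment> \<open>The value 2 outside \<Omega> extends the exponent to a Borel function on the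
    whole space. Every integral carries \<open>indicator \<Omega>\<close>, so the modulars are those
    for \<open>p\<close>.\<close>
  define p' where "p' x = (if x \<in> \<Omega> then p x else 2)" for x
  have p'm [measurable]: "p' \<in> borel_measurable borel"
    unfolding p'_def[abs_def] by (rule borel_measurable_continuous_on_if[OF \<Omega>b p(1)]) simp
  have pm [measurable]: "p \<in> borel_measurable (lebesgue_on \<Omega>)"
    by (rule continuous_imp_measurable_on_sets_lebesgue[OF p(1)]) simp
  have um [measurable]: "u \<in> borel_measurable (lebesgue_on \<Omega>)" and Gm [measurable]: "G \<in> borel_measurable (lebesgue_on \<Omega>)"
    and Hm [measurable]: "H \<in> borel_measurable (lebesgue_on \<Omega>)"
    using u G H(1) unfolding Lp_var_def by auto
  obtain u0 where u0: "u0 \<in> borel_measurable borel" "AE x in lborel. x \<in> \<Omega> \<longrightarrow> u x = u0 x"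
    using borel_representative[OF \<Omega>b um] .
  obtain G0 where G0: "G0 \<in> borel_measurable borel" "AE x in lborel. x \<in> \<Omega> \<longrightarrow> G x = G0 x"
    using borel_representative[OF \<Omega>b Gm] .
  obtain H1 where H1: "H1 \<in> borel_measurable borel" "AE x in lborel. x \<in> \<Omega> \<longrightarrow> H x = H1 x"
    using borel_representative[OF \<Omega>b Hm] .
  \<comment> \<open>The representative agrees with \<open>H\<close> only almost everywhere; the
    positive part makes it nonnegative at every point.\<close>
  define H0 where "H0 x = max 0 (H1 x)" for x
  have H0: "H0 \<in> borel_measurable borel" "AE x in lborel. x \<in> \<Omega> \<longrightarrow> H x = H0 x"
    using H1 H(2)[unfolded AE_lebesgue_on[OF \<Omega>b]] unfolding H0_def[abs_def] by (measurable, auto)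
  note [measurable] = u0(1) G0(1) H0(1)
  have p'eq: "indicator \<Omega> x * f (p' x) = indicator \<Omega> x * f (p x)" for x and f :: "real \<Rightarrow> real"
    by (simp add: indicator_def p'_def)
  have mod_u: "(\<integral>\<^sup>+x. ennreal (indicator \<Omega> x * \<bar>u0 x\<bar> powr p x) \<partial>lborel) = ennreal (modular \<Omega> p u)"
  proof -
    have "(\<integral>\<^sup>+x. ennreal (\<bar>u x\<bar> powr p x) \<partial>lebesgue_on \<Omega>) = ennreal (modular \<Omega> p u)"
      unfolding modular_def using u by (intro nn_integral_eq_integral) (auto simp: Lp_var_def)
    moreover have "(\<integral>\<^sup>+x. ennreal (\<bar>u x\<bar> powr p x) \<partial>lebesgue_on \<Omega>) = (\<integral>\<^sup>+x. ennreal (indicator \<Omega> x * \<bar>u0 x\<bar> powr p x) \<partial>lborel)"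
      by (rule nn_integral_lebesgue_on_AE[OF \<Omega>b]) (use u0(2) in \<open>auto elim!: eventually_mono\<close>)
    ultimately show ?thesis by simp
  qed
  have mod_H: "(\<integral>\<^sup>+x. ennreal (indicator \<Omega> x * H0 x powr q x) \<partial>lborel) = ennreal (modular \<Omega> q H)"
  proof -
    have "(\<integral>\<^sup>+x. ennreal (\<bar>H x\<bar> powr q x) \<partial>lebesgue_on \<Omega>) = ennreal (modular \<Omega> q H)"
      unfolding modular_def using H(1) by (intro nn_integral_eq_integral) (auto simp: Lp_var_def)
    moreover have "(\<integral>\<^sup>+x. ennreal (\<bar>H x\<bar> powr q x) \<partial>lebesgue_on \<Omega>) = (\<integral>\<^sup>+x. ennreal (indicator \<Omega> x * H0 x powr q x) \<partial>lborel)"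
      by (rule nn_integral_lebesgue_on_AE[OF \<Omega>b]) (use H0(2) in \<open>auto elim!: eventually_mono simp: H0_def\<close>)
    ultimately show ?thesis by simp
  qed
  have mod_G: "(\<integral>\<^sup>+x. ennreal (indicator \<Omega> x * norm (G0 x) powr p x) \<partial>lborel) < \<infinity>"
  proof -
    have "(\<integral>\<^sup>+x. ennreal (norm (G x) powr p x) \<partial>lebesgue_on \<Omega>) < \<infinity>"
      using G integrable_iff_bounded[of "lebesgue_on \<Omega>" "\<lambda>x. norm (G x) powr p x"] by (auto simp: Lp_var_def)
    moreover have "(\<integral>\<^sup>+x. ennreal (norm (G x) powr p x) \<partial>lebesgue_on \<Omega>) = (\<integral>\<^sup>+x. ennreal (indicator \<Omega> x * norm (G0 x) powr p x) \<partial>lborel)"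
      by (rule nn_integral_lebesgue_on_AE[OF \<Omega>b]) (use G0(2) in \<open>auto elim!: eventually_mono\<close>)
    ultimately show ?thesis by simp
  qed
  have "subsolution \<Omega> p' u0 G0 H0"
    unfolding subsolution_def
  proof (intro conjI allI impI)
    show "W11loc \<Omega> u0 G0" by (rule weak_gradient_W11loc[OF \<Omega>(1) hw u0(1) G0(1) u0(2) G0(2)])
    show "H0 \<in> borel_measurable borel" "0 \<le> H0 x" for x by (auto simp: H0_def)
    show "(\<integral>\<^sup>+x. ennreal (indicator \<Omega> x * \<bar>u0 x\<bar> powr p' x) \<partial>lborel) < \<infinity>"
      unfolding p'eq using mod_u by simp
    show "(\<integral>\<^sup>+x. ennreal (indicator \<Omega> x * norm (G0 x) powr p' x) \<partial>lborel) < \<infinity>"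
      unfolding p'eq by (rule mod_G)
    fix v F K M
    assume A: "W11 v F \<and> compact K \<and> K \<subseteq> \<Omega> \<and> (\<forall>x. 0 \<le> v x \<and> v x \<le> M) \<and> (\<forall>x. x \<notin> K \<longrightarrow> v x = 0) \<and>
        (\<integral>\<^sup>+x. ennreal (indicator \<Omega> x * norm (F x) powr p' x) \<partial>lborel) < \<infinity>"
    then have W: "W11 v F" by blast
    have [measurable]: "v \<in> borel_measurable borel" "F \<in> borel_measurable borel"
      using W11D[OF W] by auto
    have [measurable]: "F \<in> borel_measurable (lebesgue_on \<Omega>)" by (rule measurable_lebesgue_on) measurable
    have Fi: "integrable (lebesgue_on \<Omega>) (\<lambda>x. norm (F x) powr p x)"
    proof (rule integrableI_bounded)
      have "(\<integral>\<^sup>+x. ennreal (norm (F x) powr p x) \<partial>lebesgue_on \<Omega>) = (\<integral>\<^sup>+x. ennreal (indicator \<Omega> x * norm (F x) powr p' x) \<partial>lborel)"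
        unfolding p'eq by (rule nn_integral_lebesgue_on_AE[OF \<Omega>b]) auto
      then show "(\<integral>\<^sup>+x. ennreal (norm (norm (F x) powr p x)) \<partial>lebesgue_on \<Omega>) < \<infinity>" using A by simp
    qed measurable
    have adm: "v \<in> admissible \<Omega> p"
      by (rule admissibleI[OF \<Omega> p W _ _ _ _ _ Fi, of K M]) (use A in auto)
    have hv: "has_weak_gradient \<Omega> v F" by (rule W11_has_weak_gradient[OF \<Omega>(1) W])
    have wm [measurable]: "weak_grad \<Omega> v \<in> borel_measurable (lebesgue_on \<Omega>)"
      using someI[of "has_weak_gradient \<Omega> v", OF hv]
      unfolding weak_grad_def has_weak_gradient_def locally_integrable_def by blast
    have "(\<integral>x. norm (G x) powr (p x - 2) * (G x \<bullet> weak_grad \<Omega> v x) \<partial>lebesgue_on \<Omega>)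
        = (\<integral>x. indicator \<Omega> x *\<^sub>R (norm (G0 x) powr (p' x - 2) * (G0 x \<bullet> F x)) \<partial>lborel)"
    proof (rule integral_lebesgue_on(1)[OF \<Omega>b])
      show "AE x in lborel. x \<in> \<Omega> \<longrightarrow> norm (G x) powr (p x - 2) * (G x \<bullet> weak_grad \<Omega> v x) = norm (G0 x) powr (p' x - 2) * (G0 x \<bullet> F x)"
        using G0(2) weak_grad_eq[OF \<Omega>(1) hv] by eventually_elim (auto simp: p'_def)
    qed measurable
    moreover have "(\<integral>\<^sup>+x. ennreal (H x * (\<bar>u x\<bar> + 1) powr (p x - 1) * v x) \<partial>lebesgue_on \<Omega>)
        = (\<integral>\<^sup>+x. ennreal (indicator \<Omega> x * (H0 x * (\<bar>u0 x\<bar> + 1) powr (p' x - 1) * v x)) \<partial>lborel)"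
    proof (rule nn_integral_lebesgue_on_AE[OF \<Omega>b])
      show "AE x in lborel. x \<in> \<Omega> \<longrightarrow> H x * (\<bar>u x\<bar> + 1) powr (p x - 1) * v x = H0 x * (\<bar>u0 x\<bar> + 1) powr (p' x - 1) * v x"
        using u0(2) H0(2) by eventually_elim (auto simp: p'_def)
    qed
    ultimately show "ennreal (\<integral>x. indicator \<Omega> x * (norm (G0 x) powr (p' x - 2) * (G0 x \<bullet> F x)) \<partial>lborel)
        \<le> (\<integral>\<^sup>+x. ennreal (indicator \<Omega> x * (H0 x * (\<bar>u0 x\<bar> + 1) powr (p' x - 1) * v x)) \<partial>lborel)"
      using ineq[OF adm] by simp
  qed
  then show ?thesis
    using that[of u0 G0 H0] u0(2) mod_u mod_H unfolding p'_def[abs_def] by blast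
qed

section \<open>The Caccioppoli inequality\<close>

lemma powr_add_le:
  fixes x y :: real
  assumes "0 \<le> x" "0 \<le> y" "0 \<le> p" "p \<le> P"
  shows "(x + y) powr p \<le> 2 powr P * (x powr p + y powr p)"
proof -
  have "(x + y) powr p \<le> (2 * max x y) powr p"
    using assms by (intro powr_mono2) auto
  also have "\<dots> = 2 powr p * max x y powr p" using assms by (simp add: powr_mult)
  also have "\<dots> \<le> 2 powr P * (x powr p + y powr p)"
    using assms by (intro mult_mono powr_mono) (auto simp: max_def)
  finally show ?thesis .
qed

text \<open>Splitting at y = x/2 replaces Young's inequality with conjugate exponents. The
  coefficient 1/2 permits absorption, and 2^p stays bounded as the exponent varies.\<close>

lemma Young_half:
  fixes x y p :: real
  assumes "0 \<le> x" "0 \<le> y" "1 \<le> p"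
  shows "x powr (p - 1) * y \<le> x powr p / 2 + 2 powr p * y powr p"
proof (cases "y \<le> x / 2")
  case True
  have "x powr (p - 1) * y \<le> x powr (p - 1) * (x / 2)" using True by (intro mult_left_mono) auto
  also have "\<dots> = x powr p / 2" using assms by (cases "x = 0") (auto simp: powr_diff)
  finally show ?thesis by (simp add: add_increasing2)
next
  case False
  then have y: "0 < y" using assms by simp
  have "x powr (p - 1) * y \<le> (2 * y) powr (p - 1) * y"
    using False assms by (intro mult_right_mono powr_mono2) auto
  also have "\<dots> = 2 powr (p - 1) * y powr p" using y by (simp add: powr_mult powr_diff)
  also have "\<dots> \<le> 2 powr p * y powr p" by (intro mult_right_mono powr_mono) auto
  finally show ?thesis by (simp add: add_increasing)
qed

text \<open>Truncation is available only for globally integrable functions, so \<open>u\<close> is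
  first multiplied by a wider cutoff that equals 1 where the narrow one lives. The inner factor then
  disappears from the result. With \<open>m\<close> at least 2 the factor with exponent m - 1
  vanishes outside the ball too.\<close>

lemma W11_excess_cutoff:
  fixes \<Omega> :: "'a::euclidean_space set"
  assumes W: "W11loc \<Omega> u G" and R: "0 \<le> r" "r < R" "R < R'" "cball c R' \<subseteq> \<Omega>" and k: "0 \<le> k" and m: "2 \<le> m"
  shows "W11 (\<lambda>x. cutoff c r R x ^ m * max 0 (u x - k))
    (\<lambda>x. (cutoff c r R x ^ m * indicator {x. u x > k} x) *\<^sub>R G x
       + (real m * cutoff c r R x ^ (m - 1) * max 0 (u x - k)) *\<^sub>R grad (cutoff c r R) x)"
proof -
  let ?\<eta> = "cutoff c r R" and ?\<zeta> = "cutoff c R R'"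
  have \<zeta>: "?\<zeta> \<in> test_functions \<Omega>" using R by (intro cutoff_test) auto
  have \<eta>: "(\<lambda>x. ?\<eta> x ^ m) \<in> test_functions \<Omega>"
  proof (rule test_power)
    have "cball c R \<subseteq> cball c R'" using R by (intro subset_cball) simp
    then show "?\<eta> \<in> test_functions \<Omega>" using R by (intro cutoff_test) auto
  qed (use m in simp)
  have in_B: "?\<zeta> x = 1" "grad ?\<zeta> x = 0" if "x \<in> ball c R" for x
  proof -
    have 1: "?\<zeta> y = 1" if "y \<in> ball c R" for y using that R by (intro cutoff_eq_1) auto
    show "?\<zeta> x = 1" by (rule 1[OF that])
    show "grad ?\<zeta> x = 0"
    proof (rule grad_eqI)
      have "((\<lambda>x. 1) has_derivative (\<lambda>h. 0 \<bullet> h)) (at x)" by simp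
      then show "(?\<zeta> has_derivative (\<lambda>h. 0 \<bullet> h)) (at x)"
        by (rule has_derivative_transform_within_open[OF _ open_ball that]) (simp add: 1)
    qed
  qed
  have out: "?\<eta> x = 0" if "x \<notin> ball c R" for x using that R by (intro cutoff_eq_0) auto
  have gp: "grad (\<lambda>x. ?\<eta> x ^ m) x = (real m * ?\<eta> x ^ (m - 1)) *\<^sub>R grad ?\<eta> x" for x
    by (rule grad_power[OF cutoff_smooth])
  have "W11 (\<lambda>x. ?\<eta> x ^ m * max 0 (?\<zeta> x * u x - k))
    (\<lambda>x. ?\<eta> x ^ m *\<^sub>R (indicator {x. ?\<zeta> x * u x > k} x *\<^sub>R (?\<zeta> x *\<^sub>R G x + u x *\<^sub>R grad ?\<zeta> x))
       + max 0 (?\<zeta> x * u x - k) *\<^sub>R grad (\<lambda>x. ?\<eta> x ^ m) x)"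
    by (rule W11_test_mult[OF W11_excess[OF W11loc_test_mult[OF W \<zeta>] k] \<eta>])
  also have "(\<lambda>x. ?\<eta> x ^ m * max 0 (?\<zeta> x * u x - k)) = (\<lambda>x. ?\<eta> x ^ m * max 0 (u x - k))"
  proof (rule ext)
    fix x show "?\<eta> x ^ m * max 0 (?\<zeta> x * u x - k) = ?\<eta> x ^ m * max 0 (u x - k)"
      using in_B[of x] out[of x] m by (cases "x \<in> ball c R") auto
  qed
  also have "(\<lambda>x. ?\<eta> x ^ m *\<^sub>R (indicator {x. ?\<zeta> x * u x > k} x *\<^sub>R (?\<zeta> x *\<^sub>R G x + u x *\<^sub>R grad ?\<zeta> x))
       + max 0 (?\<zeta> x * u x - k) *\<^sub>R grad (\<lambda>x. ?\<eta> x ^ m) x)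
     = (\<lambda>x. (?\<eta> x ^ m * indicator {x. u x > k} x) *\<^sub>R G x
       + (real m * ?\<eta> x ^ (m - 1) * max 0 (u x - k)) *\<^sub>R grad ?\<eta> x)"
  proof (rule ext)
    fix x show "?\<eta> x ^ m *\<^sub>R (indicator {x. ?\<zeta> x * u x > k} x *\<^sub>R (?\<zeta> x *\<^sub>R G x + u x *\<^sub>R grad ?\<zeta> x))
       + max 0 (?\<zeta> x * u x - k) *\<^sub>R grad (\<lambda>x. ?\<eta> x ^ m) x
     = (?\<eta> x ^ m * indicator {x. u x > k} x) *\<^sub>R G x
       + (real m * ?\<eta> x ^ (m - 1) * max 0 (u x - k)) *\<^sub>R grad ?\<eta> x"
    proof (cases "x \<in> ball c R")
      case True
      then show ?thesis using in_B[of x] unfolding gp by (simp add: indicator_def mult.commute)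
    next
      case False
      have z: "(0::real) ^ m = 0" "(0::real) ^ (m - 1) = 0" using m by (auto intro!: zero_power)
      show ?thesis unfolding gp out[OF False] z by simp
    qed
  qed
  finally show ?thesis .
qed

lemma nn_ball_const: "(\<integral>\<^sup>+x. ennreal (indicator (ball c R) x * C) \<partial>lborel) < \<infinity>"
proof -
  have "(\<integral>\<^sup>+x. ennreal (indicator (ball c R) x * C) \<partial>lborel) = (\<integral>\<^sup>+x. ennreal C * indicator (ball c R) x \<partial>lborel)"
    by (intro nn_integral_cong) (auto simp: indicator_def)
  also have "\<dots> = ennreal C * emeasure lborel (ball c R)" by (rule nn_integral_cmult_indicator) simp
  also have "\<dots> < \<infinity>" using emeasure_lborel_ball_finite[of c R] by (simp add: ennreal_mult_less_top)
  finally show ?thesis .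
qed

text \<open>The test function is the cutoff to the power \<open>m\<close> times the excess over
  \<open>k\<close>. The gradient of the cutoff produces a cross term, half of which is absorbed by
  the energy on the left, provided that the energy is finite. The factor 2 in front of the result
  stems from this absorption.\<close>

lemma caccioppoli:
  fixes \<Omega> :: "'a::euclidean_space set"
  assumes sub: "subsolution \<Omega> p u G H" and pm [measurable]: "p \<in> borel_measurable borel"
    and \<Omega> [measurable]: "\<Omega> \<in> sets borel"
    and R: "0 \<le> r" "r < R" "R < R'" "cball c R' \<subseteq> \<Omega>" and k: "0 \<le> k"
    and p: "\<And>x. x \<in> ball c R \<Longrightarrow> 1 \<le> p x \<and> p x \<le> P" and m: "2 \<le> m" "P \<le> real m"
    and L: "\<And>x. norm (grad (cutoff c r R) x) \<le> L"
  shows "(\<integral>\<^sup>+x. ennreal (indicator (ball c R) x * (indicator {x. u x > k} x * (cutoff c r R x ^ m * norm (G x) powr p x))) \<partial>lborel)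
    \<le> 2 * ((\<integral>\<^sup>+x. ennreal (indicator (ball c R) x * (indicator {x. u x > k} x * (2 powr P * (real m * L * max 0 (u x - k)) powr p x))) \<partial>lborel)
        + (\<integral>\<^sup>+x. ennreal (indicator (ball c R) x * (H x * (\<bar>u x\<bar> + 1) powr (p x - 1) * (cutoff c r R x ^ m * max 0 (u x - k)))) \<partial>lborel))"
proof -
  define \<eta> where "\<eta> = cutoff c r R"
  define B where "B = ball c R"
  define w where "w x = max 0 (u x - k)" for x
  define g where "g x = norm (G x)" for x
  have W: "W11loc \<Omega> u G" and Hm [measurable]: "H \<in> borel_measurable borel" and H0: "\<And>x. 0 \<le> H x"
    and uint: "(\<integral>\<^sup>+x. ennreal (indicator \<Omega> x * \<bar>u x\<bar> powr p x) \<partial>lborel) < \<infinity>"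
    and gint: "(\<integral>\<^sup>+x. ennreal (indicator \<Omega> x * g x powr p x) \<partial>lborel) < \<infinity>"
    using sub unfolding subsolution_def g_def by auto
  have [measurable]: "u \<in> borel_measurable borel" "G \<in> borel_measurable borel"
    using W unfolding W11loc_def by auto
  have \<eta>s: "smooth \<eta>" unfolding \<eta>_def by (rule cutoff_smooth)
  have [measurable]: "\<eta> \<in> borel_measurable borel" "grad \<eta> \<in> borel_measurable borel"
    using smooth_measurable[OF \<eta>s] smooth_grad_measurable[OF \<eta>s] .
  have [measurable]: "B \<in> sets borel" "w \<in> borel_measurable borel" "g \<in> borel_measurable borel"
    unfolding B_def w_def[abs_def] g_def[abs_def] by measurable
  have \<eta>b: "0 \<le> \<eta> x" "\<eta> x \<le> 1" for x unfolding \<eta>_def by (rule cutoff_bounds)+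
  have \<eta>0: "\<eta> x = 0" if "x \<notin> B" for x using that R unfolding \<eta>_def B_def by (intro cutoff_eq_0) auto
  have L': "norm (grad \<eta> x) \<le> L" for x unfolding \<eta>_def by (rule L)
  have L0: "0 \<le> L" using L'[of c] norm_ge_zero order_trans by blast
  have B\<Omega>: "B \<subseteq> \<Omega>" using R ball_subset_cball[of c R] subset_cball[of R R' c] unfolding B_def by auto
  have pB: "1 \<le> p x" "p x \<le> P" if "x \<in> B" for x using p[of x] that unfolding B_def by auto
  have m0: "m \<noteq> 0" "m - 1 \<noteq> 0" using m by auto
  have z: "(0::real) ^ m = 0" "(0::real) ^ (m - 1) = 0" using m by (auto intro!: zero_power)
  define A where "A x = indicator B x * (indicator {x. u x > k} x * (\<eta> x ^ m * g x powr p x))" for x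
  define E where "E x = indicator B x * (indicator {x. u x > k} x * (2 powr P * (real m * L * w x) powr p x))" for x
  define D where "D x = indicator B x * (H x * (\<bar>u x\<bar> + 1) powr (p x - 1) * (\<eta> x ^ m * w x))" for x
  define b where "b x = indicator B x * (indicator {x. u x > k} x * (real m * \<eta> x ^ (m - 1) * L * w x * g x powr (p x - 1)))" for x
  have [measurable]: "A \<in> borel_measurable borel" "E \<in> borel_measurable borel" "D \<in> borel_measurable borel" "b \<in> borel_measurable borel"
    unfolding A_def[abs_def] E_def[abs_def] D_def[abs_def] b_def[abs_def] by measurable
  have nn: "0 \<le> A x" "0 \<le> E x" "0 \<le> D x" "0 \<le> b x" "0 \<le> w x" for x
    unfolding A_def E_def D_def b_def using \<eta>b H0 L0 by (auto simp: w_def)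
  have bA: "b x \<le> A x / 2 + E x" for x
  proof (cases "x \<in> B \<and> u x > k \<and> \<eta> x \<noteq> 0")
    case True
    then have x: "x \<in> B" and e: "0 < \<eta> x" using \<eta>b[of x] by auto
    \<comment> \<open>Dividing by \<eta> restores the full weight with exponent \<open>m\<close>.
      Young's inequality then leaves \<eta>^(m - p), which is at most 1 because m \<ge> P.\<close>
    define y where "y = real m * L * w x / \<eta> x"
    have y0: "0 \<le> y" unfolding y_def using L0 nn e by simp
    have "real m * \<eta> x ^ (m - 1) * L * w x * g x powr (p x - 1) = \<eta> x ^ m * (g x powr (p x - 1) * y)"
      using e m0 by (simp add: y_def power_eq_if)
    also have "\<dots> \<le> \<eta> x ^ m * (g x powr p x / 2 + 2 powr p x * y powr p x)"
      using e y0 pB[OF x] by (intro mult_left_mono Young_half) (auto simp: g_def)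
    also have "\<dots> = \<eta> x ^ m * g x powr p x / 2 + 2 powr p x * (\<eta> x powr (real m - p x) * (real m * L * w x) powr p x)"
      using e L0 nn by (simp add: y_def powr_divide powr_diff powr_realpow distrib_left)
    also have "\<dots> \<le> \<eta> x ^ m * g x powr p x / 2 + 2 powr P * (1 * (real m * L * w x) powr p x)"
    proof -
      have e1: "\<eta> x powr (real m - p x) \<le> 1" using e \<eta>b[of x] pB[OF x] m(2) by (intro powr_le1) auto
      show ?thesis
        by (intro add_left_mono mult_mono[of "2 powr p x" "2 powr P"] mult_right_mono[OF e1]) (use pB[OF x] in auto)
    qed
    finally show ?thesis using True unfolding b_def A_def E_def by simp
  next
    case False
    then have "b x = 0" unfolding b_def using m0 by auto
    then show ?thesis using nn[of x] by simp
  qed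
  \<comment> \<open>Finiteness of the energy is what allows half of it to be subtracted at the end.
    It follows from the gradient being in the variable Lebesgue space, without any quantitative use
    of its norm.\<close>
  have Afin: "(\<integral>\<^sup>+x. ennreal (A x) \<partial>lborel) < \<infinity>"
  proof (rule le_less_trans[OF nn_integral_mono gint])
    fix x
    have "\<eta> x ^ m \<le> 1" using \<eta>b[of x] by (simp add: power_le_one)
    then have "\<eta> x ^ m * g x powr p x \<le> g x powr p x" by (simp add: mult_left_le_one_le \<eta>b)
    then show "ennreal (A x) \<le> ennreal (indicator \<Omega> x * g x powr p x)"
      unfolding A_def using B\<Omega> by (intro ennreal_leI) (auto simp: indicator_def)
  qed
  have Efin: "(\<integral>\<^sup>+x. ennreal (E x) \<partial>lborel) < \<infinity>"
  proof -
    have "(\<integral>\<^sup>+x. ennreal (E x) \<partial>lborel) \<le> (\<integral>\<^sup>+x. ennreal (2 powr P * (1 + real m * L) powr P) * ennreal (indicator \<Omega> x * \<bar>u x\<bar> powr p x) \<partial>lborel)"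
    proof (rule nn_integral_mono)
      fix x
      show "ennreal (E x) \<le> ennreal (2 powr P * (1 + real m * L) powr P) * ennreal (indicator \<Omega> x * \<bar>u x\<bar> powr p x)"
      proof (cases "x \<in> B")
        case True
        have "(real m * L * w x) powr p x \<le> ((1 + real m * L) * \<bar>u x\<bar>) powr p x"
          using L0 pB[OF True] k by (intro powr_mono2 mult_mono) (auto simp: w_def)
        also have "\<dots> = (1 + real m * L) powr p x * \<bar>u x\<bar> powr p x" using L0 by (simp add: powr_mult)
        also have "\<dots> \<le> (1 + real m * L) powr P * \<bar>u x\<bar> powr p x"
          using L0 pB[OF True] by (intro mult_right_mono powr_mono) auto
        finally have "2 powr P * (real m * L * w x) powr p x \<le> 2 powr P * ((1 + real m * L) powr P * \<bar>u x\<bar> powr p x)"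
          by (intro mult_left_mono) auto
        then show ?thesis
          using True B\<Omega> unfolding E_def by (auto simp: indicator_def mult.assoc ennreal_leI simp flip: ennreal_mult)
      qed (simp add: E_def)
    qed
    also have "\<dots> = ennreal (2 powr P * (1 + real m * L) powr P) * (\<integral>\<^sup>+x. ennreal (indicator \<Omega> x * \<bar>u x\<bar> powr p x) \<partial>lborel)"
      by (rule nn_integral_cmult) measurable
    also have "\<dots> < \<infinity>" using uint by (simp add: ennreal_mult_less_top)
    finally show ?thesis .
  qed
  have half: "(\<integral>\<^sup>+x. ennreal (b x) \<partial>lborel) \<le> ennreal (1 / 2) * (\<integral>\<^sup>+x. ennreal (A x) \<partial>lborel) + (\<integral>\<^sup>+x. ennreal (E x) \<partial>lborel)"
  proof -
    have "(\<integral>\<^sup>+x. ennreal (b x) \<partial>lborel) \<le> (\<integral>\<^sup>+x. ennreal (1 / 2) * ennreal (A x) + ennreal (E x) \<partial>lborel)"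
    proof (rule nn_integral_mono)
      fix x
      have h: "0 \<le> 1 / 2 * A x" "(0::real) \<le> 1 / 2" using nn[of x] by auto
      show "ennreal (b x) \<le> ennreal (1 / 2) * ennreal (A x) + ennreal (E x)"
        unfolding ennreal_mult[OF h(2) nn(1), symmetric] ennreal_plus[OF h(1) nn(2), symmetric]
        using bA[of x] by (intro ennreal_leI) simp
    qed
    also have "\<dots> = ennreal (1 / 2) * (\<integral>\<^sup>+x. ennreal (A x) \<partial>lborel) + (\<integral>\<^sup>+x. ennreal (E x) \<partial>lborel)"
      by (simp add: nn_integral_add nn_integral_cmult)
    finally show ?thesis .
  qed
  have bfin: "(\<integral>\<^sup>+x. ennreal (b x) \<partial>lborel) < \<infinity>"
  proof (rule le_less_trans[OF half])
    define hf where "hf = ennreal (1 / 2)"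
    have "hf < top" unfolding hf_def by (rule ennreal_less_top)
    then show "ennreal (1 / 2) * (\<integral>\<^sup>+x. ennreal (A x) \<partial>lborel) + (\<integral>\<^sup>+x. ennreal (E x) \<partial>lborel) < \<infinity>"
      unfolding hf_def[symmetric] using Afin Efin by (simp add: ennreal_mult_less_top)
  qed
  define V where "V l x = \<eta> x ^ m * max 0 (u x - l)" for l x
  define F where "F l x = (\<eta> x ^ m * indicator {x. u x > l} x) *\<^sub>R G x + (real m * \<eta> x ^ (m - 1) * max 0 (u x - l)) *\<^sub>R grad \<eta> x" for l x
  have WV: "W11 (V l) (F l)" if "0 \<le> l" for l
    unfolding V_def F_def \<eta>_def by (rule W11_excess_cutoff[OF W R that m(1)])
  \<comment> \<open>The portion of the energy on the layer k < u \<le> k + M, which is what a test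
    function truncated at height \<open>M\<close> sees.\<close>
  define a where "a M x = indicator B x * ((indicator {x. u x > k} x - indicator {x. u x > k + M} x) * (\<eta> x ^ m * g x powr p x))" for M x
  have step: "(\<integral>\<^sup>+x. ennreal (a M x) \<partial>lborel) \<le> (\<integral>\<^sup>+x. ennreal (D x) \<partial>lborel) + (\<integral>\<^sup>+x. ennreal (b x) \<partial>lborel)"
    if M: "0 \<le> M" for M
  proof -
    \<comment> \<open>The difference of two excesses is the excess over \<open>k\<close> capped at
      \<open>M\<close>. It is therefore bounded and belongs to \<open>W11\<close> by
      linearity.\<close>
    define v where "v x = V k x - V (k + M) x" for x
    define F' where "F' x = F k x - F (k + M) x" for x
    define d where "d x = indicator {x. u x > k} x - (indicator {x. u x > k + M} x :: real)" for x
    define \<delta> where "\<delta> x = max 0 (u x - k) - max 0 (u x - (k + M))" for x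
    have Wv: "W11 v F'" unfolding v_def[abs_def] F'_def[abs_def] using k M by (intro W11_diff WV) auto
    note [measurable] = W11D(3,4)[OF Wv]
    have [measurable]: "a M \<in> borel_measurable borel" unfolding a_def[abs_def] by measurable
    have d: "0 \<le> d x" "d x \<le> indicator {x. u x > k} x" for x unfolding d_def using M by (auto simp: indicator_def)
    have \<delta>: "0 \<le> \<delta> x" "\<delta> x \<le> w x" "\<delta> x \<le> M" "\<delta> x \<le> indicator {x. u x > k} x * w x" for x
      unfolding \<delta>_def w_def using M by (auto simp: indicator_def max_def)
    have v_eq: "v x = \<eta> x ^ m * \<delta> x" for x unfolding v_def V_def \<delta>_def by (simp add: algebra_simps)
    have F_eq: "F' x = (\<eta> x ^ m * d x) *\<^sub>R G x + (real m * \<eta> x ^ (m - 1) * \<delta> x) *\<^sub>R grad \<eta> x" for x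
      unfolding F'_def F_def d_def \<delta>_def by (simp add: algebra_simps)
    have F_out: "F' x = 0" if "x \<notin> B" for x unfolding F_eq \<eta>0[OF that] z by simp
    have \<eta>m: "0 \<le> \<eta> x ^ n" "\<eta> x ^ n \<le> 1" for x n using \<eta>b[of x] by (auto simp: power_le_one)
    have F_le: "norm (F' x) \<le> g x + real m * L * M" for x
    proof -
      have "norm (F' x) \<le> norm ((\<eta> x ^ m * d x) *\<^sub>R G x) + norm ((real m * \<eta> x ^ (m - 1) * \<delta> x) *\<^sub>R grad \<eta> x)"
        unfolding F_eq by (rule norm_triangle_ineq)
      also have "\<dots> = (\<eta> x ^ m * d x) * g x + (real m * \<eta> x ^ (m - 1) * \<delta> x) * norm (grad \<eta> x)"
        using \<eta>m d \<delta> by (simp add: g_def abs_mult)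
      also have "\<dots> \<le> (1 * 1) * g x + (real m * 1 * M) * L"
      proof -
        have "d x \<le> 1" unfolding d_def by (auto simp: indicator_def)
        then show ?thesis using \<eta>m d \<delta> L' L0 M by (intro add_mono mult_mono mult_nonneg_nonneg) (auto simp: g_def)
      qed
      finally show ?thesis by (simp add: mult_ac)
    qed
    have F_fin: "(\<integral>\<^sup>+x. ennreal (indicator \<Omega> x * norm (F' x) powr p x) \<partial>lborel) < \<infinity>"
    proof -
      have "(\<integral>\<^sup>+x. ennreal (indicator \<Omega> x * norm (F' x) powr p x) \<partial>lborel) \<le>
          (\<integral>\<^sup>+x. ennreal (2 powr P) * (ennreal (indicator \<Omega> x * g x powr p x) + ennreal (indicator (ball c R) x * (1 + real m * L * M) powr P)) \<partial>lborel)"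
      proof (rule nn_integral_mono)
        fix x
        show "ennreal (indicator \<Omega> x * norm (F' x) powr p x) \<le>
          ennreal (2 powr P) * (ennreal (indicator \<Omega> x * g x powr p x) + ennreal (indicator (ball c R) x * (1 + real m * L * M) powr P))"
        proof (cases "x \<in> B")
          case True
          have mLM: "0 \<le> real m * L * M" using L0 M by simp
          have "norm (F' x) powr p x \<le> (g x + (1 + real m * L * M)) powr p x"
            using F_le[of x] pB[OF True] by (intro powr_mono2) auto
          also have "\<dots> \<le> 2 powr P * (g x powr p x + (1 + real m * L * M) powr p x)"
            using pB[OF True] mLM by (intro powr_add_le) (auto simp: g_def)
          also have "\<dots> \<le> 2 powr P * (g x powr p x + (1 + real m * L * M) powr P)"
            using pB[OF True] mLM by (intro mult_left_mono add_left_mono powr_mono) auto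
          finally show ?thesis using True B\<Omega> unfolding B_def[symmetric]
            by (auto simp: indicator_def ennreal_leI simp flip: ennreal_mult ennreal_plus)
        qed (simp add: F_out)
      qed
      also have "\<dots> = ennreal (2 powr P) * ((\<integral>\<^sup>+x. ennreal (indicator \<Omega> x * g x powr p x) \<partial>lborel) + (\<integral>\<^sup>+x. ennreal (indicator (ball c R) x * (1 + real m * L * M) powr P) \<partial>lborel))"
      proof -
        have [measurable]: "ball c R \<in> sets borel" by simp
        show ?thesis by (subst nn_integral_add[symmetric]) (measurable, rule nn_integral_cmult, measurable)
      qed
      also have "\<dots> < \<infinity>" using gint nn_ball_const[of c R "(1 + real m * L * M) powr P"] by (simp add: ennreal_mult_less_top)
      finally show ?thesis .
    qed
    define f where "f x = indicator \<Omega> x * (g x powr (p x - 2) * (G x \<bullet> F' x))" for x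
    have [measurable]: "f \<in> borel_measurable borel" unfolding f_def[abs_def] by measurable
    have f_split: "f x = a M x + indicator B x * (g x powr (p x - 2) * (G x \<bullet> grad \<eta> x) * (real m * \<eta> x ^ (m - 1) * \<delta> x))" for x
    proof (cases "x \<in> B")
      case True
      have "g x powr (p x - 2) * (G x \<bullet> G x) = g x powr p x"
        unfolding g_def by (cases "G x = 0") (auto simp: powr_diff dot_square_norm)
      then have "g x powr (p x - 2) * (G x \<bullet> F' x) = d x * (\<eta> x ^ m * g x powr p x) + g x powr (p x - 2) * (G x \<bullet> grad \<eta> x) * (real m * \<eta> x ^ (m - 1) * \<delta> x)"
        unfolding F_eq inner_add_right inner_scaleR_right distrib_left by (simp add: mult_ac)
      then show ?thesis using True B\<Omega> unfolding f_def a_def d_def by auto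
    qed (simp add: f_def a_def F_out)
    have rest: "\<bar>indicator B x * (g x powr (p x - 2) * (G x \<bullet> grad \<eta> x) * (real m * \<eta> x ^ (m - 1) * \<delta> x))\<bar> \<le> b x" for x
    proof (cases "x \<in> B")
      case True
      have "\<bar>G x \<bullet> grad \<eta> x\<bar> \<le> g x * L"
        using Cauchy_Schwarz_ineq2[of "G x" "grad \<eta> x"] mult_left_mono[OF L'[of x], of "g x"] unfolding g_def by auto
      then have "g x powr (p x - 2) * \<bar>G x \<bullet> grad \<eta> x\<bar> \<le> g x powr (p x - 2) * (g x * L)"
        by (intro mult_left_mono) auto
      also have "\<dots> = g x powr (p x - 1) * L"
        unfolding g_def by (cases "G x = 0") (auto simp: powr_diff power2_eq_square)
      finally have q: "g x powr (p x - 2) * \<bar>G x \<bullet> grad \<eta> x\<bar> \<le> g x powr (p x - 1) * L" .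
      have "g x powr (p x - 2) * \<bar>G x \<bullet> grad \<eta> x\<bar> * (real m * \<eta> x ^ (m - 1) * \<delta> x) \<le> g x powr (p x - 1) * L * (real m * \<eta> x ^ (m - 1) * (indicator {x. u x > k} x * w x))"
        by (rule mult_mono[OF q mult_left_mono[OF \<delta>(4)]]) (use \<eta>m \<delta> L0 in auto)
      then show ?thesis using True \<eta>m \<delta> unfolding b_def by (simp add: abs_mult mult_ac)
    qed (simp add: b_def)
    have ab: "a M x \<le> f x + b x" "\<bar>f x\<bar> \<le> a M x + b x" "0 \<le> a M x" "a M x \<le> A x" for x
    proof -
      show "0 \<le> a M x" "a M x \<le> A x"
        unfolding a_def A_def using d[of x, unfolded d_def] \<eta>m by (auto simp: indicator_def)
      then show "a M x \<le> f x + b x" "\<bar>f x\<bar> \<le> a M x + b x"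
        using f_split[of x] rest[of x] by linarith+
    qed
    have ai: "integrable lborel (a M)"
    proof (rule integrableI_bounded)
      show "(\<integral>\<^sup>+x. ennreal (norm (a M x)) \<partial>lborel) < \<infinity>"
        by (rule le_less_trans[OF nn_integral_mono Afin]) (use ab in \<open>auto intro: ennreal_leI\<close>)
    qed measurable
    have bi: "integrable lborel b"
      by (rule integrableI_bounded) (use bfin nn in auto)
    have fi: "integrable lborel f"
      by (rule Bochner_Integration.integrable_bound[OF Bochner_Integration.integrable_add[OF ai bi]])
        (use ab nn in \<open>auto intro!: AE_I2 order_trans[OF ab(2)]\<close>)
    have "(\<integral>x. a M x \<partial>lborel) \<le> (\<integral>x. f x + b x \<partial>lborel)"
      using ai bi fi ab by (intro integral_mono) auto
    also have "\<dots> = (\<integral>x. f x \<partial>lborel) + (\<integral>x. b x \<partial>lborel)" using bi fi by simp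
    finally have le: "(\<integral>x. a M x \<partial>lborel) \<le> (\<integral>x. f x \<partial>lborel) + (\<integral>x. b x \<partial>lborel)" .
    have "ennreal (\<integral>x. a M x \<partial>lborel) \<le> ennreal (\<integral>x. f x \<partial>lborel) + ennreal (\<integral>x. b x \<partial>lborel)"
    proof -
      \<comment> \<open>The integral of \<open>f\<close> may be negative, in which case
        \<open>ennreal\<close> replaces it by 0; only this inequality survives.\<close>
      have sub: "ennreal (s + t) \<le> ennreal s + ennreal t" if "0 \<le> t" for s t :: real
        using that by (cases "0 \<le> s") (auto simp: ennreal_neg intro: ennreal_leI)
      have "0 \<le> (\<integral>x. b x \<partial>lborel)" using nn by simp
      from order_trans[OF ennreal_leI[OF le] sub[OF this]] show ?thesis .
    qed
    also have "ennreal (\<integral>x. f x \<partial>lborel) \<le> (\<integral>\<^sup>+x. ennreal (indicator \<Omega> x * (H x * (\<bar>u x\<bar> + 1) powr (p x - 1) * v x)) \<partial>lborel)"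
    proof -
      have "W11 v F' \<and> compact (cball c R) \<and> cball c R \<subseteq> \<Omega> \<and> (\<forall>x. 0 \<le> v x \<and> v x \<le> M) \<and> (\<forall>x. x \<notin> cball c R \<longrightarrow> v x = 0) \<and>
        (\<integral>\<^sup>+x. ennreal (indicator \<Omega> x * norm (F' x) powr p x) \<partial>lborel) < \<infinity>"
      proof (intro conjI Wv F_fin compact_cball allI impI)
        show "cball c R \<subseteq> \<Omega>" using R subset_cball[of R R' c] by auto
        show "0 \<le> v x" for x unfolding v_eq using \<eta>m \<delta> by simp
        show "v x \<le> M" for x unfolding v_eq using mult_mono[OF \<eta>m(2) \<delta>(3)] \<delta>(1) by (simp add: )
        show "v x = 0" if "x \<notin> cball c R" for x
        proof -
          have "x \<notin> B" using that by (auto simp: B_def)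
          then show ?thesis unfolding v_eq \<eta>0[OF \<open>x \<notin> B\<close>] z by simp
        qed
      qed
      then show ?thesis using sub unfolding subsolution_def f_def g_def by blast
    qed
    also have "\<dots> \<le> (\<integral>\<^sup>+x. ennreal (D x) \<partial>lborel)"
    proof (rule nn_integral_mono, rule ennreal_leI)
      fix x
      show "indicator \<Omega> x * (H x * (\<bar>u x\<bar> + 1) powr (p x - 1) * v x) \<le> D x"
      proof (cases "x \<in> B")
        case True
        have "H x * (\<bar>u x\<bar> + 1) powr (p x - 1) * v x \<le> H x * (\<bar>u x\<bar> + 1) powr (p x - 1) * (\<eta> x ^ m * w x)"
          unfolding v_eq using H0 \<delta> \<eta>m by (intro mult_left_mono mult_nonneg_nonneg) auto
        then show ?thesis using True B\<Omega> unfolding D_def by (auto simp: indicator_def)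
      next
        case False
        then show ?thesis unfolding v_eq D_def \<eta>0[OF False] z by simp
      qed
    qed
    finally show ?thesis
      using nn_integral_eq_integral[OF ai] nn_integral_eq_integral[OF bi] ab(3) nn(4) by (simp add: add_mono)
  qed
  \<comment> \<open>As soon as n \<ge> u(x) the cap no longer matters at \<open>x\<close>, so the
    truncated energies are eventually equal to the full one, and Fatou's lemma transfers the
    bound.\<close>
  have lim: "(\<integral>\<^sup>+x. ennreal (A x) \<partial>lborel) \<le> (\<integral>\<^sup>+x. ennreal (D x) \<partial>lborel) + (\<integral>\<^sup>+x. ennreal (b x) \<partial>lborel)"
  proof -
    have am: "a M \<in> borel_measurable borel" for M unfolding a_def[abs_def] by measurable
    have "(\<integral>\<^sup>+x. ennreal (A x) \<partial>lborel) = (\<integral>\<^sup>+x. liminf (\<lambda>n. ennreal (a (real n) x)) \<partial>lborel)"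
    proof (rule nn_integral_cong)
      fix x
      have "\<forall>\<^sub>F n in sequentially. u x \<le> real n"
        using filterlim_real_sequentially by (simp add: filterlim_at_top)
      then have "\<forall>\<^sub>F n in sequentially. ennreal (a (real n) x) = ennreal (A x)"
      proof eventually_elim
        case (elim n)
        then have "\<not> k + real n < u x" using k by simp
        then show ?case unfolding a_def A_def by simp
      qed
      then have "(\<lambda>n. ennreal (a (real n) x)) \<longlonglongrightarrow> ennreal (A x)" by (rule tendsto_eventually)
      then show "ennreal (A x) = liminf (\<lambda>n. ennreal (a (real n) x))"
        by (simp add: lim_imp_Liminf)
    qed
    also have "\<dots> \<le> liminf (\<lambda>n. \<integral>\<^sup>+x. ennreal (a (real n) x) \<partial>lborel)"
      by (rule nn_integral_liminf) (use am in measurable)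
    also have "\<dots> \<le> (\<integral>\<^sup>+x. ennreal (D x) \<partial>lborel) + (\<integral>\<^sup>+x. ennreal (b x) \<partial>lborel)"
      using step by (intro Liminf_le) auto
    finally show ?thesis .
  qed
  have "(\<integral>\<^sup>+x. ennreal (A x) \<partial>lborel) \<le> 2 * ((\<integral>\<^sup>+x. ennreal (E x) \<partial>lborel) + (\<integral>\<^sup>+x. ennreal (D x) \<partial>lborel))"
  \<comment> \<open>If the term with \<open>H\<close> is infinite, nothing is to be shown. Otherwise
    all quantities are real and A' \<le> D' + A'/2 + E' is solved for A'.\<close>
  proof (cases "(\<integral>\<^sup>+x. ennreal (D x) \<partial>lborel)")
    case top
    then show ?thesis by (simp add: ennreal_mult_eq_top_iff)
  next
    case (real D')
    obtain A' where A': "0 \<le> A'" "(\<integral>\<^sup>+x. ennreal (A x) \<partial>lborel) = ennreal A'"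
      using Afin by (cases "(\<integral>\<^sup>+x. ennreal (A x) \<partial>lborel)") auto
    obtain E' where E': "0 \<le> E'" "(\<integral>\<^sup>+x. ennreal (E x) \<partial>lborel) = ennreal E'"
      using Efin by (cases "(\<integral>\<^sup>+x. ennreal (E x) \<partial>lborel)") auto
    have "ennreal A' \<le> ennreal D' + (ennreal (1 / 2) * ennreal A' + ennreal E')"
      using order_trans[OF lim add_left_mono[OF half]] unfolding A' E' real .
    also have "\<dots> = ennreal (D' + (1 / 2 * A' + E'))"
    proof -
      have h: "0 \<le> 1 / 2 * A'" "(0::real) \<le> 1 / 2" "0 \<le> 1 / 2 * A' + E'" using A'(1) E'(1) by auto
      show ?thesis
        by (simp only: ennreal_mult[OF h(2) A'(1)] ennreal_plus[OF h(1) E'(1)] ennreal_plus[OF real(1) h(3)])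
    qed
    finally have "A' \<le> D' + (1 / 2 * A' + E')"
      using A'(1) E'(1) real(1) by (subst (asm) ennreal_le_iff) auto
    then have "A' \<le> 2 * (E' + D')" by simp
    then have "ennreal A' \<le> ennreal (2 * (E' + D'))" by (rule ennreal_leI)
    also have "\<dots> = 2 * (ennreal E' + ennreal D')"
      using E'(1) real(1) by (simp add: ennreal_mult)
    finally show ?thesis unfolding A' E' real .
  qed
  then show ?thesis unfolding A_def E_def D_def w_def g_def \<eta>_def B_def .
qed

section \<open>Estimates on a small ball\<close>

text \<open>A pointwise splitting becomes a bound on integrals without any integrability of
  \<open>f\<close>. With \<open>a2 = 0\<close> and a ball indicator in the second place, the same
  rule serves estimates with a single term, which explains the summands \<open>0 * \<beta>\<close>
  below.\<close>

lemma nn_bound_add: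
  fixes f g1 g2 :: "'a \<Rightarrow> real"
  assumes m: "g1 \<in> borel_measurable M" "g2 \<in> borel_measurable M"
    and nn: "\<And>x. 0 \<le> g1 x" "\<And>x. 0 \<le> g2 x" "0 \<le> a1" "0 \<le> a2" "0 \<le> I1" "0 \<le> I2"
    and f: "\<And>x. f x \<le> a1 * g1 x + a2 * g2 x"
    and I: "(\<integral>\<^sup>+x. ennreal (g1 x) \<partial>M) \<le> ennreal I1" "(\<integral>\<^sup>+x. ennreal (g2 x) \<partial>M) \<le> ennreal I2"
  shows "(\<integral>\<^sup>+x. ennreal (f x) \<partial>M) \<le> ennreal (a1 * I1 + a2 * I2)"
proof -
  have "(\<integral>\<^sup>+x. ennreal (f x) \<partial>M) \<le> (\<integral>\<^sup>+x. ennreal a1 * ennreal (g1 x) + ennreal a2 * ennreal (g2 x) \<partial>M)"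
  proof (rule nn_integral_mono)
    fix x
    have "ennreal a1 * ennreal (g1 x) + ennreal a2 * ennreal (g2 x) = ennreal (a1 * g1 x + a2 * g2 x)"
      using nn by (simp add: ennreal_mult)
    then show "ennreal (f x) \<le> ennreal a1 * ennreal (g1 x) + ennreal a2 * ennreal (g2 x)"
      using f[of x] by (simp add: ennreal_leI)
  qed
  also have "\<dots> = ennreal a1 * (\<integral>\<^sup>+x. ennreal (g1 x) \<partial>M) + ennreal a2 * (\<integral>\<^sup>+x. ennreal (g2 x) \<partial>M)"
    using m by (subst nn_integral_add) (auto simp: nn_integral_cmult)
  also have "\<dots> \<le> ennreal a1 * ennreal I1 + ennreal a2 * ennreal I2"
    by (intro add_mono mult_left_mono I) auto
  also have "\<dots> = ennreal (a1 * I1 + a2 * I2)" using nn by (simp add: ennreal_mult)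
  finally show ?thesis .
qed

lemma nn_bound_add3:
  fixes f g1 g2 g3 :: "'a \<Rightarrow> real"
  assumes m: "g1 \<in> borel_measurable M" "g2 \<in> borel_measurable M" "g3 \<in> borel_measurable M"
    and nn: "\<And>x. 0 \<le> g1 x" "\<And>x. 0 \<le> g2 x" "\<And>x. 0 \<le> g3 x"
      "0 \<le> a1" "0 \<le> a2" "0 \<le> a3" "0 \<le> I1" "0 \<le> I2" "0 \<le> I3"
    and f: "\<And>x. f x \<le> a1 * g1 x + a2 * g2 x + a3 * g3 x"
    and I: "(\<integral>\<^sup>+x. ennreal (g1 x) \<partial>M) \<le> ennreal I1" "(\<integral>\<^sup>+x. ennreal (g2 x) \<partial>M) \<le> ennreal I2"
      "(\<integral>\<^sup>+x. ennreal (g3 x) \<partial>M) \<le> ennreal I3"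
  shows "(\<integral>\<^sup>+x. ennreal (f x) \<partial>M) \<le> ennreal (a1 * I1 + a2 * I2 + a3 * I3)"
proof -
  have I12: "(\<integral>\<^sup>+x. ennreal (a1 * g1 x + a2 * g2 x) \<partial>M) \<le> ennreal (a1 * I1 + a2 * I2)"
    by (rule nn_bound_add[OF m(1,2) nn(1,2,4,5,7,8) order_refl I(1,2)])
  have "(\<integral>\<^sup>+x. ennreal (f x) \<partial>M) \<le> ennreal (1 * (a1 * I1 + a2 * I2) + a3 * I3)"
  proof (rule nn_bound_add[OF _ m(3) _ nn(3) _ nn(6) _ nn(9) _ I12 I(3)])
    show "(\<lambda>x. a1 * g1 x + a2 * g2 x) \<in> borel_measurable M" using m by measurable
  qed (use nn f in auto)
  then show ?thesis by simp
qed

text \<open>Either b X^t is at most X/2 and is absorbed, or X^(1-t) \<le> 2b bounds X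
  outright.\<close>

lemma sublinear_bound:
  fixes X a b t :: real
  assumes "0 \<le> X" "0 \<le> a" "0 \<le> b" "t < 1" and X: "X \<le> a + b * X powr t"
  shows "X \<le> 2 * a + (2 * b) powr (1 / (1 - t))"
proof (cases "b * X powr t \<le> X / 2")
  case True
  then show ?thesis using X assms(2) by (simp add: add_increasing2)
next
  case False
  then have X0: "0 < X" using assms by (cases "X = 0") auto
  have "X powr (1 - t) * X powr t = X" using X0 by (simp flip: powr_add)
  then have "X powr (1 - t) * X powr t \<le> (2 * b) * X powr t" using False by simp
  then have "X powr (1 - t) \<le> 2 * b" using X0 by simp
  then have "(X powr (1 - t)) powr (1 / (1 - t)) \<le> (2 * b) powr (1 / (1 - t))"
    using assms(4) by (intro powr_mono2) auto
  then have "X \<le> (2 * b) powr (1 / (1 - t))" using X0 assms(4) by (simp add: powr_powr)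
  then show ?thesis using assms(2) by simp
qed

text \<open>It exchanges a constant exponent for a larger variable one at the price of the volume of
  the ball.\<close>

lemma powr_le_1_plus:
  fixes x :: real
  assumes "0 \<le> x" "0 \<le> s" "s \<le> t"
  shows "x powr s \<le> 1 + x powr t"
proof (cases "x \<le> 1")
  case True
  then have "x powr s \<le> 1" using assms by (intro powr_le1) auto
  then show ?thesis by (simp add: add_increasing2)
next
  case False
  then have "x powr s \<le> x powr t" using assms by (intro powr_mono) auto
  then show ?thesis by simp
qed

text \<open>The exponents vary so little on the ball that Sobolev's exponent for \<open>s = min p\<close> exceeds
  \<open>P q'\<close> with \<open>P = max p\<close>.\<close>

locale small_ball =
  fixes \<Omega> :: "'a::euclidean_space set" and p q0 :: "'a \<Rightarrow> real" and c :: 'a and R s P q r :: real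
  assumes \<Omega> [measurable]: "\<Omega> \<in> sets borel"
    and pm [measurable]: "p \<in> borel_measurable borel" and q0m [measurable]: "q0 \<in> borel_measurable borel"
    and R: "0 < R" "cball c (4 * R) \<subseteq> \<Omega>"
    and pB: "\<And>x. x \<in> cball c (4 * R) \<Longrightarrow> s \<le> p x \<and> p x \<le> P"
    and qB: "\<And>x. x \<in> cball c (4 * R) \<Longrightarrow> q \<le> q0 x"
    and s: "1 < s" and q: "1 < q" and r: "P * (q / (q - 1)) < r"
    and sub: "real DIM('a) * (1 / s - 1 / r) < 1"
begin

text \<open>Hoelder's inequality pairs \<open>H\<close> in the power \<open>q\<close> with the power
  \<open>P\<close> of the excess, so the excess is measured in the power P q'. This is the norm in
  which the iteration runs.\<close>

definition \<rho> :: real where "\<rho> = P * (q / (q - 1))"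

lemma exponents: "s \<le> P" "P < \<rho>" "\<rho> < r" "s < r" "\<rho> * (1 - 1 / q) = P" "0 < P" "0 < \<rho>"
proof -
  have "s \<le> p c \<and> p c \<le> P" by (rule pB) (use R in simp)
  then show "s \<le> P" by linarith
  then show P: "0 < P" using s by simp
  show r': "\<rho> < r" using r by (simp add: \<rho>_def)
  have "P * 1 < P * (q / (q - 1))" using P q by (intro mult_strict_left_mono) (auto simp: field_simps)
  then show P': "P < \<rho>" by (simp add: \<rho>_def)
  show "s < r" using \<open>s \<le> P\<close> P' r' by simp
  show "\<rho> * (1 - 1 / q) = P" using q by (simp add: \<rho>_def field_simps)
  show "0 < \<rho>" using P P' by simp
qed

text \<open>Fixing one constant for the ball, before any function is mentioned, keeps all estimates
  derived from it uniform in \<open>u\<close> and \<open>H\<close>.\<close>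

definition sobolev_const :: real where
  "sobolev_const = (SOME C. 0 < C \<and> (\<forall>(v :: 'a \<Rightarrow> real) G x0 I. W11 v G \<longrightarrow> (\<forall>x. x \<notin> ball x0 (4 * R) \<longrightarrow> v x = 0) \<longrightarrow> 0 \<le> I \<longrightarrow>
      (\<integral>\<^sup>+x. ennreal (norm (G x) powr s) \<partial>lborel) \<le> ennreal I \<longrightarrow>
      (\<integral>\<^sup>+x. ennreal (\<bar>v x\<bar> powr r) \<partial>lborel) \<le> ennreal (C * I powr (r / s))))"

lemma sobolev_const:
  "0 < sobolev_const"
  "W11 v G \<Longrightarrow> (\<And>x::'a. x \<notin> ball x0 (4 * R) \<Longrightarrow> v x = 0) \<Longrightarrow> 0 \<le> I \<Longrightarrow>
      (\<integral>\<^sup>+x. ennreal (norm (G x) powr s) \<partial>lborel) \<le> ennreal I \<Longrightarrow>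
      (\<integral>\<^sup>+x. ennreal (\<bar>v x\<bar> powr r) \<partial>lborel) \<le> ennreal (sobolev_const * I powr (r / s))"
proof -
  have "\<exists>C. 0 < C \<and> (\<forall>(v :: 'a \<Rightarrow> real) G x0 I. W11 v G \<longrightarrow> (\<forall>x. x \<notin> ball x0 (4 * R) \<longrightarrow> v x = 0) \<longrightarrow> 0 \<le> I \<longrightarrow>
      (\<integral>\<^sup>+x. ennreal (norm (G x) powr s) \<partial>lborel) \<le> ennreal I \<longrightarrow>
      (\<integral>\<^sup>+x. ennreal (\<bar>v x\<bar> powr r) \<partial>lborel) \<le> ennreal (C * I powr (r / s)))"
  proof -
    have "0 < 4 * R" using R by simp
    from sobolev[OF s exponents(4) sub this] show ?thesis by metis
  qed
  from someI_ex[OF this] show "0 < sobolev_const"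
    "W11 v G \<Longrightarrow> (\<And>x::'a. x \<notin> ball x0 (4 * R) \<Longrightarrow> v x = 0) \<Longrightarrow> 0 \<le> I \<Longrightarrow>
      (\<integral>\<^sup>+x. ennreal (norm (G x) powr s) \<partial>lborel) \<le> ennreal I \<Longrightarrow>
      (\<integral>\<^sup>+x. ennreal (\<bar>v x\<bar> powr r) \<partial>lborel) \<le> ennreal (sobolev_const * I powr (r / s))"
    unfolding sobolev_const_def[symmetric] by blast+
qed

definition \<beta> :: real where "\<beta> = measure lborel (ball c (4 * R))"

lemma \<beta>_nonneg: "0 \<le> \<beta>" by (simp add: \<beta>_def)

lemma ball_volume: "l \<le> 4 * R \<Longrightarrow> (\<integral>\<^sup>+x. ennreal (indicator (ball c l) x) \<partial>lborel) \<le> ennreal \<beta>"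
proof -
  assume "l \<le> 4 * R"
  then have "emeasure lborel (ball c l) \<le> emeasure lborel (ball c (4 * R))"
    by (intro emeasure_mono subset_ball) auto
  also have "\<dots> = ennreal \<beta>"
    unfolding \<beta>_def by (rule emeasure_eq_ennreal_measure) (metis emeasure_lborel_ball_finite infinity_ennreal_def less_irrefl)
  finally show ?thesis by (simp add: ennreal_indicator)
qed

lemma ball_subset: "l \<le> 4 * R \<Longrightarrow> ball c l \<subseteq> cball c (4 * R)" "l \<le> 4 * R \<Longrightarrow> ball c l \<subseteq> \<Omega>"
proof -
  show 1: "ball c l \<subseteq> cball c (4 * R)" if "l \<le> 4 * R" using that by auto
  show "ball c l \<subseteq> \<Omega>" if "l \<le> 4 * R" using 1[OF that] R by auto
qed

text \<open>Absorbing \<open>\<integral> H u\<^sup>P\<close> uses a power \<open>m / n < s\<close> of the cut off function: its bound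
  by the gradient is then sublinear, and the remaining power of \<open>u\<close> is controlled by the modular.\<close>

lemma higher_integrability:
  fixes m n :: nat
  assumes mn: "2 \<le> m" "2 \<le> n" "P \<le> real m" "real m < real n * s"
    and \<gamma>: "(P - real m / real n) / s \<le> 1 - 1 / q - real m / real n / r"
    and ab: "0 \<le> a" "0 \<le> b"
  obtains Y where "0 \<le> Y" "\<And>u G H. subsolution \<Omega> p u G H \<Longrightarrow>
    (\<integral>\<^sup>+x. ennreal (indicator \<Omega> x * H x powr q0 x) \<partial>lborel) \<le> ennreal a \<Longrightarrow>
    (\<integral>\<^sup>+x. ennreal (indicator \<Omega> x * \<bar>u x\<bar> powr p x) \<partial>lborel) \<le> ennreal b \<Longrightarrow>
    (\<integral>\<^sup>+x. ennreal (indicator (ball c (2 * R)) x * (max 0 (u x - 1)) powr \<rho>) \<partial>lborel) \<le> ennreal Y"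
proof -
  \<comment> \<open>The number \<theta> mediates between two powers of the cutoff. For V = \<eta>^n
    w one has V^\<theta> = \<eta>^m w^\<theta>, so the weight \<eta>^m of the Caccioppoli inequality
    is paid for by \<open>V\<close>. Conversely m < n s gives (\<eta>^n)^s \<le> \<eta>^m, so the
    energy controls the gradient of \<open>V\<close>.\<close>
  define \<theta> where "\<theta> = real m / real n"
  have n0: "0 < real n" "n \<noteq> 0" using mn by auto
  have \<theta>: "0 < \<theta>" "\<theta> < s" using mn n0 by (auto simp: \<theta>_def field_simps)
  \<comment> \<open>The exponent left over after giving 1/q to \<open>H\<close> and \<theta>/r to
    \<open>V\<close>. The hypothesis on the exponents says P - \<theta> \<le> s g, so the remaining
    power of the excess is dominated by the power \<open>g\<close> of (1 + w)^s, which is integrable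
    by the modular.\<close>
  define g where "g = 1 - 1 / q - \<theta> / r"
  have gP: "(P - \<theta>) / s \<le> g" using \<gamma> by (simp add: g_def \<theta>_def)
  have g0: "0 < g" using gP \<theta> exponents s by (intro less_le_trans[OF _ gP]) auto
  define b0 where "b0 = 1 - 1 / q"
  have b0: "0 < b0" using q by (simp add: b0_def)
  define L where "L = 8 * (exp 1)\<^sup>2 / R"
  have L0: "0 \<le> L" using R by (simp add: L_def)
  define a' where "a' = 1 * \<beta> + 1 * a"
  define b' where "b' = 2 powr s * 2 * \<beta> + 2 powr s * b"
  define C1 where "C1 = a' powr (1 / q) * (sobolev_const powr (\<theta> / r) * b' powr g)"
  define E1 where "E1 = 2 powr P * (1 + real m * L) powr P * b"
  define D1 where "D1 = 4 powr P * (1 * \<beta> + 1 * a')"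
  \<comment> \<open>Coefficients of the inequality X \<le> K1 + K2 X^(\<theta>/s) obtained below for
    the integral X of the gradient of \<open>V\<close> in the power \<open>s\<close>. They involve
    \<open>u\<close> and \<open>H\<close> only through \<open>a\<close> and
    \<open>b\<close>.\<close>
  define K1 where "K1 = 2 powr s * (\<beta> + 2 * (E1 + D1) + (1 + real n * L) powr s * b')"
  define K2 where "K2 = 2 powr s * (2 * 4 powr P * C1)"
  define Xmax where "Xmax = 2 * K1 + (2 * K2) powr (1 / (1 - \<theta> / s))"
  define Y where "Y = 1 * \<beta> + 1 * (sobolev_const * Xmax powr (r / s))"
  have a'0: "0 \<le> a'" and b'0: "0 \<le> b'" using ab \<beta>_nonneg by (auto simp: a'_def b'_def)
  have K0: "0 \<le> E1" "0 \<le> D1" "0 \<le> K1" "0 \<le> C1" "0 \<le> K2"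
    using ab a'0 b'0 \<beta>_nonneg sobolev_const(1) by (auto simp: E1_def D1_def K1_def C1_def K2_def)
  have Xm0: "0 \<le> Xmax" using K0 by (simp add: Xmax_def)
  show ?thesis
  proof
    show "0 \<le> Y" using \<beta>_nonneg sobolev_const(1) by (simp add: Y_def)
    fix u G H
    assume S: "subsolution \<Omega> p u G H"
      and Ha: "(\<integral>\<^sup>+x. ennreal (indicator \<Omega> x * H x powr q0 x) \<partial>lborel) \<le> ennreal a"
      and ub: "(\<integral>\<^sup>+x. ennreal (indicator \<Omega> x * \<bar>u x\<bar> powr p x) \<partial>lborel) \<le> ennreal b"
    define B where "B = ball c (3 * R)"
    define \<eta> where "\<eta> = cutoff c (2 * R) (3 * R)"
    define w where "w x = max 0 (u x - 1)" for x
    define V where "V x = \<eta> x ^ n * w x" for x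
    define F where "F x = (\<eta> x ^ n * indicator {x. u x > 1} x) *\<^sub>R G x + (real n * \<eta> x ^ (n - 1) * w x) *\<^sub>R grad \<eta> x" for x
    have W: "W11loc \<Omega> u G" and Hm [measurable]: "H \<in> borel_measurable borel" and H0: "\<And>x. 0 \<le> H x"
      and Gint: "(\<integral>\<^sup>+x. ennreal (indicator \<Omega> x * norm (G x) powr p x) \<partial>lborel) < \<infinity>"
      using S unfolding subsolution_def by auto
    have [measurable]: "u \<in> borel_measurable borel" "G \<in> borel_measurable borel"
      using W unfolding W11loc_def by auto
    have \<eta>s: "smooth \<eta>" unfolding \<eta>_def by (rule cutoff_smooth)
    have [measurable]: "\<eta> \<in> borel_measurable borel" "grad \<eta> \<in> borel_measurable borel"
      using smooth_measurable[OF \<eta>s] smooth_grad_measurable[OF \<eta>s] .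
    have [measurable]: "B \<in> sets borel" "w \<in> borel_measurable borel" "V \<in> borel_measurable borel" "F \<in> borel_measurable borel"
      unfolding B_def w_def[abs_def] V_def[abs_def] F_def[abs_def] by measurable
    have B\<Omega>: "B \<subseteq> \<Omega>" and Bc: "B \<subseteq> cball c (4 * R)"
      unfolding B_def using R by (intro ball_subset; simp)+
    have pB': "s \<le> p x" "p x \<le> P" "1 \<le> p x" "0 \<le> p x" and qB': "q \<le> q0 x" if "x \<in> B" for x
      using pB[of x] qB[of x] that Bc s by auto
    have \<eta>b: "0 \<le> \<eta> x" "\<eta> x \<le> 1" for x unfolding \<eta>_def by (rule cutoff_bounds)+
    have \<eta>k: "0 \<le> \<eta> x ^ l" "\<eta> x ^ l \<le> 1" for x l using \<eta>b[of x] by (auto simp: power_le_one)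
    have \<eta>0: "\<eta> x = 0" if "x \<notin> B" for x using that R unfolding \<eta>_def B_def by (intro cutoff_eq_0) auto
    have L': "norm (grad \<eta> x) \<le> L" for x
      unfolding \<eta>_def L_def using grad_cutoff_bound[of "2 * R" "3 * R" c x] R by simp
    have w0: "0 \<le> w x" "w x \<le> \<bar>u x\<bar>" for x by (auto simp: w_def)
    have z: "(0::real) ^ n = 0" "(0::real) ^ (n - 1) = 0" "(0::real) ^ m = 0" using mn by (auto intro!: zero_power)
    have V_out: "V x = 0" if "x \<notin> B" for x unfolding V_def \<eta>0[OF that] z by simp
    have F_out: "F x = 0" if "x \<notin> B" for x unfolding F_def \<eta>0[OF that] z by simp
    have V0: "0 \<le> V x" for x unfolding V_def using \<eta>k w0 by simp
    have WV: "W11 V F"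
      unfolding V_def[abs_def] F_def[abs_def] w_def \<eta>_def
      by (rule W11_excess_cutoff[OF W, where R' = "4 * R"]) (use R mn in auto)
    have volB: "(\<integral>\<^sup>+x. ennreal (indicator B x) \<partial>lborel) \<le> ennreal \<beta>"
      unfolding B_def using R by (intro ball_volume) simp
    have Hq: "(\<integral>\<^sup>+x. ennreal (indicator B x * H x powr q) \<partial>lborel) \<le> ennreal a'"
      unfolding a'_def
    proof (rule nn_bound_add[OF _ _ _ _ _ _ \<beta>_nonneg ab(1) _ volB Ha])
      show "indicator B x * H x powr q \<le> 1 * indicator B x + 1 * (indicator \<Omega> x * H x powr q0 x)" for x
        using powr_le_1_plus[OF H0[of x], of q "q0 x"] qB'[of x] q B\<Omega> by (auto simp: indicator_def)
    qed auto
    have us: "(\<integral>\<^sup>+x. ennreal (indicator B x * (1 + w x) powr s) \<partial>lborel) \<le> ennreal b'"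
      unfolding b'_def
    proof (rule nn_bound_add[OF _ _ _ _ _ _ \<beta>_nonneg ab(2) _ volB ub])
      show "indicator B x * (1 + w x) powr s \<le> 2 powr s * 2 * indicator B x + 2 powr s * (indicator \<Omega> x * \<bar>u x\<bar> powr p x)" for x
      proof (cases "x \<in> B")
        case True
        have "(1 + w x) powr s \<le> (1 + \<bar>u x\<bar>) powr s" using w0[of x] s by (intro powr_mono2) auto
        also have "\<dots> \<le> 2 powr s * (1 powr s + \<bar>u x\<bar> powr s)" using s by (intro powr_add_le) auto
        also have "\<dots> \<le> 2 powr s * (1 + (1 + \<bar>u x\<bar> powr p x))"
          using powr_le_1_plus[of "\<bar>u x\<bar>" s "p x"] s pB'[OF True] by (intro mult_left_mono) auto
        finally show ?thesis using True B\<Omega> by (auto simp: algebra_simps)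
      qed simp
    qed auto
    define A where "A x = indicator B x * (indicator {x. u x > 1} x * (\<eta> x ^ m * norm (G x) powr p x))" for x
    have [measurable]: "A \<in> borel_measurable borel" unfolding A_def[abs_def] by measurable
    have A0: "0 \<le> A x" for x unfolding A_def using \<eta>k by simp
    have Afin: "(\<integral>\<^sup>+x. ennreal (A x) \<partial>lborel) < \<infinity>"
    proof (rule le_less_trans[OF nn_integral_mono Gint], rule ennreal_leI)
      fix x
      have "\<eta> x ^ m * norm (G x) powr p x \<le> norm (G x) powr p x" using \<eta>k by (simp add: mult_left_le_one_le)
      then show "A x \<le> indicator \<Omega> x * norm (G x) powr p x" unfolding A_def using B\<Omega> by (auto simp: indicator_def)
    qed
    obtain A' where A': "0 \<le> A'" "(\<integral>\<^sup>+x. ennreal (A x) \<partial>lborel) = ennreal A'"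
      using Afin by (cases "(\<integral>\<^sup>+x. ennreal (A x) \<partial>lborel)") auto
    have F_le: "norm (F x) powr s \<le> 2 powr s * (indicator B x + A x + (1 + real n * L) powr s * (indicator B x * (1 + w x) powr s))" for x
    proof (cases "x \<in> B")
      case True
      let ?i = "indicator {x. u x > 1} x :: real"
      have i: "0 \<le> ?i" "?i \<le> 1" "?i powr s = ?i" using s by (auto simp: indicator_def)
      have "norm (F x) \<le> \<eta> x ^ n * ?i * norm (G x) + real n * \<eta> x ^ (n - 1) * w x * norm (grad \<eta> x)"
        unfolding F_def using norm_triangle_ineq[of "(\<eta> x ^ n * ?i) *\<^sub>R G x" "(real n * \<eta> x ^ (n - 1) * w x) *\<^sub>R grad \<eta> x"]
          \<eta>k w0 i by (simp add: abs_mult)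
      also have "real n * \<eta> x ^ (n - 1) * w x * norm (grad \<eta> x) \<le> real n * 1 * (1 + w x) * L"
        using \<eta>k w0[of x] L' L0 by (intro mult_mono mult_nonneg_nonneg) auto
      also have "\<dots> \<le> (1 + real n * L) * (1 + w x)" using w0[of x] by (simp add: algebra_simps)
      finally have "norm (F x) powr s \<le> (\<eta> x ^ n * ?i * norm (G x) + (1 + real n * L) * (1 + w x)) powr s"
        using s by (intro powr_mono2) auto
      also have "\<dots> \<le> 2 powr s * ((\<eta> x ^ n * ?i * norm (G x)) powr s + ((1 + real n * L) * (1 + w x)) powr s)"
        using s \<eta>k i L0 w0 by (intro powr_add_le) auto
      also have "(\<eta> x ^ n * ?i * norm (G x)) powr s \<le> 1 + A x"
      proof -
        \<comment> \<open>For 0 < \<eta> \<le> 1 a larger exponent makes the power smaller, and m <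
          n s; at \<eta> = 0 both sides are 0.\<close>
        have "(\<eta> x ^ n) powr s \<le> \<eta> x ^ m"
        proof (cases "\<eta> x = 0")
          case False
          then have e: "0 < \<eta> x" using \<eta>b[of x] by simp
          then have "(\<eta> x ^ n) powr s = \<eta> x powr (real n * s)" by (simp add: powr_powr flip: powr_realpow)
          also have "\<dots> \<le> \<eta> x powr real m" using mn e \<eta>b[of x] by (intro powr_mono') auto
          finally show ?thesis using e by (simp add: powr_realpow)
        next
          case True
          show ?thesis unfolding True z by simp
        qed
        then have "(\<eta> x ^ n) powr s * ?i * norm (G x) powr s \<le> \<eta> x ^ m * ?i * (1 + norm (G x) powr p x)"
          using powr_le_1_plus[of "norm (G x)" s "p x"] s pB'[OF True] i \<eta>k
          by (intro mult_mono mult_nonneg_nonneg) auto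
        also have "\<dots> \<le> 1 + A x"
        proof -
          have "\<eta> x ^ m * ?i \<le> 1 * 1" using \<eta>k i by (intro mult_mono) auto
          moreover have "A x = \<eta> x ^ m * ?i * norm (G x) powr p x" unfolding A_def using True by (simp add: mult_ac)
          ultimately show ?thesis unfolding distrib_left mult_1_right by simp
        qed
        finally show ?thesis using i \<eta>k by (simp add: powr_mult)
      qed
      finally show ?thesis using True L0 w0[of x] by (simp add: powr_mult)
    qed (simp add: F_out A0)
    have FX: "(\<integral>\<^sup>+x. ennreal (norm (F x) powr s) \<partial>lborel) \<le> ennreal (2 powr s * \<beta> + 2 powr s * A' + 2 powr s * (1 + real n * L) powr s * b')"
    proof (rule nn_bound_add3[OF _ _ _ _ _ _ _ _ _ \<beta>_nonneg A'(1) b'0 _ volB _ us])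
      show "norm (F x) powr s \<le> 2 powr s * indicator B x + 2 powr s * A x + 2 powr s * (1 + real n * L) powr s * (indicator B x * (1 + w x) powr s)" for x
        using F_le[of x] by (simp add: algebra_simps)
    qed (use A0 A' in auto)
    obtain X where X: "0 \<le> X" "(\<integral>\<^sup>+x. ennreal (norm (F x) powr s) \<partial>lborel) = ennreal X"
      using FX by (cases "(\<integral>\<^sup>+x. ennreal (norm (F x) powr s) \<partial>lborel)") (auto simp: top_unique)
    have "ennreal X \<le> ennreal (2 powr s * \<beta> + 2 powr s * A' + 2 powr s * (1 + real n * L) powr s * b')"
      using FX unfolding X(2) .
    then have XA: "X \<le> 2 powr s * \<beta> + 2 powr s * A' + 2 powr s * (1 + real n * L) powr s * b'"
      using A'(1) b'0 \<beta>_nonneg by (subst (asm) ennreal_le_iff) auto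
    have Vr: "(\<integral>\<^sup>+x. ennreal (V x powr r) \<partial>lborel) \<le> ennreal (sobolev_const * X powr (r / s))"
    proof -
      have "(\<integral>\<^sup>+x. ennreal (\<bar>V x\<bar> powr r) \<partial>lborel) \<le> ennreal (sobolev_const * X powr (r / s))"
      proof (rule sobolev_const(2)[OF WV _ X(1)])
        show "V x = 0" if "x \<notin> ball c (4 * R)" for x
          using that R by (intro V_out) (auto simp: B_def)
      qed (simp add: X)
      then show ?thesis using V0 by simp
    qed
    have T: "(\<integral>\<^sup>+x. ennreal (indicator B x * (H x * (\<eta> x ^ m * w x powr P))) \<partial>lborel) \<le> ennreal (C1 * X powr (\<theta> / s))"
    proof -
      \<comment> \<open>Three factors with exponents 1/q, \<theta>/r and g are treated by two nested
        applications of the inequality for two factors. The inner exponents are divided by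
        \<open>b0 = 1 - 1 / q\<close> so that they add up to 1.\<close>
      define f where "f x = indicator B x * H x powr q" for x
      define h where "h x = (V x powr r) powr (\<theta> / (r * b0)) * (indicator B x * (1 + w x) powr s) powr (g / b0)" for x
      have r0: "0 < r" using exponents by simp
      have hint: "(\<integral>\<^sup>+x. ennreal (h x) \<partial>lborel) \<le> ennreal ((sobolev_const * X powr (r / s)) powr (\<theta> / (r * b0)) * b' powr (g / b0))"
        unfolding h_def
      proof (rule nn_Hoelder)
        show "\<theta> / (r * b0) + g / b0 = 1"
          using b0 r0 unfolding g_def b0_def[symmetric] by (simp add: field_simps)
      qed (use \<theta> r0 b0 g0 b'0 Vr us sobolev_const(1) in auto)
      have "indicator B x * (H x * (\<eta> x ^ m * w x powr P)) \<le> f x powr (1 / q) * h x powr b0" for x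
      proof (cases "x \<in> B")
        case True
        have fq: "f x powr (1 / q) = H x" using True q H0 by (simp add: f_def powr_powr)
        have "h x powr b0 = V x powr \<theta> * (1 + w x) powr (s * g)"
          using True b0 r0 w0[of x] by (simp add: h_def powr_mult powr_powr)
        moreover have "V x powr \<theta> = \<eta> x ^ m * w x powr \<theta>"
        proof (cases "\<eta> x = 0")
          case True
          then show ?thesis unfolding V_def True z by simp
        next
          case False
          then have e: "0 < \<eta> x" using \<eta>b[of x] by simp
          then have "(\<eta> x ^ n) powr \<theta> = \<eta> x powr (real n * \<theta>)" by (simp add: powr_powr flip: powr_realpow)
          also have "real n * \<theta> = real m" using n0 by (simp add: \<theta>_def)
          finally show ?thesis unfolding V_def using e w0[of x] by (simp add: powr_mult powr_realpow)
        qed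
        moreover have "w x powr P \<le> w x powr \<theta> * (1 + w x) powr (s * g)"
        proof -
          have "w x powr P = w x powr \<theta> * w x powr (P - \<theta>)" by (simp flip: powr_add)
          also have "w x powr (P - \<theta>) \<le> (1 + w x) powr (P - \<theta>)"
            using w0[of x] \<theta> exponents(1) by (intro powr_mono2) auto
          also have "(1 + w x) powr (P - \<theta>) \<le> (1 + w x) powr (s * g)"
            using w0[of x] gP s by (intro powr_mono) (auto simp: field_simps)
          finally show ?thesis by (simp add: mult_left_mono)
        qed
        ultimately have "\<eta> x ^ m * w x powr P \<le> h x powr b0"
          using mult_left_mono[of "w x powr P" "w x powr \<theta> * (1 + w x) powr (s * g)" "\<eta> x ^ m"] \<eta>k by (simp add: mult.assoc)
        then show ?thesis unfolding fq using True H0[of x] by (simp add: mult_left_mono)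
      qed (simp add: f_def h_def)
      then have "(\<integral>\<^sup>+x. ennreal (indicator B x * (H x * (\<eta> x ^ m * w x powr P))) \<partial>lborel) \<le> (\<integral>\<^sup>+x. ennreal (f x powr (1 / q) * h x powr b0) \<partial>lborel)"
        by (intro nn_integral_mono ennreal_leI)
      also have "\<dots> \<le> ennreal (a' powr (1 / q) * ((sobolev_const * X powr (r / s)) powr (\<theta> / (r * b0)) * b' powr (g / b0)) powr b0)"
      proof (rule nn_Hoelder)
        show "h \<in> borel_measurable lborel" unfolding h_def[abs_def] by measurable
        show "f \<in> borel_measurable lborel" unfolding f_def[abs_def] by measurable
        show "(\<integral>\<^sup>+x. ennreal (f x) \<partial>lborel) \<le> ennreal a'" unfolding f_def by (rule Hq)
        show "0 \<le> h x" "0 \<le> f x" for x by (auto simp: h_def f_def)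
      qed (use q b0 hint a'0 in \<open>auto simp: b0_def\<close>)
      also have "((sobolev_const * X powr (r / s)) powr (\<theta> / (r * b0)) * b' powr (g / b0)) powr b0
          = sobolev_const powr (\<theta> / r) * b' powr g * X powr (\<theta> / s)"
        using b0 r0 s sobolev_const(1) X(1) b'0 by (simp add: powr_mult powr_powr)
      finally show ?thesis by (simp add: C1_def mult_ac)
    qed
    have Hint: "(\<integral>\<^sup>+x. ennreal (indicator B x * H x) \<partial>lborel) \<le> ennreal (1 * \<beta> + 1 * a')"
    proof (rule nn_bound_add[OF _ _ _ _ _ _ \<beta>_nonneg a'0 _ volB Hq])
      show "indicator B x * H x \<le> 1 * indicator B x + 1 * (indicator B x * H x powr q)" for x
        using powr_le_1_plus[OF H0[of x], of 1 q] q H0[of x] by (auto simp: indicator_def)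
    qed auto
    have D: "(\<integral>\<^sup>+x. ennreal (indicator B x * (H x * (\<bar>u x\<bar> + 1) powr (p x - 1) * (\<eta> x ^ m * w x))) \<partial>lborel)
        \<le> ennreal (4 powr P * (1 * \<beta> + 1 * a') + 4 powr P * (C1 * X powr (\<theta> / s)))"
    proof (rule nn_bound_add[OF _ _ _ _ _ _ _ _ _ Hint T])
      fix x
      show "indicator B x * (H x * (\<bar>u x\<bar> + 1) powr (p x - 1) * (\<eta> x ^ m * w x))
          \<le> 4 powr P * (indicator B x * H x) + 4 powr P * (indicator B x * (H x * (\<eta> x ^ m * w x powr P)))"
      proof (cases "x \<in> B \<and> u x > 1")
        case True
        have uw: "\<bar>u x\<bar> + 1 = w x + 2" using True by (simp add: w_def)
        have "(w x + 2) powr (p x - 1) * w x \<le> (w x + 2) powr (p x - 1) * (w x + 2)"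
          by (intro mult_left_mono) auto
        also have "\<dots> = (w x + 2) powr p x" using w0[of x] by (simp add: powr_diff)
        also have "\<dots> \<le> (w x + 2) powr P" using w0[of x] pB'[of x] True by (intro powr_mono) auto
        also have "\<dots> \<le> 2 powr P * (w x powr P + 2 powr P)" using w0[of x] exponents by (intro powr_add_le) auto
        also have "\<dots> \<le> 4 powr P * (w x powr P + 1)"
        proof -
          have "(4::real) powr P = 2 powr P * 2 powr P" by (simp flip: powr_mult)
          moreover have "(1::real) \<le> 2 powr P" using exponents by (intro ge_one_powr_ge_zero) auto
          moreover from this have "1 * w x powr P \<le> 2 powr P * w x powr P" by (intro mult_right_mono) auto
          ultimately show ?thesis
            using mult_left_mono[of "w x powr P + 2 powr P" "2 powr P * w x powr P + 2 powr P" "2 powr P"]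
            by (simp add: distrib_left mult_ac)
        qed
        finally have "H x * \<eta> x ^ m * ((w x + 2) powr (p x - 1) * w x) \<le> H x * \<eta> x ^ m * (4 powr P * (w x powr P + 1))"
          using H0 \<eta>k by (intro mult_left_mono) auto
        also have "\<dots> = 4 powr P * (H x * (\<eta> x ^ m * w x powr P)) + 4 powr P * (H x * \<eta> x ^ m)"
          by (simp add: algebra_simps)
        also have "\<dots> \<le> 4 powr P * (H x * (\<eta> x ^ m * w x powr P)) + 4 powr P * (H x * 1)"
          using H0 \<eta>k by (intro add_left_mono mult_left_mono) auto
        finally show ?thesis unfolding uw using True by (simp add: mult_ac)
      next
        case False
        then have "x \<notin> B \<or> w x = 0" by (auto simp: w_def)
        then show ?thesis using H0 \<eta>k by auto
      qed
    qed (use H0 \<eta>k \<beta>_nonneg a'0 K0 in auto)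
    have E: "(\<integral>\<^sup>+x. ennreal (indicator B x * (indicator {x. u x > 1} x * (2 powr P * (real m * L * w x) powr p x))) \<partial>lborel)
        \<le> ennreal (E1 + 0 * \<beta>)"
      unfolding E1_def
    proof (rule nn_bound_add[OF _ _ _ _ _ _ ab(2) \<beta>_nonneg _ ub volB])
      fix x
      show "indicator B x * (indicator {x. u x > 1} x * (2 powr P * (real m * L * w x) powr p x))
          \<le> 2 powr P * (1 + real m * L) powr P * (indicator \<Omega> x * \<bar>u x\<bar> powr p x) + 0 * indicator B x"
      proof (cases "x \<in> B")
        case True
        have "(real m * L * w x) powr p x \<le> ((1 + real m * L) * \<bar>u x\<bar>) powr p x"
          using L0 pB'[OF True] w0 by (intro powr_mono2 mult_mono) auto
        also have "\<dots> = (1 + real m * L) powr p x * \<bar>u x\<bar> powr p x" using L0 by (simp add: powr_mult)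
        also have "\<dots> \<le> (1 + real m * L) powr P * \<bar>u x\<bar> powr p x"
          using L0 pB'[OF True] by (intro mult_right_mono powr_mono) auto
        finally have "2 powr P * (real m * L * w x) powr p x \<le> 2 powr P * ((1 + real m * L) powr P * \<bar>u x\<bar> powr p x)"
          by (intro mult_left_mono) auto
        then show ?thesis using True B\<Omega> by (auto simp: indicator_def mult.assoc)
      qed simp
    qed auto
    have "ennreal A' \<le> 2 * (ennreal (E1 + 0 * \<beta>) + ennreal (D1 + 4 powr P * (C1 * X powr (\<theta> / s))))"
    proof -
      have "(\<integral>\<^sup>+x. ennreal (A x) \<partial>lborel) \<le> 2 * ((\<integral>\<^sup>+x. ennreal (indicator B x * (indicator {x. u x > 1} x * (2 powr P * (real m * L * w x) powr p x))) \<partial>lborel)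
        + (\<integral>\<^sup>+x. ennreal (indicator B x * (H x * (\<bar>u x\<bar> + 1) powr (p x - 1) * (\<eta> x ^ m * w x))) \<partial>lborel))"
        unfolding A_def B_def \<eta>_def w_def
        by (rule caccioppoli[OF S pm \<Omega>, where R' = "4 * R"])
          (use R mn pB' L' in \<open>auto simp: B_def \<eta>_def\<close>)
      also have "\<dots> \<le> 2 * (ennreal (E1 + 0 * \<beta>) + ennreal (D1 + 4 powr P * (C1 * X powr (\<theta> / s))))"
        unfolding D1_def by (intro mult_left_mono add_mono D E) auto
      finally show ?thesis unfolding A'(2) .
    qed
    also have "\<dots> = ennreal (2 * (E1 + (D1 + 4 powr P * (C1 * X powr (\<theta> / s)))))"
    proof -
      define y where "y = E1 + (D1 + 4 powr P * (C1 * X powr (\<theta> / s)))"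
      have y0: "0 \<le> y" using K0 by (simp add: y_def)
      have "2 * (ennreal (E1 + 0 * \<beta>) + ennreal (D1 + 4 powr P * (C1 * X powr (\<theta> / s)))) = 2 * ennreal y"
        using K0 by (simp add: y_def flip: ennreal_plus)
      also have "\<dots> = ennreal (2 * y)" using y0 by (simp add: ennreal_mult)
      finally show ?thesis unfolding y_def .
    qed
    finally have A'le: "A' \<le> 2 * (E1 + (D1 + 4 powr P * (C1 * X powr (\<theta> / s))))"
      using K0 by (subst (asm) ennreal_le_iff) auto
    \<comment> \<open>The loop closes: the gradient is bounded by the energy, the energy by a power
      of the gradient whose exponent \<theta>/s is less than 1.\<close>
    have "X \<le> 2 powr s * \<beta> + 2 powr s * (2 * (E1 + (D1 + 4 powr P * (C1 * X powr (\<theta> / s))))) + 2 powr s * (1 + real n * L) powr s * b'"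
      using XA mult_left_mono[OF A'le powr_ge_zero[of 2 s]] by linarith
    also have "\<dots> = K1 + K2 * X powr (\<theta> / s)" unfolding K1_def K2_def by (simp add: algebra_simps)
    finally have "X \<le> Xmax"
      unfolding Xmax_def using X(1) K0 \<theta> s by (intro sublinear_bound) auto
    then have "sobolev_const * X powr (r / s) \<le> sobolev_const * Xmax powr (r / s)"
      using X(1) sobolev_const(1) exponents s by (intro mult_left_mono powr_mono2) auto
    then have Vr': "(\<integral>\<^sup>+x. ennreal (V x powr r) \<partial>lborel) \<le> ennreal (sobolev_const * Xmax powr (r / s))"
      using Vr by (meson ennreal_leI order_trans)
    show "(\<integral>\<^sup>+x. ennreal (indicator (ball c (2 * R)) x * (max 0 (u x - 1)) powr \<rho>) \<partial>lborel) \<le> ennreal Y"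
      unfolding Y_def
    proof (rule nn_bound_add[OF _ _ _ _ _ _ \<beta>_nonneg _ _ volB Vr'])
      show "indicator (ball c (2 * R)) x * (max 0 (u x - 1)) powr \<rho> \<le> 1 * indicator B x + 1 * V x powr r" for x
      proof (cases "x \<in> ball c (2 * R)")
        case True
        then have "x \<in> B" using R by (auto simp: B_def)
        have "\<eta> x = 1" unfolding \<eta>_def using True R by (intro cutoff_eq_1) auto
        then have "V x = w x" by (simp add: V_def)
        then show ?thesis
          using True \<open>x \<in> B\<close> powr_le_1_plus[of "w x" \<rho> r] w0[of x] exponents by (simp add: w_def)
      qed simp
    qed (use sobolev_const(1) in auto)
  qed
qed

end

section \<open>Iteration over rising levels and shrinking radii\<close>

context small_ball
begin

text \<open>The radii descend from 2 R to R while the levels \<open>lev K j\<close> rise from 1 to 1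
  + K. The start, level 1 on the ball of radius 2 R, is exactly what the preliminary bound
  covers.\<close>

definition rad :: "nat \<Rightarrow> real" where "rad j = R * (1 + (1 / 2) ^ j)"

definition lev :: "real \<Rightarrow> nat \<Rightarrow> real" where "lev K j = 1 + K * (1 - (1 / 2) ^ j)"

text \<open>The Hoelder exponent left for the measure of the superlevel set when the Sobolev
  exponent \<open>r\<close> is lowered to \<rho>. Together with P/s, the power contributed by the
  gradient, it adds up to \<open>1 + \<alpha>\<close>.\<close>

definition \<tau> :: real where "\<tau> = 1 - \<rho> / r"

definition \<alpha> :: real where "\<alpha> = P / s - \<rho> / r"

lemma \<tau>_pos: "0 < \<tau>" and \<alpha>_pos: "0 < \<alpha>"
proof -
  have "\<rho> / r < 1" using exponents by simp
  moreover have "1 \<le> P / s" using exponents s by simp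
  ultimately show "0 < \<tau>" "0 < \<alpha>" by (auto simp: \<tau>_def \<alpha>_def)
qed

text \<open>Above level \<open>lev K (Suc j)\<close> the excess over \<open>lev K j\<close> is at least \<open>K / 2 ^ Suc j\<close>, so \<open>u\<close>, the
  gradient of the cut off function and the constant 1 are all bounded by multiples of that excess.\<close>

lemma De_Giorgi_step:
  fixes m :: nat
  assumes mm: "2 \<le> m" "P \<le> real m" and a: "0 \<le> a"
  obtains D0 Bc where "0 < D0" "1 < Bc" "\<And>u G H j K y. subsolution \<Omega> p u G H \<Longrightarrow>
    (\<integral>\<^sup>+x. ennreal (indicator \<Omega> x * H x powr q0 x) \<partial>lborel) \<le> ennreal a \<Longrightarrow> 1 \<le> K \<Longrightarrow> 0 \<le> y \<Longrightarrow>
    (\<integral>\<^sup>+x. ennreal (indicator (ball c (rad j)) x * (max 0 (u x - lev K j)) powr \<rho>) \<partial>lborel) \<le> ennreal y \<Longrightarrow>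
    (\<integral>\<^sup>+x. ennreal (indicator (ball c (rad (Suc j))) x * (max 0 (u x - lev K (Suc j))) powr \<rho>) \<partial>lborel)
      \<le> ennreal (D0 * Bc ^ j * K powr (- (\<rho> * \<tau>)) * y powr (1 + \<alpha>))"
proof -
  \<comment> \<open>Consecutive radii differ by R / 2^(j+1), so the cutoff has gradient at most L
    2^j. This is where 8 becomes 16.\<close>
  define L where "L = 16 * (exp 1)\<^sup>2 / R"
  have L0: "0 < L" using R by (simp add: L_def)
  \<comment> \<open>The 7 bounds |u| + 1: above the higher level it is at most w + 3K, and K \<le> 2
    t w with t = 2^j, which makes 7 t w. The second summand takes care of the gradient of the
    cutoff.\<close>
  define \<Lambda> where "\<Lambda> = 7 + real m * L"
  have \<Lambda>: "7 \<le> \<Lambda>" using L0 by (simp add: \<Lambda>_def)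
  \<comment> \<open>A bound for the integral of (1 + H)^q over the ball; the extra 1 makes it
    positive, so that \<open>D0\<close> is positive.\<close>
  define h where "h = 2 powr q * 2 * \<beta> + 2 powr q * a + 1"
  have h: "0 < h" using \<beta>_nonneg a by (simp add: h_def add_nonneg_pos)
  define c1 where "c1 = 2 powr s * (2 + 2 * (2 powr P + 1))"
  have c1: "0 < c1" by (simp add: c1_def add_pos_pos)
  \<comment> \<open>The growth rate in 2^j: the exponent P \<rho>/s comes from the gradient estimate
    and \<rho> \<tau> from the measure of the superlevel set.\<close>
  define e where "e = P * (\<rho> / s) + \<rho> * \<tau>"
  have e: "0 < e" using exponents s \<tau>_pos by (simp add: e_def add_pos_pos)
  define D0 where "D0 = sobolev_const powr (\<rho> / r) * (c1 * \<Lambda> powr P * h powr (1 / q)) powr (\<rho> / s) * 2 powr (\<rho> * \<tau>)"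
  show ?thesis
  proof
    show "0 < D0" using sobolev_const(1) c1 \<Lambda> h by (simp add: D0_def)
    show "1 < 2 powr e" using e by (intro gr_one_powr) auto
    fix u G H j K y
    assume S: "subsolution \<Omega> p u G H"
      and Ha: "(\<integral>\<^sup>+x. ennreal (indicator \<Omega> x * H x powr q0 x) \<partial>lborel) \<le> ennreal a" and K: "1 \<le> K" and y: "0 \<le> y"
      and Y: "(\<integral>\<^sup>+x. ennreal (indicator (ball c (rad j)) x * (max 0 (u x - lev K j)) powr \<rho>) \<partial>lborel) \<le> ennreal y"
    define t where "t = (2::real) ^ j"
    have t: "1 \<le> t" "(1 / 2) ^ j = 1 / t" "(1 / 2) ^ Suc j = 1 / (2 * t)"
      by (simp_all add: t_def power_one_over)
    define B where "B = ball c (rad j)"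
    define r' where "r' = rad (Suc j)"
    have rr: "0 \<le> r'" "r' < rad j" "rad j \<le> 2 * R" "rad j < 4 * R" "rad j - r' = R / (2 * t)"
    proof -
      define x where "x = R * (1 / t)"
      have "0 < 1 / t" "1 / t \<le> 1" using t(1) by auto
      then have x: "0 < x" "x \<le> R" using R mult_left_mono[of "1 / t" 1 R] by (simp_all add: x_def)
      have e: "rad j = R + x" "r' = R + x / 2" unfolding r'_def rad_def t x_def by (simp_all add: distrib_left)
      show "0 \<le> r'" "r' < rad j" "rad j \<le> 2 * R" "rad j < 4 * R"
        unfolding e using R x by auto
      show "rad j - r' = R / (2 * t)" unfolding e by (simp add: x_def)
    qed
    define k where "k = lev K (Suc j)"
    define \<eta> where "\<eta> = cutoff c r' (rad j)"
    define w where "w x = max 0 (u x - lev K j)" for x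
    define w' where "w' x = max 0 (u x - k)" for x
    define i where "i x = (indicator {x. u x > k} x :: real)" for x
    define V where "V x = \<eta> x ^ m * w' x" for x
    define F where "F x = (\<eta> x ^ m * i x) *\<^sub>R G x + (real m * \<eta> x ^ (m - 1) * w' x) *\<^sub>R grad \<eta> x" for x
    have W: "W11loc \<Omega> u G" and Hm [measurable]: "H \<in> borel_measurable borel" and H0: "\<And>x. 0 \<le> H x"
      and Gint: "(\<integral>\<^sup>+x. ennreal (indicator \<Omega> x * norm (G x) powr p x) \<partial>lborel) < \<infinity>"
      using S unfolding subsolution_def by auto
    have [measurable]: "u \<in> borel_measurable borel" "G \<in> borel_measurable borel"
      using W unfolding W11loc_def by auto
    have \<eta>s: "smooth \<eta>" unfolding \<eta>_def by (rule cutoff_smooth)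
    have [measurable]: "\<eta> \<in> borel_measurable borel" "grad \<eta> \<in> borel_measurable borel"
      using smooth_measurable[OF \<eta>s] smooth_grad_measurable[OF \<eta>s] .
    have [measurable]: "B \<in> sets borel" "w \<in> borel_measurable borel" "w' \<in> borel_measurable borel" "i \<in> borel_measurable borel"
      unfolding B_def w_def[abs_def] w'_def[abs_def] i_def[abs_def] by measurable
    have [measurable]: "V \<in> borel_measurable borel" "F \<in> borel_measurable borel"
      unfolding V_def[abs_def] F_def[abs_def] by measurable
    have B\<Omega>: "B \<subseteq> \<Omega>" and Bc: "B \<subseteq> cball c (4 * R)"
      unfolding B_def using rr by (intro ball_subset; simp)+
    have pB': "s \<le> p x" "p x \<le> P" "1 \<le> p x" "0 \<le> p x" and qB': "q \<le> q0 x" if "x \<in> B" for x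
      using pB[of x] qB[of x] that Bc s by auto
    have \<eta>b: "0 \<le> \<eta> x" "\<eta> x \<le> 1" for x unfolding \<eta>_def by (rule cutoff_bounds)+
    have \<eta>k: "0 \<le> \<eta> x ^ l" "\<eta> x ^ l \<le> 1" for x l using \<eta>b[of x] by (auto simp: power_le_one)
    have \<eta>0: "\<eta> x = 0" if "x \<notin> B" for x using that rr unfolding \<eta>_def B_def by (intro cutoff_eq_0) auto
    have L': "norm (grad \<eta> x) \<le> L * t" for x
    proof -
      have "norm (grad \<eta> x) \<le> 8 * (exp 1)\<^sup>2 / (rad j - r')"
        unfolding \<eta>_def by (rule grad_cutoff_bound[OF rr(1,2)])
      also have "\<dots> = L * t" unfolding rr(5) using t(1) R by (simp add: L_def)
      finally show ?thesis .
    qed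
    have w0: "0 \<le> w x" "0 \<le> w' x" for x by (auto simp: w_def w'_def)
    have i01: "0 \<le> i x" "i x \<le> 1" "i x powr s = i x" for x using s by (auto simp: i_def indicator_def)
    have z: "(0::real) ^ m = 0" "(0::real) ^ (m - 1) = 0" using mm by (auto intro!: zero_power)
    have V_out: "V x = 0" if "x \<notin> B" for x unfolding V_def \<eta>0[OF that] z by simp
    have F_out: "F x = 0" if "x \<notin> B" for x unfolding F_def \<eta>0[OF that] z by simp
    have V0: "0 \<le> V x" for x unfolding V_def using \<eta>k w0 by simp
    have k1: "1 \<le> lev K j" "lev K j \<le> k" "k = lev K j + K / (2 * t)" "lev K j \<le> 1 + K"
    proof -
      have "0 \<le> 1 - 1 / t" "1 - 1 / t \<le> 1" using t by auto
      then show "1 \<le> lev K j" "lev K j \<le> 1 + K" unfolding lev_def t using K by (auto simp: mult_left_le)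
      show e: "k = lev K j + K / (2 * t)" unfolding k_def lev_def t using t(1) by (simp add: field_simps)
      show "lev K j \<le> k" unfolding e using K t by simp
    qed
    have WV: "W11 V F"
      unfolding V_def[abs_def] F_def[abs_def] w'_def i_def \<eta>_def
      by (rule W11_excess_cutoff[OF W rr(1,2,4) R(2) _ mm(1)]) (use k1 in simp)
    have volB: "(\<integral>\<^sup>+x. ennreal (indicator B x) \<partial>lborel) \<le> ennreal \<beta>"
      unfolding B_def using rr by (intro ball_volume) simp
    define \<kappa> where "\<kappa> = \<Lambda> * t"
    have \<kappa>0: "0 < \<kappa>" using \<Lambda> t by (simp add: \<kappa>_def)
    have big: "1 \<le> \<kappa> * w x" "\<bar>u x\<bar> + 1 \<le> \<kappa> * w x" "real m * (L * t) * w' x \<le> \<kappa> * w x" "K / (2 * t) \<le> w x" "w' x \<le> w x"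
      if ux: "u x > k" for x
    proof -
      have w: "w x = u x - lev K j" "w' x = u x - k" using ux k1 by (auto simp: w_def w'_def)
      show wK: "K / (2 * t) \<le> w x" using ux k1 w by simp
      show ww: "w' x \<le> w x" using w k1 by simp
      have K2: "K \<le> 2 * t * w x" using wK t by (simp add: field_simps)
      have tw: "w x \<le> t * w x" using t w0 by (simp add: mult_right_mono[of 1 t, simplified])
      have "\<bar>u x\<bar> + 1 \<le> w x + 3 * K" using w ux k1 K by simp
      also have "\<dots> \<le> t * w x + 3 * (2 * t * w x)" using K2 tw by linarith
      also have "\<dots> = 7 * (t * w x)" by simp
      also have "\<dots> \<le> \<Lambda> * (t * w x)" using \<Lambda> t w0 by (intro mult_right_mono) auto
      finally show u1: "\<bar>u x\<bar> + 1 \<le> \<kappa> * w x" by (simp add: \<kappa>_def mult.assoc)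
      then show "1 \<le> \<kappa> * w x" by simp
      have "real m * (L * t) * w' x \<le> real m * (L * t) * w x" using ww L0 t by (intro mult_left_mono) auto
      also have "\<dots> = (real m * L) * (t * w x)" by simp
      also have "\<dots> \<le> \<Lambda> * (t * w x)" using t w0 by (intro mult_right_mono) (auto simp: \<Lambda>_def)
      finally show "real m * (L * t) * w' x \<le> \<kappa> * w x" by (simp add: \<kappa>_def mult.assoc)
    qed
    \<comment> \<open>A common majorant for every term of the step: the cutoff term, the term with
      \<open>H\<close> and even the constant 1, since \<kappa> w \<ge> 1 above the higher level. By
      Hoelder's inequality its integral carries the power 1 - 1/q of \<open>y\<close>.\<close>
    define Sx where "Sx x = indicator B x * (i x * ((1 + H x) * (\<kappa> * w x) powr P))" for x
    have [measurable]: "Sx \<in> borel_measurable borel" unfolding Sx_def[abs_def] by measurable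
    have Sx0: "0 \<le> Sx x" for x unfolding Sx_def using i01 H0 by simp
    define Sv where "Sv = \<kappa> powr P * (h powr (1 / q) * y powr (1 - 1 / q))"
    have Sv0: "0 \<le> Sv" by (simp add: Sv_def)
    have Sint: "(\<integral>\<^sup>+x. ennreal (Sx x) \<partial>lborel) \<le> ennreal Sv"
    proof -
      define f where "f x = indicator B x * (1 + H x) powr q" for x
      define g where "g x = indicator B x * w x powr \<rho>" for x
      have [measurable]: "f \<in> borel_measurable borel" "g \<in> borel_measurable borel"
        unfolding f_def[abs_def] g_def[abs_def] by measurable
      have fg: "(\<integral>\<^sup>+x. ennreal (f x powr (1 / q) * g x powr (1 - 1 / q)) \<partial>lborel) \<le> ennreal (h powr (1 / q) * y powr (1 - 1 / q))"
      proof (rule nn_Hoelder)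
        show "(\<integral>\<^sup>+x. ennreal (f x) \<partial>lborel) \<le> ennreal h"
        proof -
          have "(\<integral>\<^sup>+x. ennreal (f x) \<partial>lborel) \<le> ennreal (2 powr q * 2 * \<beta> + 2 powr q * a)"
          proof (rule nn_bound_add[OF _ _ _ _ _ _ \<beta>_nonneg a _ volB Ha])
            show "f x \<le> 2 powr q * 2 * indicator B x + 2 powr q * (indicator \<Omega> x * H x powr q0 x)" for x
            proof (cases "x \<in> B")
              case True
              have "(1 + H x) powr q \<le> 2 powr q * (1 powr q + H x powr q)" using q H0 by (intro powr_add_le) auto
              also have "\<dots> \<le> 2 powr q * (1 + (1 + H x powr q0 x))"
                using powr_le_1_plus[OF H0[of x], of q "q0 x"] q qB'[OF True] by (intro mult_left_mono) auto
              finally show ?thesis using True B\<Omega> unfolding f_def by (auto simp: algebra_simps)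
            qed (simp add: f_def)
          qed auto
          also have "\<dots> \<le> ennreal h" by (intro ennreal_leI) (simp add: h_def)
          finally show ?thesis .
        qed
        show "(\<integral>\<^sup>+x. ennreal (g x) \<partial>lborel) \<le> ennreal y" using Y unfolding g_def w_def B_def .
        show "0 \<le> f x" "0 \<le> g x" for x by (auto simp: f_def g_def)
      qed (use q h y in auto)
      have "(\<integral>\<^sup>+x. ennreal (Sx x) \<partial>lborel) \<le> ennreal (\<kappa> powr P * (h powr (1 / q) * y powr (1 - 1 / q)) + 0 * \<beta>)"
      proof (rule nn_bound_add[OF _ _ _ _ _ _ _ \<beta>_nonneg _ fg volB])
        show "Sx x \<le> \<kappa> powr P * (f x powr (1 / q) * g x powr (1 - 1 / q)) + 0 * indicator B x" for x
        proof (cases "x \<in> B")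
          case True
          have "f x powr (1 / q) = 1 + H x" using True q H0[of x] by (simp add: f_def powr_powr)
          moreover have "g x powr (1 - 1 / q) = w x powr P"
            using True exponents(5) by (simp add: g_def powr_powr)
          moreover have "(\<kappa> * w x) powr P = \<kappa> powr P * w x powr P" using \<kappa>0 w0 by (simp add: powr_mult)
          moreover have "i x * ((1 + H x) * (\<kappa> powr P * w x powr P)) \<le> 1 * ((1 + H x) * (\<kappa> powr P * w x powr P))"
            using i01 H0[of x] by (intro mult_right_mono) auto
          ultimately show ?thesis using True by (simp add: Sx_def mult_ac)
        qed (simp add: Sx_def f_def)
      qed auto
      then show ?thesis by (simp add: Sv_def)
    qed
    have SxI: "v \<le> Sx x" if "x \<in> B" "u x > k" "v \<le> (1 + H x) * (\<kappa> * w x) powr P" for x v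
      using that by (simp add: Sx_def i_def)
    have kP: "(\<kappa> * w x) powr l \<le> (\<kappa> * w x) powr P" if "u x > k" "l \<le> P" for x l
      using big(1)[OF that(1)] that(2) by (intro powr_mono) auto
    have kH: "b * (\<kappa> * w x) powr P \<le> (1 + H x) * (\<kappa> * w x) powr P" if "b \<le> 1 + H x" for b x
      using that by (intro mult_right_mono) auto
    define A where "A x = indicator B x * (indicator {x. u x > k} x * (\<eta> x ^ m * norm (G x) powr p x))" for x
    have [measurable]: "A \<in> borel_measurable borel" unfolding A_def[abs_def] by measurable
    have A0: "0 \<le> A x" for x unfolding A_def using \<eta>k by simp
    have Aint: "(\<integral>\<^sup>+x. ennreal (A x) \<partial>lborel) \<le> ennreal (2 * (2 powr P + 1) * Sv)"
    proof -
      have E: "(\<integral>\<^sup>+x. ennreal (indicator B x * (indicator {x. u x > k} x * (2 powr P * (real m * (L * t) * w' x) powr p x))) \<partial>lborel)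
          \<le> ennreal (2 powr P * Sv + 0 * \<beta>)"
      proof (rule nn_bound_add[OF _ _ _ _ _ _ Sv0 \<beta>_nonneg _ Sint volB])
        fix x
        show "indicator B x * (indicator {x. u x > k} x * (2 powr P * (real m * (L * t) * w' x) powr p x)) \<le> 2 powr P * Sx x + 0 * indicator B x"
        proof (cases "x \<in> B \<and> u x > k")
          case True
          have "(real m * (L * t) * w' x) powr p x \<le> (\<kappa> * w x) powr p x"
            using True big(3)[of x] L0 t w0 pB'[of x] by (intro powr_mono2) auto
          also have "\<dots> \<le> (\<kappa> * w x) powr P" using True pB'[of x] by (intro kP) auto
          also have "\<dots> \<le> (1 + H x) * (\<kappa> * w x) powr P" using kH[of 1 x] H0[of x] by simp
          finally have "(real m * (L * t) * w' x) powr p x \<le> Sx x" using True by (intro SxI) auto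
          then show ?thesis using True by (simp add: mult_left_mono)
        qed (use Sx0 in auto)
      qed (use Sx0 in auto)
      have D: "(\<integral>\<^sup>+x. ennreal (indicator B x * (H x * (\<bar>u x\<bar> + 1) powr (p x - 1) * (\<eta> x ^ m * w' x))) \<partial>lborel)
          \<le> ennreal Sv"
      proof (rule order_trans[OF nn_integral_mono Sint], rule ennreal_leI)
        fix x
        show "indicator B x * (H x * (\<bar>u x\<bar> + 1) powr (p x - 1) * (\<eta> x ^ m * w' x)) \<le> Sx x"
        proof (cases "x \<in> B \<and> u x > k")
          case True
          then have x: "x \<in> B" "u x > k" by auto
          have "(\<bar>u x\<bar> + 1) powr (p x - 1) * (\<eta> x ^ m * w' x) \<le> (\<kappa> * w x) powr (p x - 1) * (1 * (\<kappa> * w x))"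
          proof (intro mult_mono powr_mono2)
            show "w' x \<le> \<kappa> * w x" using big(5)[OF x(2)] mult_right_mono[of 1 \<kappa> "w x"] \<Lambda> t w0[of x]
              mult_mono[of 1 \<Lambda> 1 t] by (simp add: \<kappa>_def)
          qed (use \<eta>k w0 \<kappa>0 big(2)[OF x(2)] pB'[OF x(1)] in auto)
          also have "\<dots> = (\<kappa> * w x) powr p x" using big(1)[OF x(2)] by (simp add: powr_diff)
          also have "\<dots> \<le> (\<kappa> * w x) powr P" using x pB'[of x] by (intro kP) auto
          finally have "H x * ((\<bar>u x\<bar> + 1) powr (p x - 1) * (\<eta> x ^ m * w' x)) \<le> H x * (\<kappa> * w x) powr P"
            using H0 by (intro mult_left_mono) auto
          also have "\<dots> \<le> (1 + H x) * (\<kappa> * w x) powr P" by (rule kH) simp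
          finally have "H x * ((\<bar>u x\<bar> + 1) powr (p x - 1) * (\<eta> x ^ m * w' x)) \<le> Sx x" by (rule SxI[OF x])
          then show ?thesis using x by (simp add: mult_ac)
        next
          case False
          then have "x \<notin> B \<or> w' x = 0" by (auto simp: w'_def)
          then show ?thesis using Sx0 by auto
        qed
      qed
      have "(\<integral>\<^sup>+x. ennreal (A x) \<partial>lborel) \<le> 2 * ((\<integral>\<^sup>+x. ennreal (indicator B x * (indicator {x. u x > k} x * (2 powr P * (real m * (L * t) * w' x) powr p x))) \<partial>lborel)
        + (\<integral>\<^sup>+x. ennreal (indicator B x * (H x * (\<bar>u x\<bar> + 1) powr (p x - 1) * (\<eta> x ^ m * w' x))) \<partial>lborel))"
        unfolding A_def B_def \<eta>_def w'_def
        by (rule caccioppoli[OF S pm \<Omega> rr(1,2,4) R(2)])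
          (use k1 mm pB' L' in \<open>auto simp: B_def \<eta>_def\<close>)
      also have "\<dots> \<le> 2 * (ennreal (2 powr P * Sv + 0 * \<beta>) + ennreal Sv)"
        by (intro mult_left_mono add_mono D E) auto
      also have "\<dots> = 2 * ennreal ((2 powr P + 1) * Sv)"
        using Sv0 by (simp add: algebra_simps flip: ennreal_plus)
      also have "\<dots> = ennreal (2 * ((2 powr P + 1) * Sv))"
        using Sv0 by (subst ennreal_mult) auto
      finally show ?thesis by (simp only: mult.assoc)
    qed
    have F_le: "norm (F x) powr s \<le> 2 powr s * 2 * Sx x + 2 powr s * A x" for x
    proof (cases "x \<in> B \<and> u x > k")
      case True
      then have x: "x \<in> B" "u x > k" by auto
      have i1: "i x = 1" using x by (simp add: i_def)
      have "norm (F x) \<le> \<eta> x ^ m * norm (G x) + real m * \<eta> x ^ (m - 1) * w' x * norm (grad \<eta> x)"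
        unfolding F_def i1 using norm_triangle_ineq[of "(\<eta> x ^ m * 1) *\<^sub>R G x" "(real m * \<eta> x ^ (m - 1) * w' x) *\<^sub>R grad \<eta> x"]
          \<eta>k w0 by (simp add: abs_mult)
      also have "real m * \<eta> x ^ (m - 1) * w' x * norm (grad \<eta> x) \<le> real m * 1 * w' x * (L * t)"
        using \<eta>k w0 L' L0 t by (intro mult_mono mult_nonneg_nonneg) auto
      also have "\<dots> \<le> \<kappa> * w x" using big(3)[OF x(2)] by (simp add: mult_ac)
      finally have "norm (F x) powr s \<le> (\<eta> x ^ m * norm (G x) + \<kappa> * w x) powr s"
        using s by (intro powr_mono2) auto
      also have "\<dots> \<le> 2 powr s * ((\<eta> x ^ m * norm (G x)) powr s + (\<kappa> * w x) powr s)"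
        using s \<eta>k \<kappa>0 w0 by (intro powr_add_le) auto
      also have "\<dots> \<le> 2 powr s * ((Sx x + A x) + Sx x)"
      proof (intro mult_left_mono add_mono)
        have "(\<kappa> * w x) powr s \<le> (\<kappa> * w x) powr P" using x exponents by (intro kP) auto
        also have "\<dots> \<le> (1 + H x) * (\<kappa> * w x) powr P" using kH[of 1 x] H0[of x] by simp
        finally show "(\<kappa> * w x) powr s \<le> Sx x" by (rule SxI[OF x])
        have "1 \<le> (\<kappa> * w x) powr P" using big(1)[OF x(2)] exponents by (intro ge_one_powr_ge_zero) auto
        also have "\<dots> \<le> (1 + H x) * (\<kappa> * w x) powr P" using kH[of 1 x] H0[of x] by simp
        finally have S1: "1 \<le> Sx x" by (rule SxI[OF x])
        have "(\<eta> x ^ m * norm (G x)) powr s = (\<eta> x ^ m) powr s * norm (G x) powr s" using \<eta>k by (simp add: powr_mult)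
        also have "\<dots> \<le> \<eta> x ^ m * (1 + norm (G x) powr p x)"
        proof (intro mult_mono)
          have "(\<eta> x ^ m) powr s \<le> (\<eta> x ^ m) powr 1" using \<eta>k s by (intro powr_mono') auto
          then show "(\<eta> x ^ m) powr s \<le> \<eta> x ^ m" using \<eta>k by simp
          show "norm (G x) powr s \<le> 1 + norm (G x) powr p x" using s pB'[OF x(1)] by (intro powr_le_1_plus) auto
        qed (use \<eta>k in auto)
        also have "\<dots> \<le> 1 + A x" using x \<eta>k by (simp add: A_def distrib_left)
        finally show "(\<eta> x ^ m * norm (G x)) powr s \<le> Sx x + A x" using S1 by simp
      qed auto
      finally show ?thesis by (simp add: algebra_simps)
    next
      case False
      have "F x = 0"
      proof (cases "x \<in> B")
        case True
        then have "i x = 0" "w' x = 0" using False by (auto simp: i_def w'_def)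
        then show ?thesis by (simp add: F_def)
      qed (rule F_out)
      then show ?thesis using Sx0[of x] A0[of x] by simp
    qed
    have FX: "(\<integral>\<^sup>+x. ennreal (norm (F x) powr s) \<partial>lborel) \<le> ennreal (c1 * Sv)"
    proof -
      have "(\<integral>\<^sup>+x. ennreal (norm (F x) powr s) \<partial>lborel) \<le> ennreal (2 powr s * 2 * Sv + 2 powr s * (2 * (2 powr P + 1) * Sv))"
        by (rule nn_bound_add[OF _ _ _ _ _ _ Sv0 _ F_le Sint Aint]) (use Sx0 A0 Sv0 in auto)
      also have "2 powr s * 2 * Sv + 2 powr s * (2 * (2 powr P + 1) * Sv) = c1 * Sv" by (simp add: c1_def algebra_simps)
      finally show ?thesis .
    qed
    have Vr: "(\<integral>\<^sup>+x. ennreal (V x powr r) \<partial>lborel) \<le> ennreal (sobolev_const * (c1 * Sv) powr (r / s))"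
    proof -
      have "(\<integral>\<^sup>+x. ennreal (\<bar>V x\<bar> powr r) \<partial>lborel) \<le> ennreal (sobolev_const * (c1 * Sv) powr (r / s))"
      proof (rule sobolev_const(2)[OF WV _ _ FX])
        show "V x = 0" if "x \<notin> ball c (4 * R)" for x
          using that rr by (intro V_out) (auto simp: B_def)
      qed (use c1 Sv0 in simp)
      then show ?thesis using V0 by simp
    qed
    \<comment> \<open>Chebyshev's inequality: above the higher level the excess over the lower one
      is at least K/(2t). The negative power of \<open>K\<close> in the recursion originates
      here.\<close>
    have vol: "(\<integral>\<^sup>+x. ennreal (indicator B x * i x) \<partial>lborel) \<le> ennreal ((2 * t / K) powr \<rho> * y)"
    proof -
      have "(\<integral>\<^sup>+x. ennreal (indicator B x * i x) \<partial>lborel) \<le> ennreal ((2 * t / K) powr \<rho> * y + 0 * \<beta>)"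
      proof (rule nn_bound_add[OF _ _ _ _ _ _ y \<beta>_nonneg _ Y volB])
        show "(\<lambda>x. indicator (ball c (rad j)) x * (max 0 (u x - lev K j)) powr \<rho>) \<in> borel_measurable lborel"
          unfolding B_def[symmetric] by measurable
        fix x
        show "indicator B x * i x \<le> (2 * t / K) powr \<rho> * (indicator (ball c (rad j)) x * (max 0 (u x - lev K j)) powr \<rho>) + 0 * indicator B x"
        proof (cases "x \<in> B \<and> u x > k")
          case True
          then have "1 \<le> 2 * t / K * w x" using big(4)[of x] K t by (simp add: field_simps)
          then have "1 \<le> (2 * t / K * w x) powr \<rho>" using exponents by (intro ge_one_powr_ge_zero) auto
          also have "\<dots> = (2 * t / K) powr \<rho> * w x powr \<rho>" by (rule powr_mult; use t K w0 in simp)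
          finally show ?thesis using True by (simp add: B_def w_def i_def)
        qed (auto simp: i_def)
      qed (use t K in auto)
      then show ?thesis by simp
    qed
    have "(\<integral>\<^sup>+x. ennreal (indicator (ball c r') x * (w' x) powr \<rho>) \<partial>lborel)
        \<le> (\<integral>\<^sup>+x. ennreal ((V x powr r) powr (\<rho> / r) * (indicator B x * i x) powr \<tau>) \<partial>lborel)"
    proof (rule nn_integral_mono, rule ennreal_leI)
      fix x
      show "indicator (ball c r') x * (w' x) powr \<rho> \<le> (V x powr r) powr (\<rho> / r) * (indicator B x * i x) powr \<tau>"
      proof (cases "x \<in> ball c r' \<and> u x > k")
        case True
        have "\<eta> x = 1" unfolding \<eta>_def using True rr by (intro cutoff_eq_1) auto
        then have "V x = w' x" by (simp add: V_def)
        moreover have "x \<in> B" using True rr by (auto simp: B_def)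
        ultimately show ?thesis using True exponents by (simp add: powr_powr i_def)
      next
        case False
        then have "x \<notin> ball c r' \<or> w' x = 0" by (auto simp: w'_def)
        then show ?thesis by auto
      qed
    qed
    \<comment> \<open>The Sobolev bound contributes y^(P/s), because (1 - 1/q) \<rho> = P, and the
      superlevel set contributes y^\<tau>.\<close>
    also have "\<dots> \<le> ennreal ((sobolev_const * (c1 * Sv) powr (r / s)) powr (\<rho> / r) * ((2 * t / K) powr \<rho> * y) powr \<tau>)"
    proof (rule nn_Hoelder[OF _ _ _ _ _ _ _ Vr vol])
      show "\<rho> / r + \<tau> = 1" by (simp add: \<tau>_def)
    qed (use exponents \<tau>_pos i01 sobolev_const(1) y in auto)
    also have "(sobolev_const * (c1 * Sv) powr (r / s)) powr (\<rho> / r) * ((2 * t / K) powr \<rho> * y) powr \<tau>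
        = D0 * (2 powr e) ^ j * K powr (- (\<rho> * \<tau>)) * y powr (1 + \<alpha>)"
    proof -
      have r0: "0 < r" using exponents by simp
      have 1: "(sobolev_const * (c1 * Sv) powr (r / s)) powr (\<rho> / r) = sobolev_const powr (\<rho> / r) * (c1 * Sv) powr (\<rho> / s)"
        using sobolev_const(1) c1 Sv0 r0 s by (simp add: powr_mult powr_powr)
      have "c1 * Sv = (c1 * \<Lambda> powr P * h powr (1 / q)) * t powr P * y powr (1 - 1 / q)"
        using \<Lambda> t by (simp add: Sv_def \<kappa>_def powr_mult mult_ac)
      then have 2: "(c1 * Sv) powr (\<rho> / s) = (c1 * \<Lambda> powr P * h powr (1 / q)) powr (\<rho> / s) * t powr (P * (\<rho> / s)) * y powr (P / s)"
      proof -
        have y': "(1 - 1 / q) * (\<rho> / s) = P / s" using exponents(5) by (simp add: mult.commute)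
        assume "c1 * Sv = (c1 * \<Lambda> powr P * h powr (1 / q)) * t powr P * y powr (1 - 1 / q)"
        then have "(c1 * Sv) powr (\<rho> / s) = (c1 * \<Lambda> powr P * h powr (1 / q)) powr (\<rho> / s) * (t powr P) powr (\<rho> / s) * (y powr (1 - 1 / q)) powr (\<rho> / s)"
          using c1 by (simp add: powr_mult)
        then show ?thesis unfolding powr_powr y' .
      qed
      have "(2 * t / K) powr (\<rho> * \<tau>) = 2 powr (\<rho> * \<tau>) * t powr (\<rho> * \<tau>) * K powr (- (\<rho> * \<tau>))"
        using powr_divide[of "2 * t" K "\<rho> * \<tau>"] t(1) K by (simp add: powr_mult powr_minus_divide)
      moreover have "((2 * t / K) powr \<rho> * y) powr \<tau> = (2 * t / K) powr (\<rho> * \<tau>) * y powr \<tau>"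
        using y by (simp add: powr_mult powr_powr)
      ultimately have 3: "((2 * t / K) powr \<rho> * y) powr \<tau> = 2 powr (\<rho> * \<tau>) * t powr (\<rho> * \<tau>) * K powr (- (\<rho> * \<tau>)) * y powr \<tau>"
        by simp
      have 4: "t powr (P * (\<rho> / s)) * t powr (\<rho> * \<tau>) = (2 powr e) ^ j"
      proof -
        have "t = 2 powr (real j)" by (simp add: t_def powr_realpow)
        then have "t powr e = (2 powr e) powr (real j)" by (simp add: powr_powr mult.commute)
        then have "t powr e = (2 powr e) ^ j" by (simp add: powr_realpow)
        then show ?thesis unfolding e_def powr_add .
      qed
      have 5: "y powr (P / s) * y powr \<tau> = y powr (1 + \<alpha>)"
      proof -
        have "P / s + \<tau> = 1 + \<alpha>" by (simp add: \<tau>_def \<alpha>_def)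
        then show ?thesis by (metis powr_add)
      qed
      show ?thesis unfolding 1 2 3 4[symmetric] 5[symmetric] D0_def by (simp add: mult_ac)
    qed
    finally show "(\<integral>\<^sup>+x. ennreal (indicator (ball c (rad (Suc j))) x * (max 0 (u x - lev K (Suc j))) powr \<rho>) \<partial>lborel)
      \<le> ennreal (D0 * (2 powr e) ^ j * K powr (- (\<rho> * \<tau>)) * y powr (1 + \<alpha>))"
      unfolding r'_def w'_def k_def .
  qed
qed

text \<open>The superlinear recursion preserves a geometric decay once its coefficient is small, and
  a large \<open>K\<close> makes it small because \<open>K\<close> enters with a negative power. In
  the limit no excess over 1 + K remains on the ball of radius R. Since the starting bound is
  uniform, so is \<open>K\<close>.\<close>

lemma local_bound:
  fixes m n :: nat
  assumes mn: "2 \<le> m" "2 \<le> n" "P \<le> real m" "real m < real n * s"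
    and \<gamma>: "(P - real m / real n) / s \<le> 1 - 1 / q - real m / real n / r"
    and ab: "0 \<le> a" "0 \<le> b"
  obtains C where "0 < C" "\<And>u G H. subsolution \<Omega> p u G H \<Longrightarrow>
    (\<integral>\<^sup>+x. ennreal (indicator \<Omega> x * H x powr q0 x) \<partial>lborel) \<le> ennreal a \<Longrightarrow>
    (\<integral>\<^sup>+x. ennreal (indicator \<Omega> x * \<bar>u x\<bar> powr p x) \<partial>lborel) \<le> ennreal b \<Longrightarrow>
    AE x in lborel. x \<in> ball c R \<longrightarrow> u x \<le> C"
proof -
  obtain Y0 where Y0: "0 \<le> Y0" "\<And>u G H. subsolution \<Omega> p u G H \<Longrightarrow>
    (\<integral>\<^sup>+x. ennreal (indicator \<Omega> x * H x powr q0 x) \<partial>lborel) \<le> ennreal a \<Longrightarrow>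
    (\<integral>\<^sup>+x. ennreal (indicator \<Omega> x * \<bar>u x\<bar> powr p x) \<partial>lborel) \<le> ennreal b \<Longrightarrow>
    (\<integral>\<^sup>+x. ennreal (indicator (ball c (2 * R)) x * (max 0 (u x - 1)) powr \<rho>) \<partial>lborel) \<le> ennreal Y0"
    by (rule higher_integrability[OF mn \<gamma> ab]) (rule that)
  obtain D0 Bc where D: "0 < D0" "1 < Bc" "\<And>u G H j K y. subsolution \<Omega> p u G H \<Longrightarrow>
    (\<integral>\<^sup>+x. ennreal (indicator \<Omega> x * H x powr q0 x) \<partial>lborel) \<le> ennreal a \<Longrightarrow> 1 \<le> K \<Longrightarrow> 0 \<le> y \<Longrightarrow>
    (\<integral>\<^sup>+x. ennreal (indicator (ball c (rad j)) x * (max 0 (u x - lev K j)) powr \<rho>) \<partial>lborel) \<le> ennreal y \<Longrightarrow>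
    (\<integral>\<^sup>+x. ennreal (indicator (ball c (rad (Suc j))) x * (max 0 (u x - lev K (Suc j))) powr \<rho>) \<partial>lborel)
      \<le> ennreal (D0 * Bc ^ j * K powr (- (\<rho> * \<tau>)) * y powr (1 + \<alpha>))"
    by (rule De_Giorgi_step[OF mn(1,3) ab(1)]) (rule that)
  \<comment> \<open>The additional 1 makes the starting value positive, as required when
    \<open>K\<close> is obtained from powers of it.\<close>
  define Y where "Y = Y0 + 1"
  have Y: "0 < Y" using Y0(1) by (simp add: Y_def)
  \<comment> \<open>The decay rate is chosen such that l^\<alpha> compensates the growth factor
    \<open>Bc\<close> exactly; the powers with exponent \<open>j\<close> then cancel in the
    induction step.\<close>
  define l where "l = Bc powr (- 1 / \<alpha>)"
  have l: "0 < l" "l < 1" "Bc * l powr \<alpha> = 1"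
  proof -
    show "0 < l" using D(2) by (simp add: l_def)
    have "Bc powr (- 1 / \<alpha>) < Bc powr 0" using D(2) \<alpha>_pos by (intro powr_less_mono) auto
    then show "l < 1" using D(2) by (simp add: l_def)
    have "- 1 / \<alpha> * \<alpha> = - 1" using \<alpha>_pos by simp
    then have "l powr \<alpha> = Bc powr (- 1)" by (simp only: l_def powr_powr)
    then show "Bc * l powr \<alpha> = 1" using D(2) by (simp add: powr_minus_divide)
  qed
  define \<delta> where "\<delta> = \<rho> * \<tau>"
  have \<delta>: "0 < \<delta>" using exponents \<tau>_pos by (simp add: \<delta>_def)
  \<comment> \<open>Solves D0 K^(-\<delta>) Y^\<alpha> \<le> l for \<open>K\<close>; the maximum
    with 1 provides the lower bound under which the step was proved.\<close>
  define K where "K = max 1 ((D0 * Y powr \<alpha> / l) powr (1 / \<delta>))"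
  have K1: "1 \<le> K" by (simp add: K_def)
  have K2: "D0 * K powr (- \<delta>) * Y powr \<alpha> \<le> l"
  proof -
    have pos: "0 < D0 * Y powr \<alpha> / l" using D(1) Y l by simp
    have "x = (x powr (1 / \<delta>)) powr \<delta>" if "0 < x" for x :: real
      using that \<delta> by (simp add: powr_powr)
    from this[OF pos] have "D0 * Y powr \<alpha> / l = ((D0 * Y powr \<alpha> / l) powr (1 / \<delta>)) powr \<delta>" .
    also have "\<dots> \<le> K powr \<delta>" using \<delta> by (intro powr_mono2) (auto simp: K_def)
    finally have "D0 * Y powr \<alpha> \<le> l * K powr \<delta>" using l by (simp add: field_simps)
    then show ?thesis using K1 by (simp add: powr_minus field_simps)
  qed
  show ?thesis
  proof
    show "0 < 1 + K" using K1 by simp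
    fix u G H
    assume S: "subsolution \<Omega> p u G H"
      and Ha: "(\<integral>\<^sup>+x. ennreal (indicator \<Omega> x * H x powr q0 x) \<partial>lborel) \<le> ennreal a"
      and ub: "(\<integral>\<^sup>+x. ennreal (indicator \<Omega> x * \<bar>u x\<bar> powr p x) \<partial>lborel) \<le> ennreal b"
    have [measurable]: "u \<in> borel_measurable borel" using S unfolding subsolution_def W11loc_def by auto
    have iter: "(\<integral>\<^sup>+x. ennreal (indicator (ball c (rad j)) x * (max 0 (u x - lev K j)) powr \<rho>) \<partial>lborel) \<le> ennreal (Y * l ^ j)" for j
    proof (induction j)
      case 0
      have "ennreal Y0 \<le> ennreal Y" by (intro ennreal_leI) (simp add: Y_def)
      then show ?case using order_trans[OF Y0(2)[OF S Ha ub]] by (simp add: rad_def lev_def mult.commute)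
    next
      case (Suc j)
      have "0 \<le> Y * l ^ j" using Y l by simp
      from D(3)[OF S Ha K1 this Suc.IH]
      have "(\<integral>\<^sup>+x. ennreal (indicator (ball c (rad (Suc j))) x * (max 0 (u x - lev K (Suc j))) powr \<rho>) \<partial>lborel)
          \<le> ennreal (D0 * Bc ^ j * K powr (- \<delta>) * (Y * l ^ j) powr (1 + \<alpha>))" by (simp add: \<delta>_def)
      also have "\<dots> \<le> ennreal (Y * l ^ Suc j)"
      proof (rule ennreal_leI)
        have lj: "(l ^ j) powr \<alpha> = (l powr \<alpha>) ^ j"
          using l by (simp add: powr_powr mult.commute flip: powr_realpow)
        have "(Y * l ^ j) powr (1 + \<alpha>) = (Y * l ^ j) * (Y powr \<alpha> * (l powr \<alpha>) ^ j)"
          using Y l by (simp add: powr_add powr_mult lj)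
        then have "D0 * Bc ^ j * K powr (- \<delta>) * (Y * l ^ j) powr (1 + \<alpha>)
            = Y * l ^ j * (D0 * K powr (- \<delta>) * Y powr \<alpha>) * (Bc ^ j * (l powr \<alpha>) ^ j)"
          by (simp add: mult_ac)
        also have "Bc ^ j * (l powr \<alpha>) ^ j = 1" using l(3) by (simp flip: power_mult_distrib)
        also have "Y * l ^ j * (D0 * K powr (- \<delta>) * Y powr \<alpha>) * 1 \<le> Y * l ^ j * l"
          using mult_left_mono[OF K2, of "Y * l ^ j"] Y l by simp
        finally show "D0 * Bc ^ j * K powr (- \<delta>) * (Y * l ^ j) powr (1 + \<alpha>) \<le> Y * l ^ Suc j"
          by (simp add: mult_ac)
      qed
      finally show ?case .
    qed
    let ?J = "\<integral>\<^sup>+x. ennreal (indicator (ball c R) x * (max 0 (u x - (1 + K))) powr \<rho>) \<partial>lborel"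
    have J: "?J \<le> ennreal (Y * l ^ j)" for j
    proof (rule order_trans[OF nn_integral_mono iter[of j]], rule ennreal_leI)
      fix x
      have "R \<le> rad j" using R by (simp add: rad_def)
      then have 1: "indicator (ball c R) x \<le> (indicator (ball c (rad j)) x :: real)" by (auto simp: indicator_def)
      have "K * (1 / 2) ^ j \<ge> 0" using K1 by simp
      then have "lev K j \<le> 1 + K" by (simp add: lev_def right_diff_distrib)
      then have 2: "(max 0 (u x - (1 + K))) powr \<rho> \<le> (max 0 (u x - lev K j)) powr \<rho>"
        using exponents by (intro powr_mono2) auto
      show "indicator (ball c R) x * (max 0 (u x - (1 + K))) powr \<rho> \<le> indicator (ball c (rad j)) x * (max 0 (u x - lev K j)) powr \<rho>"
        by (intro mult_mono 1 2) auto
    qed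
    have "(\<lambda>j. Y * l ^ j) \<longlonglongrightarrow> Y * 0" using l by (intro tendsto_mult_left LIMSEQ_realpow_zero) auto
    then have "(\<lambda>j. ennreal (Y * l ^ j)) \<longlonglongrightarrow> ennreal 0" by (intro tendsto_ennrealI) simp
    then have "?J \<le> ennreal 0" by (rule LIMSEQ_le_const) (use J in auto)
    then have "?J = 0" by simp
    moreover have [measurable]: "ball c R \<in> sets borel" by simp
    have "(\<lambda>x. ennreal (indicator (ball c R) x * (max 0 (u x - (1 + K))) powr \<rho>)) \<in> borel_measurable lborel" by measurable
    ultimately have "AE x in lborel. ennreal (indicator (ball c R) x * (max 0 (u x - (1 + K))) powr \<rho>) = 0"
      using nn_integral_0_iff_AE by blast
    then show "AE x in lborel. x \<in> ball c R \<longrightarrow> u x \<le> 1 + K"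
    proof eventually_elim
      case (elim x)
      show ?case
      proof
        assume "x \<in> ball c R"
        then have "(max 0 (u x - (1 + K))) powr \<rho> \<le> 0" using elim by (simp add: ennreal_eq_0_iff)
        then have "max 0 (u x - (1 + K)) = 0" by (metis powr_ge_zero antisym powr_eq_0_iff)
        then show "u x \<le> 1 + K" by linarith
      qed
    qed
  qed
qed

end

section \<open>Boundedness of weak subsolutions\<close>

text \<open>All conditions are strict and continuous in a perturbation \<open>e\<close> of p0, with
  s = p0 - e and P = p0 + e, and they hold for e = 0 when 1/r is chosen well. Hence they hold for
  some small positive e, and the fraction m/n is then put slightly below \<open>s\<close>.\<close>

lemma exponents_exist:
  fixes N p0 Q :: real
  assumes N: "0 < N" and p0: "1 < p0" and Q: "max 1 (N / p0) < Q"
  obtains s P q r :: real and m n :: nat where "1 < s" "s < p0" "p0 < P" "1 < q" "q < Q"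
    "P * (q / (q - 1)) < r" "N * (1 / s - 1 / r) < 1" "2 \<le> m" "2 \<le> n" "P \<le> real m"
    "real m < real n * s" "(P - real m / real n) / s \<le> 1 - 1 / q - real m / real n / r"
proof -
  obtain q where q: "max 1 (N / p0) < q" "q < Q" using dense[OF Q] by blast
  then have q1: "1 < q" and qN: "N < q * p0" using p0 by (auto simp: field_simps)
  \<comment> \<open>The number \<tau> chosen from this interval will be 1/r. Its lower end expresses
    that \<open>r\<close> is subcritical for p0, its upper end that \<open>r\<close> exceeds p0 q'.
    The interval is not empty because q p0 > N.\<close>
  have "max 0 (1 / p0 - 1 / N) < (1 - 1 / q) / p0"
  proof -
    have "1 / (q * p0) < 1 / N" using qN N q1 p0 by (intro divide_strict_left_mono) auto
    moreover have "(1 - 1 / q) / p0 = 1 / p0 - 1 / (q * p0)" by (simp add: diff_divide_distrib)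
    moreover have "0 < (1 - 1 / q) / p0" using q1 p0 by simp
    ultimately show ?thesis by simp
  qed
  then obtain \<tau> where \<tau>: "max 0 (1 / p0 - 1 / N) < \<tau>" "\<tau> < (1 - 1 / q) / p0" using dense by blast
  then have \<tau>0: "0 < \<tau>" and \<tau>1: "1 / p0 - \<tau> < 1 / N" by auto
  have \<tau>2: "p0 * \<tau> < 1 - 1 / q" using \<tau>(2) p0 by (simp add: field_simps)
  have lim: "((\<lambda>e. e) \<longlongrightarrow> 0) (at_right (0::real))" by (rule tendsto_ident_at)
  have "((\<lambda>e. p0 - 2 * e) \<longlongrightarrow> p0 - 2 * 0) (at_right 0)" by (intro tendsto_intros lim)
  then have A: "\<forall>\<^sub>F e in at_right 0. 1 < p0 - 2 * e" using p0 by (intro order_tendstoD(1)) auto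
  have "((\<lambda>e. (p0 + e) * (q / (q - 1))) \<longlongrightarrow> (p0 + 0) * (q / (q - 1))) (at_right 0)" by (intro tendsto_intros lim)
  moreover have "(p0 + 0) * (q / (q - 1)) < 1 / \<tau>"
  proof -
    have "p0 * \<tau> * q < q - 1" using \<tau>2 q1 by (simp add: field_simps)
    then show ?thesis using \<tau>0 q1 by (simp add: field_simps)
  qed
  ultimately have B: "\<forall>\<^sub>F e in at_right 0. (p0 + e) * (q / (q - 1)) < 1 / \<tau>" by (rule order_tendstoD(2))
  have "((\<lambda>e. N * (1 / (p0 - e) - \<tau>)) \<longlongrightarrow> N * (1 / (p0 - 0) - \<tau>)) (at_right 0)"
    using p0 by (intro tendsto_intros lim) auto
  moreover have "N * (1 / (p0 - 0) - \<tau>) < 1" using \<tau>1 N by (simp add: field_simps)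
  ultimately have C: "\<forall>\<^sub>F e in at_right 0. N * (1 / (p0 - e) - \<tau>) < 1" by (rule order_tendstoD(2))
  have "((\<lambda>e. 3 * e / (p0 - e) + p0 * \<tau>) \<longlongrightarrow> 3 * 0 / (p0 - 0) + p0 * \<tau>) (at_right 0)"
    using p0 by (intro tendsto_intros lim) auto
  moreover have "3 * 0 / (p0 - 0) + p0 * \<tau> < 1 - 1 / q" using \<tau>2 by simp
  ultimately have D: "\<forall>\<^sub>F e in at_right 0. 3 * e / (p0 - e) + p0 * \<tau> < 1 - 1 / q" by (rule order_tendstoD(2))
  have "\<forall>\<^sub>F e in at_right (0::real). 0 < e" by (rule eventually_at_right_less)
  with A B C D have "\<forall>\<^sub>F e in at_right (0::real). 0 < e \<and> 1 < p0 - 2 * e \<and> (p0 + e) * (q / (q - 1)) < 1 / \<tau> \<and>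
      N * (1 / (p0 - e) - \<tau>) < 1 \<and> 3 * e / (p0 - e) + p0 * \<tau> < 1 - 1 / q"
    by eventually_elim blast
  then obtain e where e: "0 < e" "1 < p0 - 2 * e" "(p0 + e) * (q / (q - 1)) < 1 / \<tau>"
      "N * (1 / (p0 - e) - \<tau>) < 1" "3 * e / (p0 - e) + p0 * \<tau> < 1 - 1 / q"
    using eventually_happens'[OF trivial_limit_at_right_real] by blast
  \<comment> \<open>The grid of width 1/n has to be finer than \<open>e\<close>, and
    \<open>n\<close> has to exceed p0 + e so that m \<ge> P follows from m > n.\<close>
  obtain n where n: "max (1 / e) (p0 + e + 3) < real n" using reals_Archimedean2 by blast
  have n0: "0 < real n" "1 < real n * e" "p0 + e + 3 < real n" using n e(1) p0 by (auto simp: field_simps)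
  \<comment> \<open>Subtracting 1 from the ceiling gives the largest integer strictly below n (p0 -
    e), so that m/n < s is strict while m/n > p0 - 2e still holds.\<close>
  define m where "m = nat (\<lceil>real n * (p0 - e)\<rceil> - 1)"
  have pos: "1 < p0 - e" using e by simp
  have "real n \<le> real n * (p0 - e)" using n0 pos by simp
  then have "1 \<le> \<lceil>real n * (p0 - e)\<rceil>" using n0 p0 e by linarith
  then have mr: "real m = real_of_int \<lceil>real n * (p0 - e)\<rceil> - 1" by (simp add: m_def)
  then have m1: "real m < real n * (p0 - e)" and "real n * (p0 - e) \<le> real m + 1" by linarith+
  then have m2: "real n * (p0 - 2 * e) < real m" using n0 by (simp add: algebra_simps)
  have "real n * 1 \<le> real n * (p0 - 2 * e)" using n0 e by (intro mult_left_mono) auto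
  then have m3: "real n < real m" using m2 by simp
  have \<theta>: "p0 - 2 * e < real m / real n" "real m / real n < p0 - e"
    using m1 m2 n0 by (auto simp: field_simps)
  show ?thesis
  proof (rule that[of "p0 - e" "p0 + e" q "1 / \<tau>" m n])
    have "(p0 + e - real m / real n) / (p0 - e) \<le> 3 * e / (p0 - e)"
      using \<theta> pos by (intro divide_right_mono) auto
    moreover have "real m / real n * \<tau> \<le> p0 * \<tau>" using \<theta> \<tau>0 e by (intro mult_right_mono) auto
    ultimately show "(p0 + e - real m / real n) / (p0 - e) \<le> 1 - 1 / q - real m / real n / (1 / \<tau>)"
      using e(5) by simp
  qed (use e pos q q1 n0 m1 m3 p0 in auto)
qed

text \<open>Continuity of the two exponents freezes them near \<open>x0\<close> up to the margins of
  \<open>exponents_exist\<close>. The radius is quantified before \<open>a\<close> and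
  \<open>b\<close>, since it depends on the exponents alone; a single finite cover then serves all
  values of the modulars.\<close>

lemma subsolution_local_bound:
  fixes \<Omega> :: "'a::euclidean_space set"
  assumes \<Omega>: "open \<Omega>" and p: "continuous_on \<Omega> p" "continuous_on \<Omega> q0"
    and p1: "1 < p x0" and q0: "max 1 (real DIM('a) / p x0) < q0 x0" and x0: "x0 \<in> \<Omega>"
  shows "\<exists>R>0. \<forall>a b. \<exists>C>0. \<forall>u G H. 0 \<le> a \<longrightarrow> 0 \<le> b \<longrightarrow> subsolution \<Omega> (\<lambda>x. if x \<in> \<Omega> then p x else 2) u G H \<longrightarrow>
    (\<integral>\<^sup>+x. ennreal (indicator \<Omega> x * H x powr q0 x) \<partial>lborel) \<le> ennreal a \<longrightarrow>
    (\<integral>\<^sup>+x. ennreal (indicator \<Omega> x * \<bar>u x\<bar> powr p x) \<partial>lborel) \<le> ennreal b \<longrightarrow>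
    (AE x in lborel. x \<in> ball x0 R \<longrightarrow> u x \<le> C)"
proof -
  obtain s P q r and m n :: nat where E: "1 < s" "s < p x0" "p x0 < P" "1 < q" "q < q0 x0"
    "P * (q / (q - 1)) < r" "real DIM('a) * (1 / s - 1 / r) < 1" "2 \<le> m" "2 \<le> n" "P \<le> real m"
    "real m < real n * s" "(P - real m / real n) / s \<le> 1 - 1 / q - real m / real n / r"
    using exponents_exist[OF _ p1 q0] by (metis DIM_positive of_nat_0_less_iff)
  have c: "(p \<longlongrightarrow> p x0) (at x0)" "(q0 \<longlongrightarrow> q0 x0) (at x0)"
    using p x0 \<Omega> by (auto simp: continuous_on_eq_continuous_at isCont_def)
  have "\<forall>\<^sub>F x in nhds x0. s < p x \<and> p x < P \<and> q < q0 x \<and> x \<in> \<Omega>"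
  proof -
    have "\<forall>\<^sub>F x in at x0. s < p x \<and> p x < P \<and> q < q0 x"
      using order_tendstoD(1)[OF c(1) E(2)] order_tendstoD(2)[OF c(1) E(3)] order_tendstoD(1)[OF c(2) E(5)]
      by eventually_elim blast
    then have "\<forall>\<^sub>F x in nhds x0. s < p x \<and> p x < P \<and> q < q0 x"
      unfolding eventually_nhds_conv_at using E by blast
    moreover have "\<forall>\<^sub>F x in nhds x0. x \<in> \<Omega>" using \<Omega> x0 by (rule eventually_nhds_in_open)
    ultimately show ?thesis by eventually_elim blast
  qed
  then obtain d where d: "0 < d" "\<And>x. dist x x0 < d \<Longrightarrow> s < p x \<and> p x < P \<and> q < q0 x \<and> x \<in> \<Omega>"
    unfolding eventually_nhds_metric by blast
  \<comment> \<open>The estimates live on the closed ball of radius 4 R = d/2, which must fit into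
    the open ball of radius d.\<close>
  define R where "R = d / 8"
  have R: "0 < R" using d by (simp add: R_def)
  have in_d: "s < p x \<and> p x < P \<and> q < q0 x \<and> x \<in> \<Omega>" if "x \<in> cball x0 (4 * R)" for x
    using that d(1) by (intro d(2)) (auto simp: R_def dist_commute)
  define p' where "p' x = (if x \<in> \<Omega> then p x else 2)" for x
  define q' where "q' x = (if x \<in> \<Omega> then q0 x else 2)" for x
  interpret small_ball \<Omega> p' q' x0 R s P q r
  proof
    show "\<Omega> \<in> sets borel" using \<Omega> by auto
    then show "p' \<in> borel_measurable borel" "q' \<in> borel_measurable borel"
      unfolding p'_def[abs_def] q'_def[abs_def] using p by (auto intro!: borel_measurable_continuous_on_if)
    show "s \<le> p' x \<and> p' x \<le> P" "q \<le> q' x" if "x \<in> cball x0 (4 * R)" for x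
      using in_d[OF that] by (auto simp: p'_def q'_def)
    show "cball x0 (4 * R) \<subseteq> \<Omega>" using in_d by auto
  qed (use E R in auto)
  have eq: "indicator \<Omega> x * y powr p' x = indicator \<Omega> x * y powr p x" "indicator \<Omega> x * y powr q' x = indicator \<Omega> x * y powr q0 x"
    for x and y :: real
    by (auto simp: indicator_def p'_def q'_def)
  show ?thesis
  proof (rule exI[of _ R], intro conjI allI R)
    fix a b :: real
    show "\<exists>C>0. \<forall>u G H. 0 \<le> a \<longrightarrow> 0 \<le> b \<longrightarrow> subsolution \<Omega> (\<lambda>x. if x \<in> \<Omega> then p x else 2) u G H \<longrightarrow>
      (\<integral>\<^sup>+x. ennreal (indicator \<Omega> x * H x powr q0 x) \<partial>lborel) \<le> ennreal a \<longrightarrow>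
      (\<integral>\<^sup>+x. ennreal (indicator \<Omega> x * \<bar>u x\<bar> powr p x) \<partial>lborel) \<le> ennreal b \<longrightarrow>
      (AE x in lborel. x \<in> ball x0 R \<longrightarrow> u x \<le> C)"
    proof (cases "0 \<le> a \<and> 0 \<le> b")
      case True
      then have ab: "0 \<le> a" "0 \<le> b" by auto
      show ?thesis
      proof (rule local_bound[OF E(8-12) ab])
        fix C :: real
        assume C: "0 < C" "\<And>u G H. subsolution \<Omega> p' u G H \<Longrightarrow>
          (\<integral>\<^sup>+x. ennreal (indicator \<Omega> x * H x powr q' x) \<partial>lborel) \<le> ennreal a \<Longrightarrow>
          (\<integral>\<^sup>+x. ennreal (indicator \<Omega> x * \<bar>u x\<bar> powr p' x) \<partial>lborel) \<le> ennreal b \<Longrightarrow>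
          AE x in lborel. x \<in> ball x0 R \<longrightarrow> u x \<le> C"
        show ?thesis
        proof (intro exI[of _ C] conjI allI impI C(1))
          fix u G H
          assume "subsolution \<Omega> (\<lambda>x. if x \<in> \<Omega> then p x else 2) u G H"
          then have S: "subsolution \<Omega> p' u G H" by (simp add: p'_def[abs_def])
          assume "(\<integral>\<^sup>+x. ennreal (indicator \<Omega> x * H x powr q0 x) \<partial>lborel) \<le> ennreal a"
            "(\<integral>\<^sup>+x. ennreal (indicator \<Omega> x * \<bar>u x\<bar> powr p x) \<partial>lborel) \<le> ennreal b"
          then show "AE x in lborel. x \<in> ball x0 R \<longrightarrow> u x \<le> C" by (rule C(2)[OF S, unfolded eq])
        qed
      qed
    qed (auto intro: exI[of _ 1])
  qed
qed

text \<open>The radii are chosen first, so compactness can be applied before the modulars are known;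
  afterwards one constant per centre is combined over a finite set.\<close>

lemma subsolution_bound_compact:
  fixes \<Omega> :: "'a::euclidean_space set"
  assumes \<Omega>: "open \<Omega>" and p: "continuous_on \<Omega> p" "continuous_on \<Omega> q0"
    and p1: "\<And>x. x \<in> \<Omega> \<Longrightarrow> 1 < p x" and q0: "\<And>x. x \<in> \<Omega> \<Longrightarrow> max 1 (real DIM('a) / p x) < q0 x"
    and K: "compact K" "K \<subseteq> \<Omega>"
  obtains C :: "real \<Rightarrow> real \<Rightarrow> real" where "\<And>a b. 0 < C a b"
    "\<And>a b u G H. 0 \<le> a \<Longrightarrow> 0 \<le> b \<Longrightarrow> subsolution \<Omega> (\<lambda>x. if x \<in> \<Omega> then p x else 2) u G H \<Longrightarrow>
      (\<integral>\<^sup>+x. ennreal (indicator \<Omega> x * H x powr q0 x) \<partial>lborel) \<le> ennreal a \<Longrightarrow>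
      (\<integral>\<^sup>+x. ennreal (indicator \<Omega> x * \<bar>u x\<bar> powr p x) \<partial>lborel) \<le> ennreal b \<Longrightarrow>
      AE x in lborel. x \<in> K \<longrightarrow> u x \<le> C a b"
proof -
  have "\<forall>x0\<in>K. \<exists>R>0. \<forall>a b. \<exists>C>0. \<forall>u G H. 0 \<le> a \<longrightarrow> 0 \<le> b \<longrightarrow> subsolution \<Omega> (\<lambda>x. if x \<in> \<Omega> then p x else 2) u G H \<longrightarrow>
    (\<integral>\<^sup>+x. ennreal (indicator \<Omega> x * H x powr q0 x) \<partial>lborel) \<le> ennreal a \<longrightarrow>
    (\<integral>\<^sup>+x. ennreal (indicator \<Omega> x * \<bar>u x\<bar> powr p x) \<partial>lborel) \<le> ennreal b \<longrightarrow>
    (AE x in lborel. x \<in> ball x0 R \<longrightarrow> u x \<le> C)"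
    using K(2) p1 q0 by (intro ballI subsolution_local_bound[OF \<Omega> p]) auto
  then obtain R where R: "\<And>x0. x0 \<in> K \<Longrightarrow> 0 < R x0" "\<forall>x0\<in>K. \<forall>a b. \<exists>C>0. \<forall>u G H. 0 \<le> a \<longrightarrow> 0 \<le> b \<longrightarrow> subsolution \<Omega> (\<lambda>x. if x \<in> \<Omega> then p x else 2) u G H \<longrightarrow>
    (\<integral>\<^sup>+x. ennreal (indicator \<Omega> x * H x powr q0 x) \<partial>lborel) \<le> ennreal a \<longrightarrow>
    (\<integral>\<^sup>+x. ennreal (indicator \<Omega> x * \<bar>u x\<bar> powr p x) \<partial>lborel) \<le> ennreal b \<longrightarrow>
    (AE x in lborel. x \<in> ball x0 (R x0) \<longrightarrow> u x \<le> C)"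
    unfolding bchoice_iff by blast
  define good where "good x0 a b c \<longleftrightarrow> 0 < c \<and> (\<forall>u G H. 0 \<le> a \<longrightarrow> 0 \<le> b \<longrightarrow> subsolution \<Omega> (\<lambda>x. if x \<in> \<Omega> then p x else 2) u G H \<longrightarrow>
    (\<integral>\<^sup>+x. ennreal (indicator \<Omega> x * H x powr q0 x) \<partial>lborel) \<le> ennreal a \<longrightarrow>
    (\<integral>\<^sup>+x. ennreal (indicator \<Omega> x * \<bar>u x\<bar> powr p x) \<partial>lborel) \<le> ennreal b \<longrightarrow>
    (AE x in lborel. x \<in> ball x0 (R x0) \<longrightarrow> u x \<le> c))" for x0 a b c
  define C where "C x0 a b = (SOME c. good x0 a b c)" for x0 a b
  have C: "good x0 a b (C x0 a b)" if "x0 \<in> K" for x0 a b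
    unfolding C_def by (rule someI_ex) (use R(2) that in \<open>auto simp: good_def\<close>)
  obtain D where D: "D \<subseteq> K" "finite D" "K \<subseteq> (\<Union>x\<in>D. ball x (R x))"
    by (rule compactE_image[OF K(1), of K "\<lambda>x. ball x (R x)"]) (use R(1) in auto)
  show ?thesis
  proof
    have pos: "0 \<le> C x a b" if "x \<in> D" for x a b using C[of x a b] that D(1) by (auto simp: good_def)
    \<comment> \<open>A sum dominates each of its nonnegative terms and avoids a maximum over a
      possibly empty set; the 1 keeps it positive in that case.\<close>
    then show "0 < 1 + (\<Sum>x\<in>D. C x a b)" for a b by (intro add_pos_nonneg sum_nonneg) auto
    fix a b u G H
    assume A: "0 \<le> a" "0 \<le> b" "subsolution \<Omega> (\<lambda>x. if x \<in> \<Omega> then p x else 2) u G H"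
      "(\<integral>\<^sup>+x. ennreal (indicator \<Omega> x * H x powr q0 x) \<partial>lborel) \<le> ennreal a"
      "(\<integral>\<^sup>+x. ennreal (indicator \<Omega> x * \<bar>u x\<bar> powr p x) \<partial>lborel) \<le> ennreal b"
    have "AE x in lborel. \<forall>y\<in>D. x \<in> ball y (R y) \<longrightarrow> u x \<le> C y a b"
    proof (intro AE_finite_allI D(2))
      fix y assume "y \<in> D"
      then have "good y a b (C y a b)" using C D(1) by blast
      then show "AE x in lborel. x \<in> ball y (R y) \<longrightarrow> u x \<le> C y a b" unfolding good_def using A by blast
    qed
    then show "AE x in lborel. x \<in> K \<longrightarrow> u x \<le> 1 + (\<Sum>x\<in>D. C x a b)"
    proof eventually_elim
      case (elim x)
      show ?case
      proof
        assume "x \<in> K"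
        then obtain y where y: "y \<in> D" "x \<in> ball y (R y)" using D(3) by blast
        then have "u x \<le> C y a b" using elim by blast
        also have "\<dots> \<le> (\<Sum>x\<in>D. C x a b)" using y D(2) pos by (intro member_le_sum) auto
        finally show "u x \<le> 1 + (\<Sum>x\<in>D. C x a b)" by simp
      qed
    qed
  qed
qed

section \<open>From the weak inequalities to subsolutions, and reflection\<close>

lemma has_weak_gradient_uminus:
  fixes u :: "'a::euclidean_space \<Rightarrow> real"
  assumes "has_weak_gradient \<Omega> u G"
  shows "has_weak_gradient \<Omega> (\<lambda>x. - u x) (\<lambda>x. - G x)"
  unfolding has_weak_gradient_def locally_integrable_def
proof (intro conjI allI impI ballI)
  note W = assms[unfolded has_weak_gradient_def locally_integrable_def]
  show "(\<lambda>x. - u x) \<in> borel_measurable (lebesgue_on \<Omega>)" "(\<lambda>x. - G x) \<in> borel_measurable (lebesgue_on \<Omega>)"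
    using W by (auto intro: borel_measurable_uminus)
  show "integrable (lebesgue_on K) (\<lambda>x. - u x)" "integrable (lebesgue_on K) (\<lambda>x. - G x)"
    if "compact K \<and> K \<subseteq> \<Omega>" for K
    using W that by (auto intro: integrable_minus)
  fix \<phi> b assume "\<phi> \<in> test_functions \<Omega>" "(b::'a) \<in> Basis"
  then have "(\<integral>x. u x * frechet_derivative \<phi> (at x) b \<partial>lebesgue_on \<Omega>) = - (\<integral>x. \<phi> x * (G x \<bullet> b) \<partial>lebesgue_on \<Omega>)"
    using W by blast
  then show "(\<integral>x. - u x * frechet_derivative \<phi> (at x) b \<partial>lebesgue_on \<Omega>) = - (\<integral>x. \<phi> x * (- G x \<bullet> b) \<partial>lebesgue_on \<Omega>)"
    by simp
qed

text \<open>For a function of constant sign one of the two parts vanishes, so the difference never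
  becomes \<infinity> - \<infinity>.\<close>

lemma ext_integral_nonpos:
  assumes "AE x in M. f x \<le> 0"
  shows "ext_integral M f = - enn2ereal (\<integral>\<^sup>+x. ennreal (- f x) \<partial>M)"
proof -
  have "(\<integral>\<^sup>+x. ennreal (f x) \<partial>M) = (\<integral>\<^sup>+x. 0 \<partial>M)"
    using assms by (intro nn_integral_cong_AE) (auto elim!: eventually_mono simp: ennreal_neg)
  then show ?thesis by (simp add: ext_integral_def zero_ennreal.rep_eq)
qed

lemma ext_integral_nonneg:
  assumes "AE x in M. 0 \<le> f x"
  shows "ext_integral M f = enn2ereal (\<integral>\<^sup>+x. ennreal (f x) \<partial>M)"
proof -
  have "(\<integral>\<^sup>+x. ennreal (- f x) \<partial>M) = (\<integral>\<^sup>+x. 0 \<partial>M)"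
    using assms by (intro nn_integral_cong_AE) (auto elim!: eventually_mono simp: ennreal_neg)
  then show ?thesis by (simp add: ext_integral_def zero_ennreal.rep_eq)
qed

text \<open>Negative values of x become 0 under \<open>ennreal\<close>, and y may be
  infinite.\<close>

lemma ennreal_le_if_ereal_le: "ereal x \<le> enn2ereal y \<Longrightarrow> ennreal x \<le> y"
  using e2ennreal_mono[of "ereal x" "enn2ereal y"] by (simp add: e2ennreal_ereal)

text \<open>Multiplication by -1 moves everything to the nonnegative side, where the term with
  \<open>H\<close> is an integral that may be infinite and the form on the left is clipped at
  0.\<close>

lemma plap_ge_inequality:
  assumes "plap_ge \<Omega> p u (\<lambda>x. - H x * (\<bar>u x\<bar> + 1) powr (p x - 1))"
    and H: "AE x in lebesgue_on \<Omega>. 0 \<le> H x" and \<phi>: "\<phi> \<in> admissible \<Omega> p"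
  shows "ennreal (\<integral>x. norm (weak_grad \<Omega> u x) powr (p x - 2) * (weak_grad \<Omega> u x \<bullet> weak_grad \<Omega> \<phi> x) \<partial>lebesgue_on \<Omega>)
    \<le> (\<integral>\<^sup>+x. ennreal (H x * (\<bar>u x\<bar> + 1) powr (p x - 1) * \<phi> x) \<partial>lebesgue_on \<Omega>)"
proof -
  have \<phi>0: "AE x in lebesgue_on \<Omega>. 0 \<le> \<phi> x" using \<phi> by (simp add: admissible_def)
  have "AE x in lebesgue_on \<Omega>. - H x * (\<bar>u x\<bar> + 1) powr (p x - 1) * \<phi> x \<le> 0"
    using H \<phi>0 by eventually_elim simp
  from ext_integral_nonpos[OF this]
  have "ext_integral (lebesgue_on \<Omega>) (\<lambda>x. - H x * (\<bar>u x\<bar> + 1) powr (p x - 1) * \<phi> x)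
      = - enn2ereal (\<integral>\<^sup>+x. ennreal (H x * (\<bar>u x\<bar> + 1) powr (p x - 1) * \<phi> x) \<partial>lebesgue_on \<Omega>)"
    by simp
  with bspec[OF assms(1)[unfolded plap_ge_def] \<phi>]
  have "ereal (- plap_form \<Omega> p u \<phi>) \<ge> - enn2ereal (\<integral>\<^sup>+x. ennreal (H x * (\<bar>u x\<bar> + 1) powr (p x - 1) * \<phi> x) \<partial>lebesgue_on \<Omega>)"
    by simp
  then have "ereal (plap_form \<Omega> p u \<phi>) \<le> enn2ereal (\<integral>\<^sup>+x. ennreal (H x * (\<bar>u x\<bar> + 1) powr (p x - 1) * \<phi> x) \<partial>lebesgue_on \<Omega>)"
    by (metis ereal_minus_le_minus uminus_ereal.simps(1))
  then show ?thesis unfolding plap_form_def by (rule ennreal_le_if_ereal_le)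
qed

text \<open>The form is odd in the gradient of \<open>u\<close>, and the term with \<open>H\<close>
  depends only on |u|. A supersolution of this kind therefore gives the first inequality for
  -u.\<close>

lemma plap_le_inequality:
  assumes "plap_le \<Omega> p u (\<lambda>x. H x * (\<bar>u x\<bar> + 1) powr (p x - 1))"
    and H: "AE x in lebesgue_on \<Omega>. 0 \<le> H x" and \<phi>: "\<phi> \<in> admissible \<Omega> p"
  shows "ennreal (\<integral>x. norm (- weak_grad \<Omega> u x) powr (p x - 2) * (- weak_grad \<Omega> u x \<bullet> weak_grad \<Omega> \<phi> x) \<partial>lebesgue_on \<Omega>)
    \<le> (\<integral>\<^sup>+x. ennreal (H x * (\<bar>- u x\<bar> + 1) powr (p x - 1) * \<phi> x) \<partial>lebesgue_on \<Omega>)"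
proof -
  have \<phi>0: "AE x in lebesgue_on \<Omega>. 0 \<le> \<phi> x" using \<phi> by (simp add: admissible_def)
  have "AE x in lebesgue_on \<Omega>. 0 \<le> H x * (\<bar>u x\<bar> + 1) powr (p x - 1) * \<phi> x"
    using H \<phi>0 by eventually_elim simp
  from ext_integral_nonneg[OF this] bspec[OF assms(1)[unfolded plap_le_def] \<phi>]
  have "ereal (- plap_form \<Omega> p u \<phi>) \<le> enn2ereal (\<integral>\<^sup>+x. ennreal (H x * (\<bar>u x\<bar> + 1) powr (p x - 1) * \<phi> x) \<partial>lebesgue_on \<Omega>)"
    by simp
  then have "ennreal (- plap_form \<Omega> p u \<phi>) \<le> (\<integral>\<^sup>+x. ennreal (H x * (\<bar>u x\<bar> + 1) powr (p x - 1) * \<phi> x) \<partial>lebesgue_on \<Omega>)"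
    by (rule ennreal_le_if_ereal_le)
  then show ?thesis unfolding plap_form_def by simp
qed

lemma ess_sup_on_le:
  assumes "\<Omega> \<in> sets borel" "\<Omega>' \<in> sets lebesgue" "\<Omega>' \<subseteq> \<Omega>" "u \<in> borel_measurable (lebesgue_on \<Omega>)"
    and "AE x in lborel. x \<in> \<Omega>' \<longrightarrow> u x \<le> C"
  shows "ess_sup_on \<Omega>' u \<le> ereal C"
  unfolding ess_sup_on_def
proof (rule esssup_I)
  have "u \<in> borel_measurable (lebesgue_on \<Omega>')" by (rule measurable_restrict_mono[OF assms(4,3)])
  then show "(\<lambda>x. ereal (u x)) \<in> borel_measurable (lebesgue_on \<Omega>')" by simp
  show "AE x in lebesgue_on \<Omega>'. ereal (u x) \<le> ereal C"
    using assms(2,5) by (simp add: AE_restrict_space_iff AE_completion_iff)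
qed

text \<open>Since the constant may depend on the modular of \<open>u\<close>, the bound holds without the
  \<open>L\<^sup>t\<close> norm on the right-hand side.\<close>

theorem proposition2p1:
  fixes \<Omega> \<Omega>' :: "'a::euclidean_space set"
    and p q0 :: "'a \<Rightarrow> real" and p1 p2 :: real
  assumes "open \<Omega>" and "bounded \<Omega>"
    and "1 < p1" and "\<And>x. x \<in> \<Omega> \<Longrightarrow> p1 \<le> p x \<and> p x \<le> p2"
    and "continuous_on (closure \<Omega>) p"
    and "log_holder \<Omega> p"
    and "continuous_on \<Omega> q0"
    and "\<And>x. x \<in> \<Omega> \<Longrightarrow> max 1 (real DIM('a) / p x) < q0 x"
    and "\<Omega>' \<in> sets lebesgue" and "compact (closure \<Omega>')" and "closure \<Omega>' \<subseteq> \<Omega>"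
  shows
    "(\<forall>u H. u \<in> W1p \<Omega> p \<and> H \<in> Lp_var \<Omega> q0 \<and> (AE x in lebesgue_on \<Omega>. 0 \<le> H x) \<and>
        plap_ge \<Omega> p u (\<lambda>x. - H x * (\<bar>u x\<bar> + 1) powr (p x - 1)) \<longrightarrow>
        ess_sup_on \<Omega>' u < \<infinity>) \<and>
     (\<forall>u H. u \<in> W1p \<Omega> p \<and> H \<in> Lp_var \<Omega> q0 \<and> (AE x in lebesgue_on \<Omega>. 0 \<le> H x) \<and>
        plap_le \<Omega> p u (\<lambda>x. H x * (\<bar>u x\<bar> + 1) powr (p x - 1)) \<longrightarrow>
        - \<infinity> < ess_inf_on \<Omega>' u) \<and>
     (\<forall>t>0. \<exists>C :: real \<Rightarrow> real \<Rightarrow> real. (\<forall>a b. 0 < C a b) \<and>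
        (\<forall>u H. u \<in> W1p \<Omega> p \<and> H \<in> Lp_var \<Omega> q0 \<and> (AE x in lebesgue_on \<Omega>. 0 \<le> H x) \<and>
           plap_ge \<Omega> p u (\<lambda>x. - H x * (\<bar>u x\<bar> + 1) powr (p x - 1)) \<longrightarrow>
           ess_sup_on \<Omega>' u
             \<le> ereal (C (modular \<Omega> q0 H) (modular \<Omega> p u)) * (1 + Lt_norm t (half_nbhd \<Omega> \<Omega>') u)) \<and>
        (\<forall>u H. u \<in> W1p \<Omega> p \<and> H \<in> Lp_var \<Omega> q0 \<and> (AE x in lebesgue_on \<Omega>. 0 \<le> H x) \<and>
           plap_le \<Omega> p u (\<lambda>x. H x * (\<bar>u x\<bar> + 1) powr (p x - 1)) \<longrightarrow>
           - (ereal (C (modular \<Omega> q0 H) (modular \<Omega> p u)) * (1 + Lt_norm t (half_nbhd \<Omega> \<Omega>') u))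
             \<le> ess_inf_on \<Omega>' u))"
proof -
  have \<Omega>b: "\<Omega> \<in> sets borel" using assms(1) by auto
  have cont: "continuous_on \<Omega> p" using assms(5) closure_subset by (rule continuous_on_subset)
  have p1: "1 < p x" "0 \<le> p x \<and> p x \<le> p2" if "x \<in> \<Omega>" for x using assms(3) assms(4)[OF that] by auto
  have \<Omega>': "\<Omega>' \<subseteq> \<Omega>" "\<Omega>' \<subseteq> closure \<Omega>'" using assms(11) closure_subset by auto
  obtain C :: "real \<Rightarrow> real \<Rightarrow> real" where C: "\<And>a b. 0 < C a b"
    "\<And>a b u G H. 0 \<le> a \<Longrightarrow> 0 \<le> b \<Longrightarrow> subsolution \<Omega> (\<lambda>x. if x \<in> \<Omega> then p x else 2) u G H \<Longrightarrow>
      (\<integral>\<^sup>+x. ennreal (indicator \<Omega> x * H x powr q0 x) \<partial>lborel) \<le> ennreal a \<Longrightarrow>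
      (\<integral>\<^sup>+x. ennreal (indicator \<Omega> x * \<bar>u x\<bar> powr p x) \<partial>lborel) \<le> ennreal b \<Longrightarrow>
      AE x in lborel. x \<in> closure \<Omega>' \<longrightarrow> u x \<le> C a b"
    by (rule subsolution_bound_compact[OF assms(1) cont assms(7) p1(1) assms(8,10,11)]) (assumption | rule that)+
  have mod0: "0 \<le> modular \<Omega> q f" for q f unfolding modular_def by simp
  have key: "ess_sup_on \<Omega>' u \<le> ereal (C (modular \<Omega> q0 H) (modular \<Omega> p u))"
    if u: "has_weak_gradient \<Omega> u G" "u \<in> Lp_var \<Omega> p" "G \<in> Lp_var \<Omega> p"
      and H: "H \<in> Lp_var \<Omega> q0" "AE x in lebesgue_on \<Omega>. 0 \<le> H x"
      and ineq: "\<And>\<phi>. \<phi> \<in> admissible \<Omega> p \<Longrightarrow>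
      ennreal (\<integral>x. norm (G x) powr (p x - 2) * (G x \<bullet> weak_grad \<Omega> \<phi> x) \<partial>lebesgue_on \<Omega>)
        \<le> (\<integral>\<^sup>+x. ennreal (H x * (\<bar>u x\<bar> + 1) powr (p x - 1) * \<phi> x) \<partial>lebesgue_on \<Omega>)" for u G H
  proof (rule subsolution_of_weak[OF assms(1,2) cont p1(2) u H ineq])
    fix u0 G0 H0
    assume S: "subsolution \<Omega> (\<lambda>x. if x \<in> \<Omega> then p x else 2) u0 G0 H0"
      "AE x in lborel. x \<in> \<Omega> \<longrightarrow> u x = u0 x"
      "(\<integral>\<^sup>+x. ennreal (indicator \<Omega> x * \<bar>u0 x\<bar> powr p x) \<partial>lborel) = ennreal (modular \<Omega> p u)"
      "(\<integral>\<^sup>+x. ennreal (indicator \<Omega> x * H0 x powr q0 x) \<partial>lborel) = ennreal (modular \<Omega> q0 H)"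
    have "AE x in lborel. x \<in> closure \<Omega>' \<longrightarrow> u0 x \<le> C (modular \<Omega> q0 H) (modular \<Omega> p u)"
      by (rule C(2)[OF mod0 mod0 S(1)]) (simp_all add: S)
    then have "AE x in lborel. x \<in> \<Omega>' \<longrightarrow> u x \<le> C (modular \<Omega> q0 H) (modular \<Omega> p u)"
      using S(2) by eventually_elim (use \<Omega>' in auto)
    then show ?thesis
      using u(2) by (intro ess_sup_on_le[OF \<Omega>b assms(9) \<Omega>'(1)]) (auto simp: Lp_var_def)
  qed
  have W: "has_weak_gradient \<Omega> u (weak_grad \<Omega> u)" "u \<in> Lp_var \<Omega> p" "weak_grad \<Omega> u \<in> Lp_var \<Omega> p"
    if "u \<in> W1p \<Omega> p" for u
    using that someI_ex[of "has_weak_gradient \<Omega> u"] unfolding W1p_def weak_grad_def by auto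
  have upper: "ess_sup_on \<Omega>' u \<le> ereal (C (modular \<Omega> q0 H) (modular \<Omega> p u))"
    if "u \<in> W1p \<Omega> p \<and> H \<in> Lp_var \<Omega> q0 \<and> (AE x in lebesgue_on \<Omega>. 0 \<le> H x) \<and>
        plap_ge \<Omega> p u (\<lambda>x. - H x * (\<bar>u x\<bar> + 1) powr (p x - 1))" for u H
    using that by (intro key[OF W] plap_ge_inequality) auto
  have lower: "- ereal (C (modular \<Omega> q0 H) (modular \<Omega> p u)) \<le> ess_inf_on \<Omega>' u"
    if A: "u \<in> W1p \<Omega> p \<and> H \<in> Lp_var \<Omega> q0 \<and> (AE x in lebesgue_on \<Omega>. 0 \<le> H x) \<and>
        plap_le \<Omega> p u (\<lambda>x. H x * (\<bar>u x\<bar> + 1) powr (p x - 1))" for u H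
  proof -
    have u: "u \<in> W1p \<Omega> p" using A by blast
    have "ess_sup_on \<Omega>' (\<lambda>x. - u x) \<le> ereal (C (modular \<Omega> q0 H) (modular \<Omega> p (\<lambda>x. - u x)))"
    proof (rule key[OF has_weak_gradient_uminus[OF W(1)[OF u]]])
      show "(\<lambda>x. - u x) \<in> Lp_var \<Omega> p" "(\<lambda>x. - weak_grad \<Omega> u x) \<in> Lp_var \<Omega> p"
        using W(2,3)[OF u] by (auto simp: Lp_var_def)
    qed (use A plap_le_inequality in auto)
    moreover have "modular \<Omega> p (\<lambda>x. - u x) = modular \<Omega> p u" by (simp add: modular_def)
    ultimately show ?thesis by (simp only: ess_inf_on_def ereal_minus_le_minus)
  qed
  \<comment> \<open>The factor is at least 1 for every \<open>t\<close>, and it is \<infinity> when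
    the norm is.\<close>
  have Lt: "ereal c \<le> ereal c * (1 + Lt_norm t A f)" if "0 < c" for c t f and A :: "'a set"
  proof -
    have "0 \<le> Lt_norm t A f" by (simp add: Lt_norm_def)
    then have "1 \<le> 1 + Lt_norm t A f" using add_left_mono[of 0 "Lt_norm t A f" 1] by simp
    then have "ereal c * 1 \<le> ereal c * (1 + Lt_norm t A f)" using that by (intro ereal_mult_left_mono) auto
    then show ?thesis by simp
  qed
  show ?thesis
  proof (intro conjI allI impI)
    show "ess_sup_on \<Omega>' u < \<infinity>"
      if "u \<in> W1p \<Omega> p \<and> H \<in> Lp_var \<Omega> q0 \<and> (AE x in lebesgue_on \<Omega>. 0 \<le> H x) \<and>
        plap_ge \<Omega> p u (\<lambda>x. - H x * (\<bar>u x\<bar> + 1) powr (p x - 1))" for u H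
      by (rule order_le_less_trans[OF upper[OF that]]) simp
    show "- \<infinity> < ess_inf_on \<Omega>' u"
      if "u \<in> W1p \<Omega> p \<and> H \<in> Lp_var \<Omega> q0 \<and> (AE x in lebesgue_on \<Omega>. 0 \<le> H x) \<and>
        plap_le \<Omega> p u (\<lambda>x. H x * (\<bar>u x\<bar> + 1) powr (p x - 1))" for u H
      by (rule order_less_le_trans[OF _ lower[OF that]]) simp
    fix t :: real
    show "\<exists>C :: real \<Rightarrow> real \<Rightarrow> real. (\<forall>a b. 0 < C a b) \<and>
        (\<forall>u H. u \<in> W1p \<Omega> p \<and> H \<in> Lp_var \<Omega> q0 \<and> (AE x in lebesgue_on \<Omega>. 0 \<le> H x) \<and>
           plap_ge \<Omega> p u (\<lambda>x. - H x * (\<bar>u x\<bar> + 1) powr (p x - 1)) \<longrightarrow>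
           ess_sup_on \<Omega>' u
             \<le> ereal (C (modular \<Omega> q0 H) (modular \<Omega> p u)) * (1 + Lt_norm t (half_nbhd \<Omega> \<Omega>') u)) \<and>
        (\<forall>u H. u \<in> W1p \<Omega> p \<and> H \<in> Lp_var \<Omega> q0 \<and> (AE x in lebesgue_on \<Omega>. 0 \<le> H x) \<and>
           plap_le \<Omega> p u (\<lambda>x. H x * (\<bar>u x\<bar> + 1) powr (p x - 1)) \<longrightarrow>
           - (ereal (C (modular \<Omega> q0 H) (modular \<Omega> p u)) * (1 + Lt_norm t (half_nbhd \<Omega> \<Omega>') u))
             \<le> ess_inf_on \<Omega>' u)"
    proof (intro exI[of _ C] conjI allI impI C(1))
      show "ess_sup_on \<Omega>' u \<le> ereal (C (modular \<Omega> q0 H) (modular \<Omega> p u)) * (1 + Lt_norm t (half_nbhd \<Omega> \<Omega>') u)"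
        if "u \<in> W1p \<Omega> p \<and> H \<in> Lp_var \<Omega> q0 \<and> (AE x in lebesgue_on \<Omega>. 0 \<le> H x) \<and>
          plap_ge \<Omega> p u (\<lambda>x. - H x * (\<bar>u x\<bar> + 1) powr (p x - 1))" for u H
        by (rule order_trans[OF upper[OF that] Lt[OF C(1)]])
      show "- (ereal (C (modular \<Omega> q0 H) (modular \<Omega> p u)) * (1 + Lt_norm t (half_nbhd \<Omega> \<Omega>') u)) \<le> ess_inf_on \<Omega>' u"
        if "u \<in> W1p \<Omega> p \<and> H \<in> Lp_var \<Omega> q0 \<and> (AE x in lebesgue_on \<Omega>. 0 \<le> H x) \<and>
          plap_le \<Omega> p u (\<lambda>x. H x * (\<bar>u x\<bar> + 1) powr (p x - 1))" for u H
        by (rule order_trans[OF _ lower[OF that]]) (use Lt[OF C(1)] in \<open>simp only: ereal_minus_le_minus\<close>)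
    qed
  qed
qed

end
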